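(* Let $b:\mathbb R^d\to\mathbb R^d$ be twice differentiable, let $\mathrm B\in\mathbb R^{d\times m}$ be a constant matrix, let $p\ge2$ and $q>1$, and set $b_\tau(x):=b(x)/(1+\tau|x|^{2q})^{1/2}$ for $x\in\mathbb R^d$, $\tau\in(0,1)$. Suppose there exist positive constants $L_0',L_7,L_8,L_9,L_3',L_4'$ such that for all $x,y,z\in\mathbb R^d$, $$2\langle x-y,b(x)-b(y)\rangle\le L_0'|x-y|^2,\qquad 2\langle x,b(x)\rangle+(2p-1)\|\mathrm B\|^2\le L_7+L_8|x|^2,$$ $$|b(x)-b(y)|\le L_9(1+|x|+|y|)^q|x-y|,\qquad |\nabla^2b(x)(y,z)|\le(L_4'|x|^{q-1}+L_3')|y||z|,$$ and that there exist positive constants $\widetilde L_1,\dots,\widetilde L_8$ and $r$, independent of $\tau$, such that for all $x\in\mathbb R^d$ and $\tau\in(0,1)$, $$2\langle x,b_\tau(x)\rangle+(2p-1)\|\mathrm B\|^2\le\widetilde L_1+\widetilde L_2|x|^2,\qquad \tau|b_\tau(x)|^2\le\widetilde L_3+\widetilde L_4|x|^2,$$ $$\sqrt\tau\,\|\mathrm B\|^2\le\widetilde L_5+\widetilde L_6|x|^2,\qquad |b(x)-b_\tau(x)|^2\le\widetilde L_7\tau^2(1+|x|^r)|b(x)|^2 .$$ Let $r_2^*=\max\{q+1+r/2,\,2q+1\}$ and let $X_0$ be $\mathscr F(0)$-measurable with $X_0\in L^{2pr_2^*}(\Omega;\mathbb R^d)$. Let $X$ be the solution of $$dX(t)=b(X(t))\,dt+\mathrm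 B\,dW(t),\quad t\ge0,\qquad X(0)=X_0,$$ and let $X_\tau$ be the process $$dX_\tau(t)=b_\tau(X_\tau(\kappa_n(t)))\,dt+\mathrm B\,dW(t),\quad t\ge0,\qquad X_\tau(0)=X_0 .$$ Then there exists a positive constant $C$, independent of $\tau$ and $n$, such that $$\mathbb E|X(t_n)-X_\tau(t_n)|^{2p}\le Ce^{Ct_n}\tau^{2p}\bigl(1+Ct_n+\mathbb E|X_0|^{2pr_2^*}\bigr),\qquad n\in\mathbb N_+ .$$
   Context: $(\Omega,\mathscr F,(\mathscr F(t))_{t\ge0},\mathbb P)$ is a complete filtered probability space carrying an $\mathbb R^m$-valued Wiener process $W$ with respect to the filtration. $\tau$ is the time step, $t_n:=n\tau$, and $\kappa_n(t):=t_n$ for $t\in[t_n,t_{n+1})$. $|\cdot|$ and $\langle\cdot,\cdot\rangle$ are the Euclidean norm and inner product, $\|\cdot\|$ is the Hilbert--Schmidt norm on $\mathbb R^{d\times m}$, and $\nabla^2b(x)(y,z)\in\mathbb R^d$ is the second derivative of $b$ at $x$ applied to $(y,z)$. The process $X_\tau$ is the continuous-time interpolation of the drift-tamed Euler--Maruyama scheme $Z_n=Z_{n-1}+\tau b_\tau(Z_{n-1})+\mathrm B(W(t_n)-W(t_{n-1}))$, $Z_0=X_0$. *)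

theory Defs
  imports "HOL-Probability.Probability"
begin

text \<open>Only the values of a filtration at times \<open>t \<ge> 0\<close> are constrained; the measure carried by
  \<open>F t\<close> is irrelevant, only its \<open>\<sigma>\<close>-algebra matters. Completeness means that \<open>M\<close> is complete and
  that \<open>F 0\<close>, hence every \<open>F t\<close>, contains all null sets; right-continuity is not required.\<close>

definition complete_filtered_prob_space :: "'a measure \<Rightarrow> (real \<Rightarrow> 'a measure) \<Rightarrow> bool" where
  "complete_filtered_prob_space M F \<longleftrightarrow>
     prob_space M \<and> complete_measure M \<and>
     (\<forall>t\<ge>0. subalgebra M (F t)) \<and>
     (\<forall>s t. 0 \<le> s \<and> s \<le> t \<longrightarrow> sets (F s) \<subseteq> sets (F t)) \<and>
     null_sets M \<subseteq> sets (F 0)"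

definition adapted_process ::
  "(real \<Rightarrow> 'a measure) \<Rightarrow> (real \<Rightarrow> 'a \<Rightarrow> 'b::topological_space) \<Rightarrow> bool" where
  "adapted_process F Y \<longleftrightarrow> (\<forall>t\<ge>0. Y t \<in> borel_measurable (F t))"

definition continuous_paths ::
  "'a measure \<Rightarrow> (real \<Rightarrow> 'a \<Rightarrow> 'b::topological_space) \<Rightarrow> bool" where
  "continuous_paths M Y \<longleftrightarrow> (AE \<omega> in M. continuous_on {0..} (\<lambda>t. Y t \<omega>))"

text \<open>The increment over \<open>[s, t]\<close> is \<open>N(0, (t - s) I)\<close>: its Lebesgue density on \<open>\<real>\<^sup>m\<close> is the product
  of one-dimensional normal densities with standard deviation \<open>sqrt (t - s)\<close>.\<close>

definition wiener_process ::
  "'a measure \<Rightarrow> (real \<Rightarrow> 'a measure) \<Rightarrow> (real \<Rightarrow> 'a \<Rightarrow> real ^ 'm) \<Rightarrow> bool" where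
  "wiener_process M F W \<longleftrightarrow>
     adapted_process F W \<and> continuous_paths M W \<and> (AE \<omega> in M. W 0 \<omega> = 0) \<and>
     (\<forall>s t. 0 \<le> s \<and> s < t \<longrightarrow>
        prob_space.indep_set M (sets (F s))
          (sets (vimage_algebra (space M) (\<lambda>\<omega>. W t \<omega> - W s \<omega>) borel)) \<and>
        distributed M lborel (\<lambda>\<omega>. W t \<omega> - W s \<omega>)
          (\<lambda>x. ennreal (\<Prod>i\<in>UNIV. normal_density 0 (sqrt (t - s)) (x $ i))))"

text \<open>\<open>X\<close> satisfies \<open>dX(t) = a(t) dt + B dW(t)\<close>, \<open>X(0) = X0\<close>, in the integrated sense. Because the
  diffusion coefficient \<open>B\<close> is a constant matrix, its Ito integral over \<open>[0, t]\<close> is the integral of a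
  simple process, namely \<open>B (W(t) - W(0))\<close>. The case \<open>t = 0\<close> of the equation is the initial condition.
  The drift \<open>a\<close> may be a functional of \<open>X\<close> itself.\<close>

definition additive_noise_sde ::
  "'a measure \<Rightarrow> (real \<Rightarrow> 'a measure) \<Rightarrow> (real \<Rightarrow> 'a \<Rightarrow> real ^ 'm) \<Rightarrow>
   (real \<Rightarrow> 'a \<Rightarrow> real ^ 'd) \<Rightarrow> real ^ 'm ^ 'd \<Rightarrow> ('a \<Rightarrow> real ^ 'd) \<Rightarrow>
   (real \<Rightarrow> 'a \<Rightarrow> real ^ 'd) \<Rightarrow> bool" where
  "additive_noise_sde M F W a B X0 X \<longleftrightarrow>
     adapted_process F X \<and> continuous_paths M X \<and>
     (AE \<omega> in M. \<forall>t\<ge>0.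
        set_integrable lborel {0..t} (\<lambda>s. a s \<omega>) \<and>
        X t \<omega> = X0 \<omega> + (LINT s:{0..t}|lborel. a s \<omega>) + B *v (W t \<omega> - W 0 \<omega>))"

definition tamed_drift ::
  "real \<Rightarrow> (real ^ 'd \<Rightarrow> real ^ 'd) \<Rightarrow> real \<Rightarrow> real ^ 'd \<Rightarrow> real ^ 'd" where
  "tamed_drift q b \<tau> x = (1 / sqrt (1 + \<tau> * norm x powr (2 * q))) *\<^sub>R b x"

text \<open>The last grid point \<open>n \<tau>\<close> not exceeding \<open>t\<close>, for \<open>t \<ge> 0\<close> and \<open>\<tau> > 0\<close>.\<close>

definition grid_floor :: "real \<Rightarrow> real \<Rightarrow> real" where
  "grid_floor \<tau> t = of_int \<lfloor>t / \<tau>\<rfloor> * \<tau>"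

definition total_deriv ::
  "('a::real_normed_vector \<Rightarrow> 'b::real_normed_vector) \<Rightarrow> 'a \<Rightarrow> 'a \<Rightarrow>\<^sub>L 'b" where
  "total_deriv f x = Blinfun (frechet_derivative f (at x))"

definition twice_differentiable ::
  "('a::real_normed_vector \<Rightarrow> 'b::real_normed_vector) \<Rightarrow> bool" where
  "twice_differentiable f \<longleftrightarrow>
     (\<forall>x. f differentiable (at x)) \<and> (\<forall>x. total_deriv f differentiable (at x))"

definition second_deriv ::
  "('a::real_normed_vector \<Rightarrow> 'b::real_normed_vector) \<Rightarrow> 'a \<Rightarrow> 'a \<Rightarrow> 'a \<Rightarrow> 'b" where
  "second_deriv f x y z = blinfun_apply (frechet_derivative (total_deriv f) (at x) y) z"

text \<open>For matrices of type \<open>real ^ 'm ^ 'd\<close> the library's \<open>norm\<close> is the Euclidean norm of all entries,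
  i.e. the Hilbert--Schmidt norm.\<close>

end

theory Submission
  imports Defs
begin

text \<open>Write \<open>e = X - X\<tau>\<close> for the error. The noise is additive and cancels in \<open>e\<close>, so that \<open>e\<close> is
differentiable inside every cell of the grid, with derivative \<open>b (X s) - b\<^sub>\<tau> z\<close>, where \<open>z\<close> is the value
of the scheme at the left end of the cell. All estimates can therefore be made path by path, with
ordinary calculus in place of Ito's formula. Probability enters in two ways only: through moments of
Gaussian increments, and through one orthogonality relation, for which the independence of the
increments of the Wiener process is used.

Moments. The process \<open>X - B (W - W 0)\<close> solves an ordinary differential equation with a random
right-hand side. Comparing \<open>b (y + w)\<close> with \<open>b w\<close>, the one-sided Lipschitz condition gives
\<open>2 \<langle>y, b (y + w)\<rangle> \<le> (L0' + 1) |y|\<^sup>2 + |b w|\<^sup>2\<close>, and Gronwall's inequality bounds \<open>|X|\<close> by the path of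
the noise (\<open>X_moment\<close>). The tamed drift is \<open>b\<close> times a factor in \<open>[0, 1]\<close>, so that it inherits this
inequality, and the growth condition on \<open>\<tau> |b\<^sub>\<tau>|\<^sup>2\<close> controls the quadratic term that the explicit
step adds (\<open>tamed_step_bound\<close>, \<open>Z_moment\<close>).

Order one. Within a cell, with \<open>\<Delta> s\<close> the increment of \<open>W\<close> since its left end,
\<open>b (X\<tau> s) - b\<^sub>\<tau> z = Db(z) B \<Delta> s + O(\<tau>)\<close> by Taylor's formula and the bound on the taming error
(\<open>local_residual_bound\<close>). The first term is only of order \<open>\<tau>\<^bsup>1/2\<^esup>\<close>. Its time integrals over the cells,
however, are martingale differences of size \<open>\<tau>\<^bsup>3/2\<^esup>\<close>, and the sum of \<open>t/\<tau>\<close> of them has size \<open>\<tau>\<close>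
(\<open>correction_moment\<close>; \<open>\<tau>\<close> has been divided out of \<open>correction\<close>). This sum is subtracted from
\<open>e\<close>. The derivative of the remaining \<open>v\<close> is \<open>b X - b X\<tau> + O(\<tau>)\<close>, and the one-sided
Lipschitz condition for \<open>e = v + \<tau> correction\<close> yields a differential inequality
\<open>(|v|\<^sup>2)' \<le> c |v|\<^sup>2 + h\<close> whose \<open>h\<close> is of order \<open>\<tau>\<^sup>2\<close> (\<open>error_energy\<close>). Gronwall's inequality on each cell,
raised to the power \<open>p\<close> and summed over the cells in expectation, gives the rate (\<open>error_step\<close>,
\<open>corrected_error_moment\<close>). The exponent \<open>r2\<close> is the growth of the local residual; the product of
\<open>correction\<close> with the local Lipschitz constant \<open>(1 + |X| + |X\<tau>|)\<^bsup>q\<^esup>\<close> is split by Young's inequality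
and needs moments of order \<open>4 p q\<close>, which is less than \<open>2 p r2\<close>.\<close>

section \<open>Inequalities for real powers\<close>

text \<open>The tangent inequality, unlike the derivative, extends to the boundary point \<open>0\<close>, where all
powers are \<open>0\<close>. Deriving the other inequalities from it avoids a special treatment of paths that hit \<open>0\<close>.\<close>

lemma powr_above_tangent:
  fixes u m k :: real
  assumes "0 \<le> u" "0 \<le> m" "1 \<le> k"
  shows "m powr k + k * m powr (k - 1) * (u - m) \<le> u powr k"
proof (cases "m = 0 \<or> u = 0")
  case True
  have "m powr k \<le> k * m powr (k - 1) * m" if "m > 0"
    using that assms by (simp add: powr_diff)
  then show ?thesis using True assms by (cases "m = 0") auto
next
  case False
  then have pos: "m > 0" "u > 0" using assms by auto
  have "(u powr k) - (m powr k) \<ge> (k * m powr (k - 1)) * (u - m)"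
  proof (rule convex_on_imp_above_tangent[where A="{0<..}"])
    show "convex_on {0<..} (\<lambda>x. x powr k)" using powr_convex assms by blast
    show "((\<lambda>x. x powr k) has_real_derivative k * m powr (k - 1)) (at m within {0<..})"
      using has_real_derivative_powr[OF pos(1)] by (rule DERIV_subset) simp
  qed (use pos in \<open>auto simp: interior_open\<close>)
  then show ?thesis by simp
qed

text \<open>Convexity with the weights \<open>1\<close> and \<open>l\<close>. The factor \<open>(1 + l) powr (k - 1)\<close> is at most \<open>exp (l * k)\<close>, so that
its use in every step of length \<open>l\<close> accumulates to an exponential of time only, whereas \<open>powr_add_le\<close> would
cost a factor \<open>2 powr k\<close> in every step.\<close>

lemma powr_weighted_sum_le:
  fixes a c l k :: real
  assumes "0 \<le> a" "0 \<le> c" "0 \<le> l" "1 \<le> k"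
  shows "(a + l * c) powr k \<le> (1 + l) powr (k - 1) * (a powr k + l * c powr k)"
proof -
  define m where "m = (a + l * c) / (1 + l)"
  have m: "0 \<le> m" "a + l * c = (1 + l) * m" using assms by (auto simp: m_def)
  have "m powr k + k * m powr (k - 1) * (a - m) \<le> a powr k"
       "l * (m powr k + k * m powr (k - 1) * (c - m)) \<le> l * c powr k"
    using assms m(1) by (auto intro!: mult_left_mono powr_above_tangent)
  then have "(1 + l) * m powr k + k * m powr (k - 1) * (a + l * c - (1 + l) * m) \<le> a powr k + l * c powr k"
    by (simp add: algebra_simps)
  then have *: "(1 + l) * m powr k \<le> a powr k + l * c powr k" using m by simp
  have "(a + l * c) powr k = (1 + l) powr k * m powr k" using assms m by (simp add: powr_mult)
  also have "\<dots> = (1 + l) powr (k - 1) * ((1 + l) * m powr k)"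
    using assms by (simp add: powr_diff)
  also have "\<dots> \<le> (1 + l) powr (k - 1) * (a powr k + l * c powr k)"
    using * by (intro mult_left_mono) auto
  finally show ?thesis .
qed

lemma powr_add_le:
  fixes a b k :: real
  assumes "0 \<le> a" "0 \<le> b" "1 \<le> k"
  shows "(a + b) powr k \<le> 2 powr k * (a powr k + b powr k)"
proof -
  have "(a + b) powr k \<le> 2 powr (k - 1) * (a powr k + b powr k)"
    using powr_weighted_sum_le[of a b 1 k] assms by simp
  also have "\<dots> \<le> 2 powr k * (a powr k + b powr k)"
    by (intro mult_right_mono powr_mono add_nonneg_nonneg) auto
  finally show ?thesis .
qed

lemma powr_add3_le:
  fixes a b c k :: real
  assumes "0 \<le> a" "0 \<le> b" "0 \<le> c" "1 \<le> k"
  shows "(a + b + c) powr k \<le> 4 powr k * (a powr k + b powr k + c powr k)"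
proof -
  have "(a + b + c) powr k \<le> 2 powr k * ((a + b) powr k + c powr k)"
    using assms by (intro powr_add_le) auto
  also have "\<dots> \<le> 2 powr k * (2 powr k * (a powr k + b powr k) + 2 powr k * c powr k)"
  proof -
    have "1 \<le> (2::real) powr k" using assms(4) by (simp add: ge_one_powr_ge_zero)
    then have "c powr k \<le> 2 powr k * c powr k"
      by (metis mult_right_mono mult_1 powr_ge_zero)
    with powr_add_le[OF assms(1,2,4)] show ?thesis by (intro mult_left_mono) auto
  qed
  also have "\<dots> = (2 powr k * 2 powr k) * (a powr k + b powr k + c powr k)"
    by (simp add: algebra_simps)
  also have "(2::real) powr k * 2 powr k = 4 powr k"
    using powr_mult[of "2::real" 2 k] by simp
  finally show ?thesis .
qed

text \<open>The tangent at \<open>v\<close> bounds \<open>v powr k\<close> with the slope at \<open>v\<close>; replacing it by the slope at \<open>u\<close> costs the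
quadratic term, by the tangent inequality for the exponent \<open>k - 1\<close>.\<close>

lemma powr_second_order_le:
  fixes u v m k :: real
  assumes "0 \<le> u" "0 \<le> v" "u \<le> m" "v \<le> m" "2 \<le> k"
  shows "v powr k \<le> u powr k + k * u powr (k - 1) * (v - u) + k * (k - 1) * m powr (k - 2) * (v - u)\<^sup>2"
proof -
  have lip: "b powr (k - 1) - a powr (k - 1) \<le> (k - 1) * m powr (k - 2) * (b - a)"
    if "0 \<le> a" "a \<le> b" "b \<le> m" for a b
  proof -
    have "b powr (k - 1) - a powr (k - 1) \<le> (k - 1) * b powr (k - 1 - 1) * (b - a)"
      using powr_above_tangent[of a b "k - 1"] that assms by (simp add: algebra_simps)
    also have "\<dots> \<le> (k - 1) * m powr (k - 2) * (b - a)"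
      using that assms by (intro mult_right_mono mult_left_mono) (auto intro!: powr_mono2)
    finally show ?thesis .
  qed
  have "(v powr (k - 1) - u powr (k - 1)) * (v - u) \<le> ((k - 1) * m powr (k - 2)) * (v - u)\<^sup>2"
  proof (cases "u \<le> v")
    case True
    have "(v powr (k - 1) - u powr (k - 1)) * (v - u) \<le> (k - 1) * m powr (k - 2) * (v - u) * (v - u)"
      using lip[of u v] True assms by (intro mult_right_mono) auto
    then show ?thesis by (simp add: power2_eq_square mult.assoc)
  next
    case False
    have "(u powr (k - 1) - v powr (k - 1)) * (u - v) \<le> (k - 1) * m powr (k - 2) * (u - v) * (u - v)"
      using lip[of v u] False assms by (intro mult_right_mono) auto
    then show ?thesis by (simp add: power2_eq_square algebra_simps)
  qed
  then have "k * ((v powr (k - 1) - u powr (k - 1)) * (v - u)) \<le> k * ((k - 1) * m powr (k - 2) * (v - u)\<^sup>2)"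
    using assms by (intro mult_left_mono) auto
  moreover have "v powr k + k * v powr (k - 1) * (u - v) \<le> u powr k"
    using assms by (intro powr_above_tangent) auto
  ultimately show ?thesis by (simp add: algebra_simps)
qed

text \<open>The previous inequality for \<open>u = |x|\<^sup>2\<close>, \<open>v = |x + y|\<^sup>2\<close> and half the exponent, since
\<open>v - u = 2 \<langle>x, y\<rangle> + |y|\<^sup>2\<close>.\<close>

lemma norm_powr_expansion_le:
  fixes x y :: "'a::real_inner"
  assumes "4 \<le> m"
  shows "norm (x + y) powr m \<le> norm x powr m + m * norm x powr (m - 2) * (x \<bullet> y)
           + m\<^sup>2 * ((norm x + norm y) powr (m - 2) * (norm y)\<^sup>2)"
proof -
  define k s where "k = m / 2" and "s = norm x + norm y"
  have s0: "0 \<le> s" "norm x \<le> s" "norm y \<le> s" by (auto simp: s_def)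
  have sq: "(z\<^sup>2) powr c = z powr (2 * c)" if "0 \<le> z" for z c :: real
    using powr_powr[of z 2 c] that by simp
  have d: "(norm (x + y))\<^sup>2 - (norm x)\<^sup>2 = 2 * (x \<bullet> y) + (norm y)\<^sup>2"
    by (simp add: power2_norm_eq_inner inner_add inner_commute)
  have "\<bar>(norm (x + y))\<^sup>2 - (norm x)\<^sup>2\<bar> \<le> 2 * (norm x * norm y) + norm y * norm y"
    using Cauchy_Schwarz_ineq2[of x y] unfolding d by (simp add: power2_eq_square abs_le_iff) (smt (verit) mult_nonneg_nonneg norm_ge_zero)
  also have "\<dots> \<le> 2 * norm y * s" by (simp add: s_def algebra_simps)
  finally have "((norm (x + y))\<^sup>2 - (norm x)\<^sup>2)\<^sup>2 \<le> (2 * norm y * s)\<^sup>2"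
    by (metis abs_ge_zero power2_abs power_mono)
  then have d2: "((norm (x + y))\<^sup>2 - (norm x)\<^sup>2)\<^sup>2 \<le> 4 * (norm y)\<^sup>2 * s\<^sup>2"
    by (simp add: power_mult_distrib)
  have s2: "s powr (m - 4) * s\<^sup>2 = s powr (m - 2)"
    using s0(1) by (cases "s = 0") (auto simp flip: powr_numeral powr_add)
  have "norm (x + y) powr m = ((norm (x + y))\<^sup>2) powr k" by (simp add: sq k_def)
  also have "\<dots> \<le> ((norm x)\<^sup>2) powr k + k * ((norm x)\<^sup>2) powr (k - 1) * ((norm (x + y))\<^sup>2 - (norm x)\<^sup>2)
      + k * (k - 1) * (s\<^sup>2) powr (k - 2) * ((norm (x + y))\<^sup>2 - (norm x)\<^sup>2)\<^sup>2"
  proof (rule powr_second_order_le)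
    show "(norm (x + y))\<^sup>2 \<le> s\<^sup>2" using norm_triangle_ineq[of x y] by (intro power_mono) (auto simp: s_def)
    show "(norm x)\<^sup>2 \<le> s\<^sup>2" using s0 by (intro power_mono) auto
  qed (use assms in \<open>auto simp: k_def\<close>)
  also have "\<dots> = norm x powr m + k * norm x powr (m - 2) * (2 * (x \<bullet> y) + (norm y)\<^sup>2)
      + k * (k - 1) * s powr (m - 4) * ((norm (x + y))\<^sup>2 - (norm x)\<^sup>2)\<^sup>2"
    unfolding d using s0 by (simp add: sq k_def algebra_simps)
  also have "\<dots> \<le> norm x powr m + k * norm x powr (m - 2) * (2 * (x \<bullet> y) + (norm y)\<^sup>2)
      + k * (k - 1) * s powr (m - 4) * (4 * (norm y)\<^sup>2 * s\<^sup>2)"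
    using d2 assms by (intro add_left_mono mult_left_mono) (auto simp: k_def)
  also have "\<dots> = norm x powr m + m * norm x powr (m - 2) * (x \<bullet> y)
      + (k * norm x powr (m - 2) * (norm y)\<^sup>2 + 4 * k * (k - 1) * (s powr (m - 4) * s\<^sup>2) * (norm y)\<^sup>2)"
    by (simp add: k_def algebra_simps)
  also have "\<dots> \<le> norm x powr m + m * norm x powr (m - 2) * (x \<bullet> y)
      + (k * s powr (m - 2) * (norm y)\<^sup>2 + 4 * k * (k - 1) * s powr (m - 2) * (norm y)\<^sup>2)"
    unfolding s2 using assms s0 by (intro add_left_mono add_right_mono mult_right_mono mult_left_mono powr_mono2) (auto simp: k_def)
  also have "\<dots> = norm x powr m + m * norm x powr (m - 2) * (x \<bullet> y)
      + (k + 4 * k * (k - 1)) * (s powr (m - 2) * (norm y)\<^sup>2)"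
    by (simp add: algebra_simps)
  also have "\<dots> \<le> norm x powr m + m * norm x powr (m - 2) * (x \<bullet> y)
      + m\<^sup>2 * (s powr (m - 2) * (norm y)\<^sup>2)"
    using assms by (intro add_left_mono mult_right_mono) (auto simp: k_def power2_eq_square algebra_simps)
  finally show ?thesis by (simp add: s_def)
qed

text \<open>If \<open>y\<close> is a martingale increment, then the term with the inner product has mean zero and the rest is of
order \<open>\<tau>\<close>, although the increment has order \<open>\<tau>\<^bsup>1/2\<^esup>\<close>. Iterated over the steps, this takes the place of the
Burkholder--Davis--Gundy inequality.\<close>

lemma norm_powr_small_increment_le:
  fixes x y :: "'a::real_inner"
  assumes "4 \<le> m" "0 \<le> \<tau>" "\<tau> \<le> 1"
  shows "norm (x + sqrt \<tau> *\<^sub>R y) powr m \<le> norm x powr m + m * norm x powr (m - 2) * (x \<bullet> (sqrt \<tau> *\<^sub>R y))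
           + m\<^sup>2 * 2 powr m * \<tau> * (norm x powr m + norm y powr m)"
proof -
  let ?s = "norm x + norm y"
  have "norm (sqrt \<tau> *\<^sub>R y) \<le> norm y" using assms
    by (simp add: mult_left_le_one_le)
  then have "(norm x + norm (sqrt \<tau> *\<^sub>R y)) powr (m - 2) * (norm (sqrt \<tau> *\<^sub>R y))\<^sup>2
     \<le> ?s powr (m - 2) * (norm (sqrt \<tau> *\<^sub>R y))\<^sup>2"
    using assms by (intro mult_right_mono powr_mono2) auto
  also have "\<dots> = \<tau> * (?s powr (m - 2) * (norm y)\<^sup>2)"
    using assms by (simp add: power_mult_distrib)
  also have "\<dots> \<le> \<tau> * (?s powr (m - 2) * ?s\<^sup>2)"
    using assms by (intro mult_left_mono power_mono) auto
  also have "?s powr (m - 2) * ?s\<^sup>2 = ?s powr m"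
    by (cases "?s = 0") (auto simp flip: powr_numeral powr_add)
  also have "\<tau> * ?s powr m \<le> \<tau> * (2 powr m * (norm x powr m + norm y powr m))"
    using assms by (intro mult_left_mono powr_add_le) auto
  finally have "m\<^sup>2 * ((norm x + norm (sqrt \<tau> *\<^sub>R y)) powr (m - 2) * (norm (sqrt \<tau> *\<^sub>R y))\<^sup>2)
      \<le> m\<^sup>2 * (\<tau> * (2 powr m * (norm x powr m + norm y powr m)))"
    by (intro mult_left_mono) auto
  then show ?thesis using norm_powr_expansion_le[OF assms(1), of x "sqrt \<tau> *\<^sub>R y"]
    by (simp add: mult_ac)
qed

text \<open>Young's inequality, arranged so that the exponent \<open>\<alpha> + \<gamma>\<close> of \<open>x\<close> on the right can be prescribed. It is used
when only finitely many moments of \<open>x\<close> are available.\<close>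

lemma product_powr_le_sum_powr:
  fixes x y \<alpha> \<beta> \<gamma> :: real
  assumes "0 \<le> x" "0 \<le> y" "0 \<le> \<alpha>" "0 \<le> \<beta>" "0 < \<gamma>"
  shows "x powr \<alpha> * y powr \<beta> \<le> x powr (\<alpha> + \<gamma>) + y powr (\<beta> * (\<alpha> + \<gamma>) / \<gamma>)"
proof (cases "y powr \<beta> \<le> x powr \<gamma>")
  case True
  then have "x powr \<alpha> * y powr \<beta> \<le> x powr \<alpha> * x powr \<gamma>" by (intro mult_left_mono) auto
  then show ?thesis by (simp add: powr_add add_increasing2)
next
  case False
  have "x = (x powr \<gamma>) powr (1 / \<gamma>)" using assms by (simp add: powr_powr)
  also have "\<dots> \<le> (y powr \<beta>) powr (1 / \<gamma>)" using False assms by (intro powr_mono2) auto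
  finally have "x powr \<alpha> \<le> (y powr (\<beta> / \<gamma>)) powr \<alpha>" using assms by (intro powr_mono2) (auto simp: powr_powr)
  then have "x powr \<alpha> * y powr \<beta> \<le> y powr (\<beta> / \<gamma> * \<alpha>) * y powr \<beta>"
    by (intro mult_right_mono) (auto simp: powr_powr)
  also have "\<dots> = y powr (\<beta> * (\<alpha> + \<gamma>) / \<gamma>)"
    using assms by (simp flip: powr_add add: field_simps)
  finally show ?thesis by (simp add: add_increasing)
qed

text \<open>Jensen's inequality, by integrating the tangent inequality at the mean value of \<open>f\<close>.\<close>

lemma powr_integral_le:
  fixes f :: "real \<Rightarrow> real"
  assumes "a < b" "1 \<le> k" "continuous_on {a..b} f" "\<And>s. s \<in> {a..b} \<Longrightarrow> 0 \<le> f s"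
  shows "(integral {a..b} f / (b - a)) powr k \<le> integral {a..b} (\<lambda>s. f s powr k) / (b - a)"
proof -
  define m where "m = integral {a..b} f / (b - a)"
  have int: "f integrable_on {a..b}" "(\<lambda>s. f s powr k) integrable_on {a..b}"
    using assms by (auto intro!: integrable_continuous_real continuous_on_powr')
  have m0: "0 \<le> m" using assms by (auto simp: m_def intro!: divide_nonneg_nonneg integral_nonneg int)
  have "integral {a..b} (\<lambda>s. m powr k + k * m powr (k - 1) * (f s - m)) \<le> integral {a..b} (\<lambda>s. f s powr k)"
    using assms m0 by (intro integral_le int powr_above_tangent integrable_continuous_real continuous_intros) auto
  also have "integral {a..b} (\<lambda>s. m powr k + k * m powr (k - 1) * (f s - m))
      = integral {a..b} (\<lambda>s. (m powr k - k * m powr (k - 1) * m) + (k * m powr (k - 1)) * f s)"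
    by (simp add: algebra_simps)
  also have "\<dots> = (b - a) * (m powr k - k * m powr (k - 1) * m) + (k * m powr (k - 1)) * integral {a..b} f"
    using assms int(1) integrable_on_cmult_left[OF int(1), of "k * m powr (k - 1)"] by (subst integral_add) auto
  also have "integral {a..b} f = (b - a) * m" using assms by (simp add: m_def)
  finally have "(b - a) * m powr k \<le> integral {a..b} (\<lambda>s. f s powr k)" by (simp add: algebra_simps)
  then show ?thesis using assms by (simp add: m_def[symmetric] pos_le_divide_eq mult.commute)
qed

section \<open>Gronwall inequalities for paths\<close>

text \<open>The function \<open>exp (- c * (s - a)) * |v s|\<^sup>2\<close> has a derivative of at most \<open>h s\<close>.\<close>

lemma norm_square_gronwall:
  fixes v f :: "real \<Rightarrow> 'a::real_inner"
  assumes ab: "a \<le> b" and c: "0 \<le> c"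
    and v: "\<And>s. s \<in> {a..b} \<Longrightarrow> (v has_vector_derivative f s) (at s within {a..b})"
    and f: "\<And>s. s \<in> {a..b} \<Longrightarrow> 2 * (v s \<bullet> f s) \<le> c * (norm (v s))\<^sup>2 + h s"
    and h: "continuous_on {a..b} h" "\<And>s. s \<in> {a..b} \<Longrightarrow> 0 \<le> h s"
  shows "(norm (v b))\<^sup>2 \<le> exp (c * (b - a)) * ((norm (v a))\<^sup>2 + integral {a..b} h)"
proof -
  define \<phi> where "\<phi> s = exp (- c * (s - a)) * (v s \<bullet> v s)" for s
  define \<phi>' where "\<phi>' s = exp (- c * (s - a)) * (2 * (v s \<bullet> f s)) - c * exp (- c * (s - a)) * (v s \<bullet> v s)" for s
  have d: "(\<phi> has_vector_derivative \<phi>' s) (at s within {a..b})" if "s \<in> {a..b}" for s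
  proof -
    have "((\<lambda>s. v s \<bullet> v s) has_derivative (\<lambda>t. v s \<bullet> (t *\<^sub>R f s) + (t *\<^sub>R f s) \<bullet> v s)) (at s within {a..b})"
      using v[OF that] unfolding has_vector_derivative_def by (intro has_derivative_inner)
    moreover have "((\<lambda>s. exp (- c * (s - a))) has_derivative (\<lambda>t. t * (- c * exp (- c * (s - a))))) (at s within {a..b})"
      by (auto intro!: derivative_eq_intros)
    ultimately have "(\<phi> has_derivative (\<lambda>t. exp (- c * (s - a)) * (v s \<bullet> (t *\<^sub>R f s) + (t *\<^sub>R f s) \<bullet> v s)
        + t * (- c * exp (- c * (s - a))) * (v s \<bullet> v s))) (at s within {a..b})"
      unfolding \<phi>_def by (rule has_derivative_mult[rotated])
    then show ?thesis unfolding has_vector_derivative_def \<phi>'_def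
      by (rule has_derivative_eq_rhs) (auto simp: algebra_simps inner_commute)
  qed
  have "\<phi>' s \<le> h s" if "s \<in> {a..b}" for s
  proof -
    have e: "exp (- c * (s - a)) \<le> 1" using that c by auto
    have "\<phi>' s = exp (- c * (s - a)) * (2 * (v s \<bullet> f s) - c * (norm (v s))\<^sup>2)"
      by (simp add: \<phi>'_def power2_norm_eq_inner algebra_simps)
    also have "\<dots> \<le> exp (- c * (s - a)) * h s" using f[OF that] by (intro mult_left_mono) auto
    also have "\<dots> \<le> h s" using mult_right_mono[OF e h(2)[OF that]] by simp
    finally show ?thesis .
  qed
  moreover have "(\<phi>' has_integral (\<phi> b - \<phi> a)) {a..b}"
    by (rule fundamental_theorem_of_calculus[OF ab]) (use d in auto)
  moreover have "(h has_integral integral {a..b} h) {a..b}"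
    using h(1) by (intro integrable_integral integrable_continuous_real)
  ultimately have "\<phi> b - \<phi> a \<le> integral {a..b} h" by (metis has_integral_le)
  then have "exp (- c * (b - a)) * (norm (v b))\<^sup>2 \<le> (norm (v a))\<^sup>2 + integral {a..b} h"
    by (simp add: \<phi>_def power2_norm_eq_inner)
  then have "exp (c * (b - a)) * (exp (- c * (b - a)) * (norm (v b))\<^sup>2) \<le> exp (c * (b - a)) * ((norm (v a))\<^sup>2 + integral {a..b} h)"
    by (intro mult_left_mono) auto
  then show ?thesis by (simp flip: mult.assoc exp_add)
qed

text \<open>The factor in front of \<open>norm (v a)\<close> is a pure exponential of the length of the interval, so that the
estimate can be iterated over arbitrarily many short intervals.\<close>

lemma norm_powr_gronwall:
  fixes v f :: "real \<Rightarrow> 'a::real_inner"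
  assumes ab: "a < b" and c: "0 \<le> c" and k: "1 \<le> k"
    and v: "\<And>s. s \<in> {a..b} \<Longrightarrow> (v has_vector_derivative f s) (at s within {a..b})"
    and f: "\<And>s. s \<in> {a..b} \<Longrightarrow> 2 * (v s \<bullet> f s) \<le> c * (norm (v s))\<^sup>2 + h s"
    and h: "continuous_on {a..b} h" "\<And>s. s \<in> {a..b} \<Longrightarrow> 0 \<le> h s"
  shows "norm (v b) powr (2 * k)
           \<le> exp ((c + 1) * k * (b - a)) * (norm (v a) powr (2 * k) + integral {a..b} (\<lambda>s. h s powr k))"
proof -
  have sq: "z powr (2 * k) = (z\<^sup>2) powr k" if "0 \<le> z" for z :: real
    using powr_powr[of z 2 k] that by simp
  define l where "l = b - a"
  define A where "A = integral {a..b} h / l"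
  have l: "0 < l" using ab by (simp add: l_def)
  have A0: "0 \<le> A" unfolding A_def using l h
    by (intro divide_nonneg_nonneg integral_nonneg integrable_continuous_real) auto
  have iA: "integral {a..b} h = l * A" using l by (simp add: A_def)
  have "norm (v b) powr (2 * k) = ((norm (v b))\<^sup>2) powr k" by (simp add: sq)
  also have "\<dots> \<le> (exp (c * l) * ((norm (v a))\<^sup>2 + l * A)) powr k"
    using norm_square_gronwall[OF less_imp_le[OF ab] c v f h] k iA
    by (intro powr_mono2) (auto simp: l_def)
  also have "\<dots> = exp (c * l * k) * ((norm (v a))\<^sup>2 + l * A) powr k"
    using l A0 by (subst powr_mult) (auto simp: exp_powr_real)
  also have "\<dots> \<le> exp (c * l * k) * ((1 + l) powr (k - 1) * (norm (v a) powr (2 * k) + l * A powr k))"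
    using powr_weighted_sum_le[of "(norm (v a))\<^sup>2" A l k] l A0 k
    by (intro mult_left_mono) (auto simp: sq)
  also have "\<dots> \<le> exp (c * l * k) * (exp (l * k) * (norm (v a) powr (2 * k) + integral {a..b} (\<lambda>s. h s powr k)))"
  proof (intro mult_left_mono mult_mono add_left_mono)
    have "(1 + l) powr (k - 1) \<le> exp l powr (k - 1)" using l k by (intro powr_mono2) auto
    also have "\<dots> \<le> exp (l * k)" using l k by (simp add: exp_powr_real)
    finally show "(1 + l) powr (k - 1) \<le> exp (l * k)" .
    show "l * A powr k \<le> integral {a..b} (\<lambda>s. h s powr k)"
      using powr_integral_le[OF ab k h] l by (simp add: A_def l_def pos_le_divide_eq mult.commute)
  qed (use l in auto)
  also have "\<dots> = exp ((c + 1) * k * l) * (norm (v a) powr (2 * k) + integral {a..b} (\<lambda>s. h s powr k))"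
    by (simp add: algebra_simps exp_add)
  finally show ?thesis by (simp add: l_def)
qed

section \<open>Deterministic estimates for the drift\<close>

text \<open>The conditions on the drift alone. They are kept apart from the probability space because the estimates
of this section concern single vectors.\<close>

locale tamed_drift_conditions =
  fixes b :: "real ^ 'd \<Rightarrow> real ^ 'd" and q r L0' L3' L4' L9 K3 K4 K7 r2 :: real
  assumes q: "q > 1"
    and b2: "twice_differentiable b"
    and const_pos: "L0' > 0" "L9 > 0" "L3' > 0" "L4' > 0" "K3 > 0" "K4 > 0" "K7 > 0" "r > 0"
    and one_sided_Lipschitz: "2 * ((x - y) \<bullet> (b x - b y)) \<le> L0' * (norm (x - y))\<^sup>2"
    and polynomial_Lipschitz: "norm (b x - b y) \<le> L9 * (1 + norm x + norm y) powr q * norm (x - y)"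
    and second_deriv_growth: "norm (second_deriv b x y z)
           \<le> (L4' * norm x powr (q - 1) + L3') * norm y * norm z"
    and tamed_growth: "\<tau> \<in> {0<..<1} \<Longrightarrow>
           \<tau> * (norm (tamed_drift q b \<tau> x))\<^sup>2 \<le> K3 + K4 * (norm x)\<^sup>2"
    and taming_error: "\<tau> \<in> {0<..<1} \<Longrightarrow>
           (norm (b x - tamed_drift q b \<tau> x))\<^sup>2
             \<le> K7 * \<tau>\<^sup>2 * (1 + norm x powr r) * (norm (b x))\<^sup>2"
    and r2: "r2 = max (q + 1 + r / 2) (2 * q + 1)"
begin

lemma r2_bounds: "q + 1 + r / 2 \<le> r2" "2 * q + 1 \<le> r2" "3 < r2"
  using r2 q by auto

lemma has_derivative_total_deriv: "(b has_derivative blinfun_apply (total_deriv b x)) (at x within S)"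
proof -
  have "b differentiable (at x)" using b2 by (simp add: twice_differentiable_def)
  then have "(b has_derivative frechet_derivative b (at x)) (at x)"
    by (simp add: frechet_derivative_works)
  moreover from this have "blinfun_apply (total_deriv b x) = frechet_derivative b (at x)"
    unfolding total_deriv_def by (intro bounded_linear_Blinfun_apply has_derivative_bounded_linear)
  ultimately show ?thesis by (simp add: has_derivative_at_withinI)
qed

lemma continuous_on_b: "continuous_on S b"
  using has_derivative_total_deriv by (intro has_derivative_continuous_on) auto

lemma continuous_on_total_deriv: "continuous_on S (total_deriv b)"
proof -
  have "isCont (total_deriv b) x" for x
    using b2 by (intro differentiable_imp_continuous_within) (auto simp: twice_differentiable_def)
  then show ?thesis by (simp add: continuous_at_imp_continuous_on)
qed

lemma drift_growth: "\<exists>C\<ge>1. \<forall>x. norm (b x) \<le> C * (1 + norm x) powr (q + 1)"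
proof (intro exI[of _ "1 + norm (b 0) + L9"] conjI allI)
  fix x
  have "norm (b x) \<le> norm (b 0) + norm (b x - b 0)" using norm_triangle_ineq[of "b 0" "b x - b 0"] by simp
  also have "norm (b x - b 0) \<le> L9 * (1 + norm x) powr q * norm x"
    using polynomial_Lipschitz[of x 0] by simp
  also have "\<dots> \<le> L9 * (1 + norm x) powr q * (1 + norm x)"
    using const_pos by (intro mult_left_mono) auto
  also have "\<dots> = L9 * (1 + norm x) powr (q + 1)" by (simp add: powr_add powr_one_gt_zero_iff add_pos_nonneg)
  also have "norm (b 0) \<le> norm (b 0) * (1 + norm x) powr (q + 1)"
    using q by (simp add: mult_le_cancel_left1 ge_one_powr_ge_zero)
  finally show "norm (b x) \<le> (1 + norm (b 0) + L9) * (1 + norm x) powr (q + 1)"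
    by (simp add: algebra_simps add_increasing)
qed (use const_pos in auto)

text \<open>A derivative is bounded by the local Lipschitz constant at its point.\<close>

lemma total_deriv_growth: "norm (total_deriv b x) \<le> L9 * 2 powr q * (1 + norm x) powr q"
proof (rule norm_blinfun_bound)
  fix h :: "real ^ 'd"
  have "((\<lambda>t. b (x + t *\<^sub>R h)) has_vector_derivative total_deriv b x h) (at 0)"
  proof -
    have "((\<lambda>t::real. x + t *\<^sub>R h) has_derivative (\<lambda>t. t *\<^sub>R h)) (at 0)"
      by (auto intro!: derivative_eq_intros)
    from has_derivative_compose[OF this, of b "blinfun_apply (total_deriv b x)"]
    show ?thesis using has_derivative_total_deriv[of x UNIV]
      by (simp add: has_vector_derivative_def blinfun.scaleR_right)
  qed
  then have lim: "((\<lambda>t. norm (b (x + t *\<^sub>R h) - b x - t *\<^sub>R total_deriv b x h) / norm t) \<longlongrightarrow> 0) (at 0)"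
    unfolding has_vector_derivative_def has_derivative_iff_norm by simp
  have lim2: "((\<lambda>t. L9 * (1 + norm (x + t *\<^sub>R h) + norm x) powr q * norm h) \<longlongrightarrow>
      L9 * (1 + norm (x + 0 *\<^sub>R h) + norm x) powr q * norm h) (at (0::real))"
    by (intro tendsto_intros) (smt (verit) norm_ge_zero)
  have "norm (total_deriv b x h) \<le> L9 * (1 + norm (x + 0 *\<^sub>R h) + norm x) powr q * norm h + 0"
  proof (rule tendsto_lowerbound[OF tendsto_add[OF lim2 lim]])
    show "\<forall>\<^sub>F t in at 0. norm (total_deriv b x h) \<le> L9 * (1 + norm (x + t *\<^sub>R h) + norm x) powr q * norm h
        + norm (b (x + t *\<^sub>R h) - b x - t *\<^sub>R total_deriv b x h) / norm t"
    proof (rule eventually_mono[OF eventually_neq_at_within[of 0]])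
      fix t :: real assume t: "t \<noteq> 0"
      have "norm (t *\<^sub>R total_deriv b x h)
          \<le> norm (b (x + t *\<^sub>R h) - b x) + norm (b (x + t *\<^sub>R h) - b x - t *\<^sub>R total_deriv b x h)"
        using norm_triangle_ineq4[of "b (x + t *\<^sub>R h) - b x" "b (x + t *\<^sub>R h) - b x - t *\<^sub>R total_deriv b x h"] by simp
      also have "norm (b (x + t *\<^sub>R h) - b x) \<le> L9 * (1 + norm (x + t *\<^sub>R h) + norm x) powr q * (\<bar>t\<bar> * norm h)"
        using polynomial_Lipschitz[of "x + t *\<^sub>R h" x] by simp
      finally show "norm (total_deriv b x h) \<le> L9 * (1 + norm (x + t *\<^sub>R h) + norm x) powr q * norm h
        + norm (b (x + t *\<^sub>R h) - b x - t *\<^sub>R total_deriv b x h) / norm t"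
        using t by (simp add: field_simps)
    qed
  qed auto
  then have "norm (total_deriv b x h) \<le> L9 * (1 + norm (x + 0 *\<^sub>R h) + norm x) powr q * norm h" by simp
  also have "\<dots> \<le> L9 * (2 * (1 + norm x)) powr q * norm h"
    using const_pos q by (intro mult_right_mono mult_left_mono powr_mono2) auto
  finally show "norm (total_deriv b x h) \<le> L9 * 2 powr q * (1 + norm x) powr q * norm h"
    by (subst (asm) powr_mult) (auto simp: mult.assoc)
qed (use const_pos in auto)

text \<open>The mean value inequality on the ball around \<open>x\<close> of radius \<open>norm h\<close>, used twice: for \<open>Db\<close>, and then for
\<open>b\<close> minus its linearisation at \<open>x\<close>.\<close>

lemma drift_Taylor:
  "norm (b (x + h) - b x - total_deriv b x h) \<le> (L4' * (norm x + norm h) powr (q - 1) + L3') * (norm h)\<^sup>2"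
proof -
  define S where "S = cball x (norm h)"
  define D where "D = L4' * (norm x + norm h) powr (q - 1) + L3'"
  have S: "convex S" "x \<in> S" "x + h \<in> S" by (auto simp: S_def dist_norm)
  have D0: "0 \<le> D" using const_pos by (simp add: D_def)
  have second: "norm (total_deriv b y - total_deriv b x) \<le> D * norm (y - x)" if "y \<in> S" for y
  proof (rule differentiable_bound[OF S(1) _ _ that S(2)])
    fix u assume u: "u \<in> S"
    have "total_deriv b differentiable (at u)" using b2 by (simp add: twice_differentiable_def)
    then have d: "(total_deriv b has_derivative frechet_derivative (total_deriv b) (at u)) (at u)"
      by (simp add: frechet_derivative_works)
    then show "(total_deriv b has_derivative frechet_derivative (total_deriv b) (at u)) (at u within S)"
      by (rule has_derivative_at_withinI)
    have "norm u \<le> norm x + norm h"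
      using u norm_triangle_ineq[of x "u - x"] by (simp add: S_def dist_norm norm_minus_commute)
    then have uD: "L4' * norm u powr (q - 1) + L3' \<le> D" 
      unfolding D_def using const_pos q by (intro add_right_mono mult_left_mono powr_mono2) auto
    show "onorm (frechet_derivative (total_deriv b) (at u)) \<le> D"
    proof (rule onorm_le)
      fix y
      show "norm (frechet_derivative (total_deriv b) (at u) y) \<le> D * norm y"
      proof (rule norm_blinfun_bound)
        fix z
        have "norm (second_deriv b u y z) \<le> (L4' * norm u powr (q - 1) + L3') * norm y * norm z"
          by (rule second_deriv_growth)
        also have "\<dots> \<le> D * norm y * norm z" using uD by (intro mult_right_mono) auto
        finally show "norm (blinfun_apply (frechet_derivative (total_deriv b) (at u) y) z) \<le> D * norm y * norm z"
          by (simp add: second_deriv_def)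
      qed (use D0 in auto)
    qed
  qed
  have "norm ((b (x + h) - total_deriv b x (x + h)) - (b x - total_deriv b x x)) \<le> (D * norm h) * norm (x + h - x)"
  proof (rule differentiable_bound[OF S(1) _ _ S(3,2)])
    fix y assume y: "y \<in> S"
    show "((\<lambda>y. b y - total_deriv b x y) has_derivative blinfun_apply (total_deriv b y - total_deriv b x)) (at y within S)"
      unfolding minus_blinfun.rep_eq
      by (intro has_derivative_diff has_derivative_total_deriv bounded_linear_imp_has_derivative blinfun.bounded_linear_right)
    have "onorm (blinfun_apply (total_deriv b y - total_deriv b x)) = norm (total_deriv b y - total_deriv b x)"
      by (simp add: norm_blinfun.rep_eq)
    also have "\<dots> \<le> D * norm (y - x)" by (rule second[OF y])
    also have "\<dots> \<le> D * norm h" using y D0 by (intro mult_left_mono) (auto simp: S_def dist_norm norm_minus_commute)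
    finally show "onorm (blinfun_apply (total_deriv b y - total_deriv b x)) \<le> D * norm h" .
  qed
  then show ?thesis by (simp add: blinfun.add_right D_def power2_eq_square algebra_simps)
qed

lemma taming_factor:
  "0 < \<tau> \<Longrightarrow> \<exists>\<phi>\<in>{0..1}. tamed_drift q b \<tau> x = \<phi> *\<^sub>R b x"
proof (intro bexI[of _ "1 / sqrt (1 + \<tau> * norm x powr (2 * q))"])
  assume "0 < \<tau>"
  then have "1 \<le> sqrt (1 + \<tau> * norm x powr (2 * q))" by simp
  then show "1 / sqrt (1 + \<tau> * norm x powr (2 * q)) \<in> {0..1}" by (auto simp: divide_le_eq_1)
qed (simp add: tamed_drift_def)

lemma norm_tamed_drift_le: "0 < \<tau> \<Longrightarrow> norm (tamed_drift q b \<tau> x) \<le> norm (b x)"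
  using taming_factor[of \<tau> x] by (auto simp: mult_left_le_one_le)

text \<open>Here \<open>s\<close> is the time elapsed since the last grid point and \<open>w\<close> the noise added in the meantime. What is left
after the removal of the linear term in \<open>w\<close> is the second-order Taylor remainder, the effect
\<open>Db(x) (s b\<^sub>\<tau>(x))\<close> of the drift, and the taming error. Their growth exponents are \<open>q + 1\<close>, \<open>2 q + 1\<close> and
\<open>q + 1 + r / 2\<close>, whence \<open>r2\<close>.\<close>

lemma local_residual_bound:
  "\<exists>C>0. \<forall>\<tau>\<in>{0<..<1}. \<forall>s\<in>{0..\<tau>}. \<forall>x w.
     norm (b (x + (s *\<^sub>R tamed_drift q b \<tau> x + w)) - tamed_drift q b \<tau> x - total_deriv b x w)
       \<le> C * \<tau> * (1 + norm x + norm w / sqrt \<tau>) powr r2"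
proof -
  obtain C where C: "C \<ge> 1" "\<And>x. norm (b x) \<le> C * (1 + norm x) powr (q + 1)"
    using drift_growth by auto
  define c where "c = sqrt (K3 + K4)"
  define D1 where "D1 = (L4' * (c + 2) powr (q - 1) + L3') * (c + 1)\<^sup>2"
  define D2 where "D2 = L9 * 2 powr q * C"
  define D3 where "D3 = sqrt (2 * K7) * C"
  have c0: "0 \<le> c" using const_pos by (simp add: c_def)
  have pos: "D1 > 0" "D2 > 0" "D3 > 0"
    using const_pos C c0 by (auto simp: D1_def D2_def D3_def intro!: mult_pos_pos add_nonneg_pos mult_nonneg_nonneg)
  show ?thesis
  proof (intro exI[of _ "D1 + D2 + D3"] conjI ballI allI)
    fix \<tau> s :: real and x w :: "real ^ 'd"
    assume \<tau>: "\<tau> \<in> {0<..<1}" and s: "s \<in> {0..\<tau>}"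
    define y where "y = 1 + norm x + norm w / sqrt \<tau>"
    define bt where "bt = tamed_drift q b \<tau> x"
    define h where "h = s *\<^sub>R bt + w"
    have y: "1 \<le> y" "1 + norm x \<le> y" "norm x \<le> y" "norm w \<le> sqrt \<tau> * y"
      using \<tau> by (auto simp: y_def field_simps)
    have yr: "y powr a \<le> y powr r2" if "a \<le> r2" for a using y that by (intro powr_mono) auto
    have by': "norm (b x) \<le> C * y powr (q + 1)"
    proof -
      have "C * (1 + norm x) powr (q + 1) \<le> C * y powr (q + 1)"
        using y C q by (intro mult_left_mono powr_mono2) auto
      with C(2)[of x] show ?thesis by simp
    qed
    have bt_le: "norm bt \<le> norm (b x)" using \<tau> by (simp add: bt_def norm_tamed_drift_le)
    have "sqrt \<tau> * norm bt = sqrt (\<tau> * (norm bt)\<^sup>2)" using \<tau> by (simp add: real_sqrt_mult)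
    also have "\<dots> \<le> sqrt ((K3 + K4) * y\<^sup>2)"
    proof (intro real_sqrt_le_mono)
      have "\<tau> * (norm bt)\<^sup>2 \<le> K3 * 1 + K4 * (norm x)\<^sup>2" using tamed_growth[OF \<tau>] by (simp add: bt_def)
      also have "\<dots> \<le> K3 * y\<^sup>2 + K4 * y\<^sup>2"
        using const_pos y by (intro add_mono mult_left_mono power_mono) auto
      finally show "\<tau> * (norm bt)\<^sup>2 \<le> (K3 + K4) * y\<^sup>2" by (simp add: algebra_simps)
    qed
    also have "\<dots> = c * y" using y by (simp add: real_sqrt_mult c_def)
    finally have bt_c: "sqrt \<tau> * norm bt \<le> c * y" .
    \<comment> \<open>The condition on \<open>\<tau> |b\<^sub>\<tau>|\<^sup>2\<close> makes the whole step \<open>h\<close> of order \<open>\<tau>\<^bsup>1/2\<^esup>\<close>, so that its square is of order \<open>\<tau>\<close>.\<close>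
    have "norm h \<le> \<tau> * norm bt + norm w"
      unfolding h_def using s by (intro norm_triangle_le add_mono) (auto intro: mult_right_mono)
    also have "\<tau> * norm bt = sqrt \<tau> * (sqrt \<tau> * norm bt)" using \<tau> by (simp flip: mult.assoc)
    also have "\<dots> \<le> sqrt \<tau> * (c * y)" using bt_c \<tau> by (intro mult_left_mono) auto
    finally have h1: "norm h \<le> sqrt \<tau> * ((c + 1) * y)" using y by (simp add: algebra_simps)
    have "sqrt \<tau> * ((c + 1) * y) \<le> 1 * ((c + 1) * y)" using \<tau> c0 y by (intro mult_right_mono) auto
    with h1 y have h2: "norm x + norm h \<le> (c + 2) * y" by (simp add: algebra_simps)
    have h3: "(norm h)\<^sup>2 \<le> \<tau> * (c + 1)\<^sup>2 * y\<^sup>2"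
      using power_mono[OF h1, of 2] \<tau> by (simp add: power_mult_distrib)
    have "norm (b (x + h) - b x - total_deriv b x h) \<le> (L4' * (norm x + norm h) powr (q - 1) + L3') * (norm h)\<^sup>2"
      by (rule drift_Taylor)
    also have "\<dots> \<le> (L4' * ((c + 2) * y) powr (q - 1) + L3' * y powr (q - 1)) * (\<tau> * (c + 1)\<^sup>2 * y\<^sup>2)"
      using h2 h3 q const_pos y ge_one_powr_ge_zero[of y "q - 1"]
      by (intro mult_mono add_mono mult_left_mono powr_mono2) (auto intro!: add_nonneg_nonneg mult_nonneg_nonneg)
    also have "\<dots> = D1 * \<tau> * (y powr (q - 1) * y\<^sup>2)"
    proof -
      have "((c + 2) * y) powr (q - 1) = (c + 2) powr (q - 1) * y powr (q - 1)"
        by (rule powr_mult)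
      then show ?thesis by (simp only: D1_def) (simp add: algebra_simps)
    qed
    also have "y powr (q - 1) * y\<^sup>2 = y powr (q + 1)"
      using y by (simp flip: powr_numeral powr_add add: add.commute)
    also have "D1 * \<tau> * y powr (q + 1) \<le> D1 * \<tau> * y powr r2"
      using pos \<tau> yr r2_bounds q by (intro mult_left_mono) auto
    finally have t1: "norm (b (x + h) - b x - total_deriv b x h) \<le> D1 * \<tau> * y powr r2" .
    have "norm (total_deriv b x (s *\<^sub>R bt)) \<le> norm (total_deriv b x) * (\<tau> * norm bt)"
      using s norm_blinfun[of "total_deriv b x" "s *\<^sub>R bt"]
      by (rule_tac order_trans) (auto intro!: mult_left_mono mult_right_mono)
    also have "\<dots> \<le> (L9 * 2 powr q * y powr q) * (\<tau> * (C * y powr (q + 1)))"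
    proof (intro mult_mono mult_left_mono)
      have "L9 * 2 powr q * (1 + norm x) powr q \<le> L9 * 2 powr q * y powr q"
        using const_pos y q by (intro mult_left_mono powr_mono2) auto
      then show "norm (total_deriv b x) \<le> L9 * 2 powr q * y powr q" using total_deriv_growth[of x] by simp
    qed (use \<tau> const_pos bt_le by' in auto)
    also have "\<dots> = D2 * \<tau> * y powr (2 * q + 1)"
      by (simp add: D2_def mult_ac flip: powr_add)
    also have "\<dots> \<le> D2 * \<tau> * y powr r2"
      using pos \<tau> yr r2_bounds by (intro mult_left_mono) auto
    finally have t2: "norm (total_deriv b x (s *\<^sub>R bt)) \<le> D2 * \<tau> * y powr r2" .
    have "norm (b x - bt) = sqrt ((norm (b x - bt))\<^sup>2)" by simp
    also have "\<dots> \<le> sqrt (K7 * \<tau>\<^sup>2 * (2 * y powr r) * (C * y powr (q + 1))\<^sup>2)"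
    proof (intro real_sqrt_le_mono)
      have "norm x powr r \<le> y powr r" using y const_pos by (intro powr_mono2) auto
      moreover have "1 \<le> y powr r" using y const_pos by (intro ge_one_powr_ge_zero) auto
      ultimately have "K7 * \<tau>\<^sup>2 * (1 + norm x powr r) * (norm (b x))\<^sup>2 \<le> K7 * \<tau>\<^sup>2 * (2 * y powr r) * (C * y powr (q + 1))\<^sup>2"
        using by' const_pos by (intro mult_mono mult_left_mono power_mono) auto
      with taming_error[OF \<tau>, of x] show "(norm (b x - bt))\<^sup>2 \<le> K7 * \<tau>\<^sup>2 * (2 * y powr r) * (C * y powr (q + 1))\<^sup>2"
        by (simp add: bt_def)
    qed
    also have "\<dots> = sqrt (2 * K7) * \<tau> * sqrt (y powr r) * (C * y powr (q + 1))"
      using \<tau> C by (simp add: real_sqrt_mult)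
    also have "sqrt (y powr r) = y powr (r / 2)" using y by (simp add: powr_half_sqrt[symmetric] powr_powr)
    also have "sqrt (2 * K7) * \<tau> * y powr (r / 2) * (C * y powr (q + 1)) = D3 * \<tau> * y powr (q + 1 + r / 2)"
      by (simp add: D3_def mult_ac flip: powr_add)
    also have "\<dots> \<le> D3 * \<tau> * y powr r2"
      using pos \<tau> yr r2_bounds by (intro mult_left_mono) auto
    finally have t3: "norm (b x - bt) \<le> D3 * \<tau> * y powr r2" .
    have "b (x + h) - bt - total_deriv b x w
        = (b (x + h) - b x - total_deriv b x h) + total_deriv b x (s *\<^sub>R bt) + (b x - bt)"
      by (simp add: h_def blinfun.add_right)
    then have "norm (b (x + h) - bt - total_deriv b x w) \<le> D1 * \<tau> * y powr r2 + D2 * \<tau> * y powr r2 + D3 * \<tau> * y powr r2"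
      using t1 t2 t3 by (metis add_mono norm_triangle_le norm_triangle_mono)
    then show "norm (b (x + (s *\<^sub>R tamed_drift q b \<tau> x + w)) - tamed_drift q b \<tau> x - total_deriv b x w)
       \<le> (D1 + D2 + D3) * \<tau> * (1 + norm x + norm w / sqrt \<tau>) powr r2"
      unfolding h_def bt_def y_def by (simp add: algebra_simps)
  qed (use pos in auto)
qed

text \<open>For \<open>w\<close> the noise and \<open>y\<close> the solution minus the noise, this bounds the growth of \<open>y\<close>, whose path is
differentiable: the comparison of \<open>b (y + w)\<close> with \<open>b w\<close> replaces Ito's formula.\<close>

lemma dissipativity_shifted:
  "2 * (y \<bullet> b (y + w)) \<le> (L0' + 1) * (norm y)\<^sup>2 + (norm (b w))\<^sup>2"
proof -
  have "2 * (y \<bullet> (b (y + w) - b w)) \<le> L0' * (norm y)\<^sup>2"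
    using one_sided_Lipschitz[of "y + w" w] by simp
  moreover have "2 * (y \<bullet> b w) \<le> (norm y)\<^sup>2 + (norm (b w))\<^sup>2"
    using inner_ge_zero[of "y - b w"] by (simp add: power2_norm_eq_inner inner_diff inner_commute)
  ultimately show ?thesis by (simp add: inner_diff_right algebra_simps)
qed

text \<open>One step of the scheme with the noise subtracted. The bound of \<open>dissipativity_shifted\<close> is nonnegative and
hence also holds for \<open>b\<^sub>\<tau> = \<phi> b\<close> with \<open>\<phi> \<in> [0, 1]\<close>.\<close>

lemma tamed_step_bound:
  assumes "\<tau> \<in> {0<..<1}"
  shows "(norm (y + \<tau> *\<^sub>R tamed_drift q b \<tau> (y + w)))\<^sup>2
    \<le> exp ((L0' + 1 + K3 + 2 * K4) * \<tau>)
       * ((norm y)\<^sup>2 + \<tau> * ((1 + K3 + 2 * K4) * (1 + (norm w)\<^sup>2 + (norm (b w))\<^sup>2)))"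
proof -
  define bt where "bt = tamed_drift q b \<tau> (y + w)"
  define c where "c = L0' + 1 + K3 + 2 * K4"
  define G where "G = (1 + K3 + 2 * K4) * (1 + (norm w)\<^sup>2 + (norm (b w))\<^sup>2)"
  have \<tau>: "0 < \<tau>" using assms by simp
  obtain \<phi> where \<phi>: "\<phi> \<in> {0..1}" "bt = \<phi> *\<^sub>R b (y + w)" using taming_factor[OF \<tau>] bt_def by blast
  have "2 * (y \<bullet> bt) = \<phi> * (2 * (y \<bullet> b (y + w)))" by (simp add: \<phi>)
  also have "\<dots> \<le> \<phi> * ((L0' + 1) * (norm y)\<^sup>2 + (norm (b w))\<^sup>2)"
    using \<phi> by (intro mult_left_mono dissipativity_shifted) auto
  also have "\<dots> \<le> 1 * ((L0' + 1) * (norm y)\<^sup>2 + (norm (b w))\<^sup>2)"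
    using \<phi> const_pos by (intro mult_right_mono) auto
  finally have i: "2 * (y \<bullet> bt) \<le> (L0' + 1) * (norm y)\<^sup>2 + (norm (b w))\<^sup>2" by simp
  have "(norm (y + w))\<^sup>2 \<le> 2 * (norm y)\<^sup>2 + 2 * (norm w)\<^sup>2"
    using inner_ge_zero[of "y - w"] by (simp add: power2_norm_eq_inner inner_diff inner_add inner_commute)
  then have "K4 * (norm (y + w))\<^sup>2 \<le> K4 * (2 * (norm y)\<^sup>2 + 2 * (norm w)\<^sup>2)"
    using const_pos by (intro mult_left_mono) auto
  then have ii: "\<tau> * (norm bt)\<^sup>2 \<le> K3 + 2 * K4 * (norm y)\<^sup>2 + 2 * K4 * (norm w)\<^sup>2"
    using tamed_growth[OF assms, of "y + w"] by (simp add: bt_def algebra_simps)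
  have "(norm (y + \<tau> *\<^sub>R bt))\<^sup>2 = (norm y)\<^sup>2 + \<tau> * (2 * (y \<bullet> bt) + \<tau> * (norm bt)\<^sup>2)"
    by (simp add: power2_norm_eq_inner inner_add inner_commute algebra_simps)
  also have "2 * (y \<bullet> bt) + \<tau> * (norm bt)\<^sup>2 \<le> c * (norm y)\<^sup>2 + G"
  proof -
    have "0 \<le> K3 * (norm y)\<^sup>2 + K3 * (norm w)\<^sup>2 + K3 * (norm (b w))\<^sup>2 + 2 * K4 * (norm (b w))\<^sup>2 + 2 * K4 + (norm w)\<^sup>2 + 1"
      using const_pos by (intro add_nonneg_nonneg mult_nonneg_nonneg) auto
    with i ii show ?thesis by (simp add: c_def G_def algebra_simps)
  qed
  also have "(norm y)\<^sup>2 + \<tau> * (c * (norm y)\<^sup>2 + G) \<le> (1 + c * \<tau>) * ((norm y)\<^sup>2 + \<tau> * G)"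
  proof -
    have "0 \<le> c * \<tau> * (\<tau> * G)" using \<tau> const_pos by (simp add: c_def G_def)
    then show ?thesis by (simp add: algebra_simps)
  qed
  also have "\<dots> \<le> exp (c * \<tau>) * ((norm y)\<^sup>2 + \<tau> * G)"
    using \<tau> const_pos by (intro mult_right_mono) (auto simp: G_def)
  finally show ?thesis using \<tau> by (simp add: bt_def c_def G_def)
qed

text \<open>The one-sided Lipschitz condition applies to \<open>x - z = v + n\<close> and not to \<open>v\<close>. The difference is the inner
product of \<open>n\<close> with \<open>b x - b z\<close>, which the local Lipschitz condition bounds by a multiple of \<open>|n| |x - z|\<close>.\<close>

lemma error_energy:
  fixes x z n \<rho> :: "real ^ 'd"
  defines "v \<equiv> x - z - n"
  shows "2 * (v \<bullet> (b x - b z + \<rho>)) \<le> (2 * L0' + 3) * (norm v)\<^sup>2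
     + (2 * L0' + 3 + L9\<^sup>2) * ((norm n)\<^sup>2 * (1 + norm x + norm z) powr (2 * q) + (norm \<rho>)\<^sup>2)"
proof -
  define e Z where "e = x - z" and "Z = 1 + norm x + norm z"
  have Z: "1 \<le> Z" by (simp add: Z_def)
  have Z2: "1 \<le> Z powr (2 * q)" using Z q by (intro ge_one_powr_ge_zero) auto
  have "- 2 * (n \<bullet> (b x - b z)) \<le> 2 * (norm n * norm (b x - b z))"
    using Cauchy_Schwarz_ineq2[of n "b x - b z"] by simp
  also have "\<dots> \<le> 2 * (norm n * (L9 * Z powr q * norm e))"
    using polynomial_Lipschitz[of x z] by (intro mult_left_mono) (auto simp: Z_def e_def)
  also have "\<dots> \<le> (norm e)\<^sup>2 + (norm n * (L9 * Z powr q))\<^sup>2"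
    using sum_squares_bound[of "norm e" "norm n * (L9 * Z powr q)"] by (simp add: mult_ac)
  also have "(norm n * (L9 * Z powr q))\<^sup>2 = L9\<^sup>2 * ((norm n)\<^sup>2 * Z powr (2 * q))"
    using Z by (simp add: power_mult_distrib power2_eq_square flip: powr_add)
  finally have i: "- 2 * (n \<bullet> (b x - b z)) \<le> (norm e)\<^sup>2 + L9\<^sup>2 * ((norm n)\<^sup>2 * Z powr (2 * q))" .
  have ii: "2 * (v \<bullet> \<rho>) \<le> (norm v)\<^sup>2 + (norm \<rho>)\<^sup>2"
    using inner_ge_zero[of "v - \<rho>"] by (simp add: power2_norm_eq_inner inner_diff inner_commute)
  have iii: "2 * (e \<bullet> (b x - b z)) \<le> L0' * (norm e)\<^sup>2" using one_sided_Lipschitz by (simp add: e_def)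
  have "(norm e)\<^sup>2 \<le> 2 * (norm v)\<^sup>2 + 2 * (norm n)\<^sup>2"
  proof -
    have "e = v + n" by (simp add: e_def v_def)
    then show ?thesis using inner_ge_zero[of "v - n"]
      by (simp add: power2_norm_eq_inner inner_diff inner_add inner_commute)
  qed
  then have "(L0' + 1) * (norm e)\<^sup>2 \<le> (L0' + 1) * (2 * (norm v)\<^sup>2 + 2 * (norm n)\<^sup>2)"
    using const_pos by (intro mult_left_mono) auto
  moreover have "(2 * L0' + 2) * (norm n)\<^sup>2 \<le> (2 * L0' + 3) * ((norm n)\<^sup>2 * Z powr (2 * q))"
    using Z2 const_pos mult_left_mono[OF Z2, of "(norm n)\<^sup>2"] by (intro mult_mono) auto
  moreover have "2 * (v \<bullet> (b x - b z + \<rho>)) = 2 * (e \<bullet> (b x - b z)) - 2 * (n \<bullet> (b x - b z)) + 2 * (v \<bullet> \<rho>)"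
    by (simp add: v_def e_def inner_diff inner_add algebra_simps)
  moreover have "0 \<le> (2 * L0' + 2 + L9\<^sup>2) * (norm \<rho>)\<^sup>2" using const_pos by simp
  ultimately show ?thesis using i ii iii unfolding Z_def[symmetric] by (simp add: algebra_simps)
qed

end

section \<open>Means of integrals of continuous processes\<close>

text \<open>Integrability is part of the bound, because the integral of a non-integrable function has the default
value \<open>0\<close>.\<close>

definition mean_le :: "'a measure \<Rightarrow> ('a \<Rightarrow> real) \<Rightarrow> real \<Rightarrow> bool" where
  "mean_le M f K \<longleftrightarrow> integrable M f \<and> integral\<^sup>L M f \<le> K"

lemma mean_le_mono: "mean_le M f K \<Longrightarrow> K \<le> K' \<Longrightarrow> mean_le M f K'"
  by (simp add: mean_le_def)

lemma mean_le_add: "mean_le M f K \<Longrightarrow> mean_le M g L \<Longrightarrow> mean_le M (\<lambda>\<omega>. f \<omega> + g \<omega>) (K + L)"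
  by (auto simp: mean_le_def)

lemma mean_le_cmult: "mean_le M f K \<Longrightarrow> 0 \<le> c \<Longrightarrow> mean_le M (\<lambda>\<omega>. c * f \<omega>) (c * K)"
  by (auto simp: mean_le_def intro: mult_left_mono)

lemma (in prob_space) mean_le_const: "mean_le M (\<lambda>\<omega>. c) c"
  by (simp add: mean_le_def prob_space)

lemma mean_le_AE_mono:
  assumes "mean_le M g K" "f \<in> borel_measurable M" "AE \<omega> in M. 0 \<le> f \<omega> \<and> f \<omega> \<le> g \<omega>"
  shows "mean_le M f K"
proof -
  have g: "integrable M g" using assms by (simp add: mean_le_def)
  have "integrable M f"
    by (rule Bochner_Integration.integrable_bound[OF g assms(2)]) (use assms(3) in eventually_elim, auto)
  moreover from this g have "integral\<^sup>L M f \<le> integral\<^sup>L M g"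
    using assms(3) by (intro integral_mono_AE) auto
  ultimately show ?thesis using assms by (simp add: mean_le_def)
qed

lemma mean_le_nonneg: "mean_le M f K \<Longrightarrow> (\<And>\<omega>. 0 \<le> f \<omega>) \<Longrightarrow> 0 \<le> K"
  unfolding mean_le_def by (metis AE_I2 integral_nonneg_AE order_trans)

text \<open>Paths are continuous only almost surely, so that integrals along them agree only almost surely with
functions that are visibly measurable. A \<open>\<sigma>\<close>-algebra that contains all null sets does not see the difference.\<close>

lemma measurable_complete_AE_eq:
  fixes f g :: "'a \<Rightarrow> 'b::topological_space"
  assumes M: "complete_measure M" and G: "subalgebra M G" "null_sets M \<subseteq> sets G"
    and g: "g \<in> borel_measurable G" and ae: "AE \<omega> in M. f \<omega> = g \<omega>"
  shows "f \<in> borel_measurable G"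
proof (rule measurableI)
  interpret complete_measure M by (rule M)
  fix A :: "'b set" assume A: "A \<in> sets borel"
  define D where "D = {\<omega> \<in> space M. f \<omega> \<noteq> g \<omega>}"
  have D: "D \<in> null_sets M" using ae unfolding D_def AE_iff_null_sets .
  have "f -` A \<inter> space G = (g -` A \<inter> space G - D) \<union> (f -` A \<inter> D)"
    using G by (auto simp: D_def subalgebra_def)
  moreover have "f -` A \<inter> D \<in> sets G" using subsetD[OF G(2) complete2[OF Int_lower2 D]] .
  moreover have "g -` A \<inter> space G \<in> sets G" using g A by (rule measurable_sets)
  moreover have "D \<in> sets G" using subsetD[OF G(2) D] .
  ultimately show "f -` A \<inter> space G \<in> sets G" by (metis sets.Un sets.Diff)
qed simp

text \<open>The process is the limit of processes that are piecewise constant in time. Time is clamped to \<open>[a, b]\<close> so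
that the statement concerns a function on the whole product space.\<close>

lemma continuous_process_jointly_measurable:
  fixes Y :: "real \<Rightarrow> 'a \<Rightarrow> 'b::metric_space"
  assumes ab: "a \<le> b" and Y: "\<And>s. s \<in> {a..b} \<Longrightarrow> Y s \<in> borel_measurable G"
    and cont: "\<And>\<omega>. \<omega> \<in> space G \<Longrightarrow> continuous_on {a..b} (\<lambda>s. Y s \<omega>)"
  shows "(\<lambda>(s, \<omega>). Y (max a (min b s)) \<omega>) \<in> borel_measurable (lborel \<Otimes>\<^sub>M G)"
proof (rule borel_measurable_LIMSEQ_metric)
  fix n
  define c where "c k = max a (min b (real_of_int k / real (Suc n)))" for k
  have "(\<lambda>z :: real \<times> 'a. (\<lambda>z. Y (c \<lfloor>fst z * real (Suc n)\<rfloor>) (snd z)) z) \<in> borel_measurable (lborel \<Otimes>\<^sub>M G)"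
  proof (rule measurable_compose_countable)
    show "(\<lambda>z. Y (c k) (snd z)) \<in> borel_measurable (lborel \<Otimes>\<^sub>M G)" for k
      using Y[of "c k"] ab by (intro measurable_compose[OF measurable_snd]) (auto simp: c_def)
  qed measurable
  then show "(\<lambda>z. Y (c \<lfloor>fst z * real (Suc n)\<rfloor>) (snd z)) \<in> borel_measurable (lborel \<Otimes>\<^sub>M G)" by simp
next
  fix z :: "real \<times> 'a" assume "z \<in> space (lborel \<Otimes>\<^sub>M G)"
  then have z: "snd z \<in> space G" by (auto simp: space_pair_measure)
  let ?r = "\<lambda>n. max a (min b (real_of_int \<lfloor>fst z * real (Suc n)\<rfloor> / real (Suc n)))"
  have fl: "fst z - inverse (real (Suc n)) \<le> real_of_int \<lfloor>fst z * real (Suc n)\<rfloor> / real (Suc n)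
      \<and> real_of_int \<lfloor>fst z * real (Suc n)\<rfloor> / real (Suc n) \<le> fst z" for n
  proof -
    define N where "N = real (Suc n)"
    have N: "N > 0" by (simp add: N_def)
    have "fst z * N - 1 \<le> real_of_int \<lfloor>fst z * N\<rfloor>" "real_of_int \<lfloor>fst z * N\<rfloor> \<le> fst z * N" by linarith+
    then show ?thesis using N unfolding N_def[symmetric] by (simp add: pos_le_divide_eq pos_divide_le_eq left_diff_distrib)
  qed
  have "(\<lambda>n. fst z - inverse (real (Suc n))) \<longlonglongrightarrow> fst z"
    using tendsto_diff[OF tendsto_const LIMSEQ_inverse_real_of_nat, of "fst z"] by simp
  then have "(\<lambda>n. real_of_int \<lfloor>fst z * real (Suc n)\<rfloor> / real (Suc n)) \<longlonglongrightarrow> fst z"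
    by (rule tendsto_sandwich[OF always_eventually always_eventually _ tendsto_const, rotated 2]) (simp_all only: fl simp_thms)
  then have lim: "?r \<longlonglongrightarrow> max a (min b (fst z))"
    by (rule tendsto_max[OF tendsto_const tendsto_min[OF tendsto_const]])
  have "(\<lambda>n. Y (?r n) (snd z)) \<longlonglongrightarrow> Y (max a (min b (fst z))) (snd z)"
    by (rule continuous_on_tendsto_compose[OF cont[OF z] lim]) (use ab in auto)
  then show "(\<lambda>n. Y (max a (min b (real_of_int \<lfloor>fst z * real (Suc n)\<rfloor> / real (Suc n)))) (snd z))
      \<longlonglongrightarrow> (case z of (s, \<omega>) \<Rightarrow> Y (max a (min b s)) \<omega>)"
    by (simp add: case_prod_beta)
qed

text \<open>Fubini's theorem asks for a jointly measurable function. Setting the process to \<open>0\<close> on the null set of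
discontinuous paths provides one.\<close>

lemma continuous_process_modification:
  fixes Y :: "real \<Rightarrow> 'a \<Rightarrow> 'b::euclidean_space"
  assumes M: "complete_measure M" and G: "subalgebra M G" "null_sets M \<subseteq> sets G"
    and ab: "a \<le> b" and Y: "\<And>s. s \<in> {a..b} \<Longrightarrow> Y s \<in> borel_measurable G"
    and cont: "AE \<omega> in M. continuous_on {a..b} (\<lambda>s. Y s \<omega>)"
  obtains f where "case_prod f \<in> borel_measurable (lborel \<Otimes>\<^sub>M G)"
    "AE \<omega> in M. \<forall>s. f s \<omega> = indicator {a..b} s *\<^sub>R Y s \<omega>"
    "AE \<omega> in M. (\<integral>s. f s \<omega> \<partial>lborel) = integral {a..b} (\<lambda>s. Y s \<omega>)"
proof -
  interpret complete_measure M by (rule M)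
  define D where "D = {\<omega> \<in> space M. \<not> continuous_on {a..b} (\<lambda>s. Y s \<omega>)}"
  have D: "D \<in> null_sets M" using cont unfolding D_def AE_iff_null_sets .
  then have DG: "D \<in> sets G" using G by auto
  define Z where "Z s \<omega> = indicator (space M - D) \<omega> *\<^sub>R Y s \<omega>" for s \<omega>
  have sp: "space G = space M" using G by (simp add: subalgebra_def)
  have "space M - D \<in> sets G" using DG sp by (metis sets.compl_sets)
  then have Zm: "Z s \<in> borel_measurable G" if "s \<in> {a..b}" for s
    unfolding Z_def using Y[OF that] by (intro borel_measurable_scaleR) auto
  have Zc: "continuous_on {a..b} (\<lambda>s. Z s \<omega>)" if "\<omega> \<in> space G" for \<omega>
    using that by (cases "\<omega> \<in> D") (auto simp: Z_def D_def sp)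
  define f where "f s \<omega> = indicator {a..b} s *\<^sub>R Z (max a (min b s)) \<omega>" for s \<omega>
  have ae: "AE \<omega> in M. \<omega> \<in> space M - D" using AE_not_in[OF D] AE_space by eventually_elim auto
  show thesis
  proof
    have "(\<lambda>(s, \<omega>). Z (max a (min b s)) \<omega>) \<in> borel_measurable (lborel \<Otimes>\<^sub>M G)"
      by (rule continuous_process_jointly_measurable[OF ab Zm Zc])
    from borel_measurable_scaleR[OF _ this]
    have "(\<lambda>z. indicator {a..b} (fst z) *\<^sub>R (case z of (s, \<omega>) \<Rightarrow> Z (max a (min b s)) \<omega>)) \<in> borel_measurable (lborel \<Otimes>\<^sub>M G)"
      by measurable
    then show "case_prod f \<in> borel_measurable (lborel \<Otimes>\<^sub>M G)"
      unfolding f_def by (simp only: case_prod_beta')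
    show ff: "AE \<omega> in M. \<forall>s. f s \<omega> = indicator {a..b} s *\<^sub>R Y s \<omega>"
      using ae by eventually_elim (simp add: f_def Z_def split: split_indicator)
    from ff ae show "AE \<omega> in M. (\<integral>s. f s \<omega> \<partial>lborel) = integral {a..b} (\<lambda>s. Y s \<omega>)"
    proof eventually_elim
      case (elim \<omega>)
      then have "continuous_on {a..b} (\<lambda>s. Y s \<omega>)" by (auto simp: D_def)
      then have "set_integrable lborel {a..b} (\<lambda>s. Y s \<omega>)" by (rule borel_integrable_atLeastAtMost')
      then show ?case using set_borel_integral_eq_integral(2) elim(1) by (simp add: set_lebesgue_integral_def)
    qed
  qed
qed

lemma measurable_process_integral:
  fixes Y :: "real \<Rightarrow> 'a \<Rightarrow> 'b::euclidean_space"
  assumes "complete_measure M" "subalgebra M G" "null_sets M \<subseteq> sets G"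
    and "a \<le> b" "\<And>s. s \<in> {a..b} \<Longrightarrow> Y s \<in> borel_measurable G"
    and "AE \<omega> in M. continuous_on {a..b} (\<lambda>s. Y s \<omega>)"
  shows "(\<lambda>\<omega>. integral {a..b} (\<lambda>s. Y s \<omega>)) \<in> borel_measurable G"
proof -
  obtain f where f: "case_prod f \<in> borel_measurable (lborel \<Otimes>\<^sub>M G)"
    "AE \<omega> in M. \<forall>s. f s \<omega> = indicator {a..b} s *\<^sub>R Y s \<omega>"
    "AE \<omega> in M. (\<integral>s. f s \<omega> \<partial>lborel) = integral {a..b} (\<lambda>s. Y s \<omega>)"
    by (rule continuous_process_modification[OF assms])
  have "(\<lambda>(\<omega>, s). f s \<omega>) \<in> borel_measurable (G \<Otimes>\<^sub>M lborel)"
    using measurable_compose[OF measurable_pair_swap' f(1)] by (simp add: case_prod_beta')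
  then have "(\<lambda>\<omega>. \<integral>s. f s \<omega> \<partial>lborel) \<in> borel_measurable G"
    by (rule lborel.borel_measurable_lebesgue_integral)
  moreover have "AE \<omega> in M. integral {a..b} (\<lambda>s. Y s \<omega>) = (\<integral>s. f s \<omega> \<partial>lborel)" using f(3) by eventually_elim simp
  ultimately show ?thesis by (rule measurable_complete_AE_eq[OF assms(1-3)])
qed

text \<open>Fubini's theorem. The bound \<open>L\<close> on the absolute values only provides integrability; the means themselves
may be bounded by a smaller \<open>K\<close>, in particular by \<open>0\<close> for processes of mean zero.\<close>

lemma mean_le_process_integral:
  fixes Y :: "real \<Rightarrow> 'a \<Rightarrow> real"
  assumes M: "prob_space M" "complete_measure M" and ab: "a \<le> b"
    and cont: "AE \<omega> in M. continuous_on {a..b} (\<lambda>s. Y s \<omega>)"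
    and Y: "\<And>s. s \<in> {a..b} \<Longrightarrow> mean_le M (Y s) K"
    and Yabs: "\<And>s. s \<in> {a..b} \<Longrightarrow> mean_le M (\<lambda>\<omega>. \<bar>Y s \<omega>\<bar>) L"
  shows "mean_le M (\<lambda>\<omega>. integral {a..b} (\<lambda>s. Y s \<omega>)) (K * (b - a))"
proof -
  interpret prob_space M by (rule M)
  interpret pair_sigma_finite lborel M ..
  have int: "integrable M (Y s)" if "s \<in> {a..b}" for s using Y[OF that] by (simp add: mean_le_def)
  have G: "subalgebra M M" "null_sets M \<subseteq> sets M" by (auto simp: subalgebra_def)
  obtain f where f[measurable]: "case_prod f \<in> borel_measurable (lborel \<Otimes>\<^sub>M M)"
    and f1: "AE \<omega> in M. \<forall>s. f s \<omega> = indicator {a..b} s *\<^sub>R Y s \<omega>"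
    and f2: "AE \<omega> in M. (\<integral>s. f s \<omega> \<partial>lborel) = integral {a..b} (\<lambda>s. Y s \<omega>)"
    by (rule continuous_process_modification[OF M(2) G ab borel_measurable_integrable[OF int] cont])
  have fm: "(\<lambda>\<omega>. f s \<omega>) \<in> borel_measurable M" for s by simp
  have fs: "AE \<omega> in M. f s \<omega> = indicator {a..b} s * Y s \<omega>" for s
    using f1 by eventually_elim auto
  have Ym: "(\<lambda>\<omega>. indicator {a..b} s * Y s \<omega>) \<in> borel_measurable M" for s
    using int[of s] by (cases "s \<in> {a..b}") auto
  have fi: "integrable M (f s)" for s
  proof -
    have "integrable M (\<lambda>\<omega>. indicator {a..b} s * Y s \<omega>)" using int[of s] by (cases "s \<in> {a..b}") auto
    then show ?thesis by (subst integrable_cong_AE[OF fm Ym fs])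
  qed
  have fE: "(\<integral>\<omega>. f s \<omega> \<partial>M) \<le> indicator {a..b} s * K" for s
    using Y[of s] by (subst integral_cong_AE[OF fm Ym fs], cases "s \<in> {a..b}") (auto simp: mean_le_def)
  have fA: "(\<integral>\<omega>. norm (f s \<omega>) \<partial>M) \<le> indicator {a..b} s * L" for s
  proof -
    have "AE \<omega> in M. norm (f s \<omega>) = indicator {a..b} s * \<bar>Y s \<omega>\<bar>"
      using fs[of s] by eventually_elim (auto simp: abs_mult)
    then have "(\<integral>\<omega>. norm (f s \<omega>) \<partial>M) = (\<integral>\<omega>. indicator {a..b} s * \<bar>Y s \<omega>\<bar> \<partial>M)"
      using int[of s] by (intro integral_cong_AE) (auto, cases "s \<in> {a..b}", auto)
    then show ?thesis using Yabs[of s] by (cases "s \<in> {a..b}") (auto simp: mean_le_def)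
  qed
  have lb: "integrable lborel (\<lambda>s. indicator {a..b} s * c :: real)" for c
    using ab by (intro integrable_mult_left) auto
  have "integrable (lborel \<Otimes>\<^sub>M M) (case_prod f)"
  proof (rule Fubini_integrable)
    show "integrable lborel (\<lambda>s. \<integral>\<omega>. norm (case_prod f (s, \<omega>)) \<partial>M)"
    proof (rule Bochner_Integration.integrable_bound[OF lb[of L]])
      show "AE s in lborel. norm (\<integral>\<omega>. norm (case_prod f (s, \<omega>)) \<partial>M) \<le> norm (indicator {a..b} s * L)"
        using fA by (intro AE_I2) (auto intro: order_trans[OF _ abs_ge_self] simp del: abs_mult)
    qed measurable
    show "AE s in lborel. integrable M (\<lambda>\<omega>. case_prod f (s, \<omega>))" using fi by auto
  qed simp
  note P = this
  have "integrable M (\<lambda>\<omega>. \<integral>s. f s \<omega> \<partial>lborel)" by (rule integrable_snd[OF P])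
  moreover have m: "(\<lambda>\<omega>. integral {a..b} (\<lambda>s. Y s \<omega>)) \<in> borel_measurable M"
    using int by (intro measurable_process_integral[OF M(2) G ab _ cont]) auto
  moreover have "(\<lambda>\<omega>. \<integral>s. f s \<omega> \<partial>lborel) \<in> borel_measurable M" using calculation by auto
  ultimately have i: "integrable M (\<lambda>\<omega>. integral {a..b} (\<lambda>s. Y s \<omega>))"
    and e: "(\<integral>\<omega>. integral {a..b} (\<lambda>s. Y s \<omega>) \<partial>M) = (\<integral>\<omega>. (\<integral>s. f s \<omega> \<partial>lborel) \<partial>M)"
    using integrable_cong_AE[OF _ _ f2] integral_cong_AE[OF _ _ f2] by auto
  note e
  also have "(\<integral>\<omega>. (\<integral>s. f s \<omega> \<partial>lborel) \<partial>M) = (\<integral>s. (\<integral>\<omega>. f s \<omega> \<partial>M) \<partial>lborel)"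
    by (rule Fubini_integral[OF P])
  also have "\<dots> \<le> (\<integral>s. indicator {a..b} s * K \<partial>lborel)"
    by (rule integral_mono[OF integrable_fst[OF P] lb]) (use fE in auto)
  also have "\<dots> = K * (b - a)" using ab by simp
  finally show ?thesis using i by (simp add: mean_le_def)
qed

text \<open>Lebesgue measure and the density are both products over the coordinates, so that the integral of a function
of one coordinate factors, and the other factors are \<open>1\<close>.\<close>

section \<open>Gaussian vectors\<close>

lemma distributed_normal_component:
  fixes D :: "'a \<Rightarrow> real ^ 'm"
  assumes D: "distributed M lborel D (\<lambda>x. ennreal (\<Prod>i\<in>UNIV. normal_density 0 \<sigma> (x $ i)))" and s: "0 < \<sigma>"
  shows "distributed M lborel (\<lambda>\<omega>. D \<omega> $ i) (normal_density 0 \<sigma>)"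
proof -
  have Dm[measurable]: "D \<in> borel_measurable M" using distributed_measurable[OF D] by simp
  have nth[measurable]: "(\<lambda>x :: real ^ 'm. x $ j) \<in> borel_measurable borel" for j
    by (intro borel_measurable_continuous_onI continuous_intros)
  have Dim[measurable]: "(\<lambda>\<omega>. D \<omega> $ i) \<in> borel_measurable M"
    by (rule measurable_compose[OF Dm nth])
  have "distr M lborel (\<lambda>\<omega>. D \<omega> $ i) = density lborel (normal_density 0 \<sigma>)"
  proof (rule measure_eqI)
    fix A assume "A \<in> sets (distr M lborel (\<lambda>\<omega>. D \<omega> $ i))"
    then have A[measurable]: "A \<in> sets borel" by simp
    define f where "f b y = ennreal (normal_density 0 \<sigma> y) * (if b = axis i 1 then indicator A y else 1)"
      for b :: "real ^ 'm" and y
    have fm[measurable]: "f b \<in> borel_measurable borel" for b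
      unfolding f_def by (cases "b = axis i 1") simp_all
    have ax: "inj (\<lambda>j. axis j (1::real) :: real ^ 'm)" by (auto simp: inj_def axis_eq_axis)
    have Ba: "(Basis :: (real ^ 'm) set) = range (\<lambda>j. axis j 1)" by (auto simp: Basis_vec_def)
    have pr: "(\<Prod>b\<in>Basis. g b) = (\<Prod>j\<in>UNIV. g (axis j 1))" for g :: "real ^ 'm \<Rightarrow> ennreal"
      unfolding Ba by (subst prod.reindex[OF ax]) simp
    have "emeasure (distr M lborel (\<lambda>\<omega>. D \<omega> $ i)) A = (\<integral>\<^sup>+\<omega>. indicator A (D \<omega> $ i) \<partial>M)"
      by (subst emeasure_distr) (auto simp: nn_integral_indicator[symmetric] simp del: nn_integral_indicator intro!: nn_integral_cong split: split_indicator)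
    also have "\<dots> = (\<integral>\<^sup>+x. ennreal (\<Prod>i\<in>UNIV. normal_density 0 \<sigma> (x $ i)) * indicator A (x $ i) \<partial>lborel)"
      by (subst distributed_nn_integral[OF D, symmetric]) auto
    also have "\<dots> = (\<integral>\<^sup>+x. (\<Prod>b\<in>Basis. f b (x \<bullet> b)) \<partial>lborel)"
    proof (rule nn_integral_cong)
      fix x :: "real ^ 'm"
      have "(\<Prod>b\<in>Basis. f b (x \<bullet> b)) = (\<Prod>j\<in>UNIV. ennreal (normal_density 0 \<sigma> (x $ j)) * (if j = i then indicator A (x $ i) else 1))"
        unfolding pr by (intro prod.cong) (auto simp: f_def inner_axis axis_eq_axis)
      also have "\<dots> = ennreal (\<Prod>i\<in>UNIV. normal_density 0 \<sigma> (x $ i)) * indicator A (x $ i)"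
        by (simp add: prod.distrib prod_ennreal)
      finally show "ennreal (\<Prod>i\<in>UNIV. normal_density 0 \<sigma> (x $ i)) * indicator A (x $ i) = (\<Prod>b\<in>Basis. f b (x \<bullet> b))" ..
    qed
    also have "\<dots> = (\<Prod>b\<in>Basis. \<integral>\<^sup>+y. f b y \<partial>lborel)"
      by (rule nn_integral_lborel_prod) auto
    also have "\<dots> = (\<Prod>j\<in>UNIV. if j = i then emeasure (density lborel (normal_density 0 \<sigma>)) A else 1)"
      unfolding pr
    proof (rule prod.cong)
      fix j
      have "(\<integral>\<^sup>+y. ennreal (normal_density 0 \<sigma> y) \<partial>lborel) = 1"
        using prob_space.emeasure_space_1[OF prob_space_normal_density[OF s, of 0]]
        by (simp add: emeasure_density)
      then show "(\<integral>\<^sup>+y. f (axis j 1) y \<partial>lborel) = (if j = i then emeasure (density lborel (normal_density 0 \<sigma>)) A else 1)"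
        by (simp add: f_def axis_eq_axis emeasure_density)
    qed simp
    also have "\<dots> = emeasure (density lborel (normal_density 0 \<sigma>)) A" by simp
    finally show "emeasure (distr M lborel (\<lambda>\<omega>. D \<omega> $ i)) A = emeasure (density lborel (normal_density 0 \<sigma>)) A" .
  qed simp
  then show ?thesis unfolding distributed_def using Dim by simp
qed

text \<open>The constant does not depend on \<open>\<sigma>\<close>, because \<open>D / \<sigma>\<close> is standard Gaussian. A real exponent is reduced to the
next natural number.\<close>

lemma (in prob_space) Gaussian_vector_moment:
  assumes K: "0 \<le> K"
  shows "\<exists>c>0. \<forall>\<sigma>>0. \<forall>D :: 'a \<Rightarrow> real ^ 'm.
     distributed M lborel D (\<lambda>x. ennreal (\<Prod>i\<in>UNIV. normal_density 0 \<sigma> (x $ i)))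
       \<longrightarrow> mean_le M (\<lambda>\<omega>. (norm (D \<omega>) / \<sigma>) powr K) c"
proof -
  define k where "k = nat \<lceil>K\<rceil>"
  define m where "m = CARD('m)"
  define c where "c = (\<integral>y. std_normal_density y * \<bar>y\<bar> ^ k \<partial>lborel)"
  have kK: "K \<le> real k" unfolding k_def by linarith
  have c0: "0 \<le> c" unfolding c_def by (intro integral_nonneg_AE) auto
  show ?thesis
  proof (intro exI[of _ "1 + real m ^ k * (real m * c)"] conjI allI impI)
    fix \<sigma> :: real and D :: "'a \<Rightarrow> real ^ 'm"
    assume s: "0 < \<sigma>" and D: "distributed M lborel D (\<lambda>x. ennreal (\<Prod>i\<in>UNIV. normal_density 0 \<sigma> (x $ i)))"
    have Dm[measurable]: "D \<in> borel_measurable M" using distributed_measurable[OF D] by simp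
    have comp: "mean_le M (\<lambda>\<omega>. \<bar>D \<omega> $ i / \<sigma>\<bar> ^ k) c" for i
    proof -
      have "distributed M lborel (\<lambda>\<omega>. (D \<omega> $ i - 0) / \<sigma>) std_normal_density"
        using distributed_normal_component[OF D s, of i] normal_standard_normal_convert[OF s, of "\<lambda>\<omega>. D \<omega> $ i" 0]
        by simp
      then have d: "distributed M lborel (\<lambda>\<omega>. D \<omega> $ i / \<sigma>) std_normal_density" by simp
      have "integrable M (\<lambda>\<omega>. \<bar>D \<omega> $ i / \<sigma>\<bar> ^ k)"
        using distributed_integrable[OF d, of "\<lambda>y. \<bar>y\<bar> ^ k"] integrable_std_normal_moment_abs[of k] by simp
      moreover have "(\<integral>\<omega>. \<bar>D \<omega> $ i / \<sigma>\<bar> ^ k \<partial>M) = c"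
        using distributed_integral[OF d, of "\<lambda>y. \<bar>y\<bar> ^ k"] by (simp add: c_def)
      ultimately show ?thesis by (simp add: mean_le_def)
    qed
    have "mean_le M (\<lambda>\<omega>. \<Sum>i\<in>UNIV. \<bar>D \<omega> $ i / \<sigma>\<bar> ^ k) (real m * c)"
    proof -
      have "(\<integral>\<omega>. (\<Sum>i\<in>UNIV. \<bar>D \<omega> $ i / \<sigma>\<bar> ^ k) \<partial>M) = (\<Sum>i\<in>UNIV. \<integral>\<omega>. \<bar>D \<omega> $ i / \<sigma>\<bar> ^ k \<partial>M)"
        using comp by (intro Bochner_Integration.integral_sum) (auto simp: mean_le_def)
      also have "\<dots> \<le> (\<Sum>i\<in>(UNIV::'m set). c)" using comp by (intro sum_mono) (auto simp: mean_le_def)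
      finally show ?thesis using comp by (auto simp: mean_le_def m_def)
    qed
    then have "mean_le M (\<lambda>\<omega>. 1 + real m ^ k * (\<Sum>i\<in>UNIV. \<bar>D \<omega> $ i / \<sigma>\<bar> ^ k)) (1 + real m ^ k * (real m * c))"
      by (intro mean_le_add mean_le_const mean_le_cmult) auto
    then show "mean_le M (\<lambda>\<omega>. (norm (D \<omega>) / \<sigma>) powr K) (1 + real m ^ k * (real m * c))"
    proof (rule mean_le_AE_mono)
      show "AE \<omega> in M. 0 \<le> (norm (D \<omega>) / \<sigma>) powr K \<and>
          (norm (D \<omega>) / \<sigma>) powr K \<le> 1 + real m ^ k * (\<Sum>i\<in>UNIV. \<bar>D \<omega> $ i / \<sigma>\<bar> ^ k)"
      proof (intro AE_I2 conjI)
        fix \<omega>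
        define a where "a i = \<bar>D \<omega> $ i / \<sigma>\<bar>" for i
        define g where "g = norm (D \<omega>) / \<sigma>"
        have g0: "0 \<le> g" using s by (simp add: g_def)
        have a0: "0 \<le> a i" for i by (simp add: a_def)
        define mx where "mx = Max (range a)"
        have "mx \<in> range a" unfolding mx_def by (intro Max_in) auto
        then obtain j where j: "mx = a j" by auto
        have le: "a i \<le> mx" for i unfolding mx_def by (intro Max_ge) auto
        have "g \<le> (\<Sum>i\<in>UNIV. a i)"
          using norm_le_l1_cart[of "D \<omega>"] s by (simp add: g_def a_def sum_divide_distrib[symmetric] divide_right_mono)
        also have "\<dots> \<le> real m * mx" using sum_bounded_above[of UNIV a mx] le by (simp add: m_def)
        finally have "g ^ k \<le> (real m * mx) ^ k" using g0 by (intro power_mono)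
        also have "\<dots> = real m ^ k * a j ^ k" by (simp add: power_mult_distrib j)
        also have "\<dots> \<le> real m ^ k * (\<Sum>i\<in>UNIV. a i ^ k)"
          using member_le_sum[of j UNIV "\<lambda>i. a i ^ k"] a0 by (intro mult_left_mono) auto
        finally have gk: "g ^ k \<le> real m ^ k * (\<Sum>i\<in>UNIV. a i ^ k)" .
        show "g powr K \<le> 1 + real m ^ k * (\<Sum>i\<in>UNIV. a i ^ k)"
        proof (cases "g \<le> 1")
          case True
          then have "g powr K \<le> 1" using K g0 by (simp add: powr_le1)
          then show ?thesis using a0 by (intro add_increasing2) (auto intro!: mult_nonneg_nonneg sum_nonneg)
        next
          case False
          then have "g powr K \<le> g powr real k" using kK by (intro powr_mono) auto
          also have "\<dots> = g ^ k" using False by (simp add: powr_realpow)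
          finally show ?thesis using gk by simp
        qed
      qed simp
    qed simp
  qed (use c0 in \<open>auto intro!: add_pos_nonneg\<close>)
qed

section \<open>Paths of the solution and of the scheme\<close>

text \<open>The setting of the theorem; \<open>Z \<tau>\<close> is the interpolated scheme with time step \<open>\<tau>\<close>.\<close>

locale tamed_scheme = tamed_drift_conditions b q r L0' L3' L4' L9 K3 K4 K7 r2
  for b :: "real ^ 'd \<Rightarrow> real ^ 'd" and q r L0' L3' L4' L9 K3 K4 K7 r2 :: real +
  fixes M :: "'a measure" and F :: "real \<Rightarrow> 'a measure" and W :: "real \<Rightarrow> 'a \<Rightarrow> real ^ 'm"
    and B :: "real ^ 'm ^ 'd" and p :: real
    and X0 :: "'a \<Rightarrow> real ^ 'd" and X :: "real \<Rightarrow> 'a \<Rightarrow> real ^ 'd" and Z :: "real \<Rightarrow> real \<Rightarrow> 'a \<Rightarrow> real ^ 'd"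
  assumes filtered: "complete_filtered_prob_space M F"
    and wiener: "wiener_process M F W"
    and p: "p \<ge> 2"
    and X0_moment: "integrable M (\<lambda>\<omega>. norm (X0 \<omega>) powr (2 * p * r2))"
    and X_sde: "additive_noise_sde M F W (\<lambda>s \<omega>. b (X s \<omega>)) B X0 X"
    and Z_sde: "\<tau> \<in> {0<..<1} \<Longrightarrow> additive_noise_sde M F W
             (\<lambda>s \<omega>. tamed_drift q b \<tau> (Z \<tau> (grid_floor \<tau> s) \<omega>)) B X0 (Z \<tau>)"
begin

lemma prob_space_M: "prob_space M" and complete_M: "complete_measure M"
  and sub: "0 \<le> t \<Longrightarrow> subalgebra M (F t)"
  and sets_F_mono: "0 \<le> s \<Longrightarrow> s \<le> t \<Longrightarrow> sets (F s) \<subseteq> sets (F t)"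
  and null_sets_F: "0 \<le> t \<Longrightarrow> null_sets M \<subseteq> sets (F t)"
proof -
  show "null_sets M \<subseteq> sets (F t)" if "0 \<le> t"
    using filtered that unfolding complete_filtered_prob_space_def by (meson order_refl subset_trans)
qed (use filtered in \<open>auto simp: complete_filtered_prob_space_def\<close>)

sublocale prob_space M by (rule prob_space_M)

lemma F_measurable_mono: "f \<in> F s \<rightarrow>\<^sub>M N \<Longrightarrow> 0 \<le> s \<Longrightarrow> s \<le> t \<Longrightarrow> f \<in> F t \<rightarrow>\<^sub>M N"
  using sub[of s] sub[of t] sets_F_mono[of s t] unfolding subalgebra_def measurable_def by auto

lemma F_measurable_M: "f \<in> F s \<rightarrow>\<^sub>M N \<Longrightarrow> 0 \<le> s \<Longrightarrow> f \<in> M \<rightarrow>\<^sub>M N"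
  by (rule measurable_from_subalg[OF sub])

lemma W_measurable: "0 \<le> t \<Longrightarrow> W t \<in> borel_measurable (F t)"
  using wiener by (simp add: wiener_process_def adapted_process_def)

lemma X_measurable: "0 \<le> t \<Longrightarrow> X t \<in> borel_measurable (F t)"
  using X_sde by (simp add: additive_noise_sde_def adapted_process_def)

lemma Z_measurable: "\<tau> \<in> {0<..<1} \<Longrightarrow> 0 \<le> t \<Longrightarrow> Z \<tau> t \<in> borel_measurable (F t)"
  using Z_sde by (simp add: additive_noise_sde_def adapted_process_def)

lemma W_meas: "0 \<le> t \<Longrightarrow> W t \<in> borel_measurable M"
  by (rule F_measurable_M[OF W_measurable])

lemma X_meas: "0 \<le> t \<Longrightarrow> X t \<in> borel_measurable M"
  by (rule F_measurable_M[OF X_measurable])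

lemma Z_meas: "\<tau> \<in> {0<..<1} \<Longrightarrow> 0 \<le> t \<Longrightarrow> Z \<tau> t \<in> borel_measurable M"
  by (rule F_measurable_M[OF Z_measurable])

lemma W_continuous: "AE \<omega> in M. continuous_on {0..} (\<lambda>t. W t \<omega>)"
  using wiener by (simp add: wiener_process_def continuous_paths_def)

lemma X_continuous: "AE \<omega> in M. continuous_on {0..} (\<lambda>t. X t \<omega>)"
  using X_sde by (simp add: additive_noise_sde_def continuous_paths_def)

lemma Z_continuous: "\<tau> \<in> {0<..<1} \<Longrightarrow> AE \<omega> in M. continuous_on {0..} (\<lambda>t. Z \<tau> t \<omega>)"
  using Z_sde by (simp add: additive_noise_sde_def continuous_paths_def)

text \<open>The noise is subtracted because paths of \<open>W\<close> are not differentiable; what remains is a time integral with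
a continuous integrand.\<close>

lemma X_derivative:
  "AE \<omega> in M. X 0 \<omega> = X0 \<omega> \<and> (\<forall>a\<ge>0. \<forall>c. \<forall>s\<in>{a..c}. ((\<lambda>s. X s \<omega> - B *v W s \<omega>) has_vector_derivative b (X s \<omega>)) (at s within {a..c}))"
proof -
  have "AE \<omega> in M. \<forall>t\<ge>0. set_integrable lborel {0..t} (\<lambda>s. b (X s \<omega>)) \<and>
        X t \<omega> = X0 \<omega> + (LINT s:{0..t}|lborel. b (X s \<omega>)) + B *v (W t \<omega> - W 0 \<omega>)"
    using X_sde by (simp add: additive_noise_sde_def)
  with X_continuous show ?thesis
  proof eventually_elim
    case (elim \<omega>)
    let ?f = "\<lambda>s. b (X s \<omega>)"
    have eq: "X t \<omega> - B *v W t \<omega> = (X0 \<omega> - B *v W 0 \<omega>) + integral {0..t} ?f" if "0 \<le> t" for t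
      using elim(2) that set_borel_integral_eq_integral(2)[of "{0..t}" ?f]
      by (simp add: matrix_vector_mult_diff_distrib)
    have "X 0 \<omega> = X0 \<omega>" using eq[of 0] by simp
    moreover have "((\<lambda>s. X s \<omega> - B *v W s \<omega>) has_vector_derivative ?f s) (at s within {a..c})"
      if as: "0 \<le> a" "s \<in> {a..c}" for a c s
    proof -
      have cont: "continuous_on {0..c} ?f"
        by (rule continuous_on_compose2[OF continuous_on_b[of UNIV] continuous_on_subset[OF elim(1)]]) auto
      have "((\<lambda>s. (X0 \<omega> - B *v W 0 \<omega>) + integral {0..s} ?f) has_vector_derivative 0 + ?f s) (at s within {0..c})"
        using as by (intro has_vector_derivative_add has_vector_derivative_const integral_has_vector_derivative[OF cont]) auto
      then have "((\<lambda>s. (X0 \<omega> - B *v W 0 \<omega>) + integral {0..s} ?f) has_vector_derivative ?f s) (at s within {a..c})"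
        using as by (rule_tac has_vector_derivative_within_subset[where S="{0..c}"]) auto
      then show ?thesis
      proof (rule has_vector_derivative_transform[rotated 2])
        show "X u \<omega> - B *v W u \<omega> = (X0 \<omega> - B *v W 0 \<omega>) + integral {0..u} ?f" if "u \<in> {a..c}" for u
        proof (rule eq)
          show "0 \<le> u" using that as(1) by simp
        qed
      qed (rule as)
    qed
    ultimately show ?case by blast
  qed
qed

lemma grid_floor_eq:
  assumes "0 < \<tau>" "real j * \<tau> \<le> u" "u < real (Suc j) * \<tau>"
  shows "grid_floor \<tau> u = real j * \<tau>"
proof -
  have "\<lfloor>u / \<tau>\<rfloor> = int j" using assms by (intro floor_unique) (auto simp: field_simps)
  then show ?thesis by (simp add: grid_floor_def)
qed

text \<open>On a cell of the grid the integrand is constant, except at the right end point, which is a null set.\<close>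

lemma Z_step:
  assumes \<tau>: "\<tau> \<in> {0<..<1}"
  shows "AE \<omega> in M. Z \<tau> 0 \<omega> = X0 \<omega> \<and> (\<forall>j. \<forall>s\<in>{real j * \<tau>..real (Suc j) * \<tau>}.
     Z \<tau> s \<omega> = Z \<tau> (real j * \<tau>) \<omega> + ((s - real j * \<tau>) *\<^sub>R tamed_drift q b \<tau> (Z \<tau> (real j * \<tau>) \<omega>)
       + B *v (W s \<omega> - W (real j * \<tau>) \<omega>)))"
proof -
  have "AE \<omega> in M. \<forall>t\<ge>0. set_integrable lborel {0..t} (\<lambda>s. tamed_drift q b \<tau> (Z \<tau> (grid_floor \<tau> s) \<omega>)) \<and>
        Z \<tau> t \<omega> = X0 \<omega> + (LINT s:{0..t}|lborel. tamed_drift q b \<tau> (Z \<tau> (grid_floor \<tau> s) \<omega>)) + B *v (W t \<omega> - W 0 \<omega>)"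
    using Z_sde[OF \<tau>] by (simp add: additive_noise_sde_def)
  then show ?thesis
  proof eventually_elim
    case (elim \<omega>)
    define f where "f s = tamed_drift q b \<tau> (Z \<tau> (grid_floor \<tau> s) \<omega>)" for s
    have f: "f integrable_on {0..t}" "Z \<tau> t \<omega> = X0 \<omega> + integral {0..t} f + B *v (W t \<omega> - W 0 \<omega>)"
      if "0 \<le> t" for t
      using elim that set_borel_integral_eq_integral[of "{0..t}" f] unfolding f_def by auto
    have "Z \<tau> 0 \<omega> = X0 \<omega>" using f(2)[of 0] by simp
    moreover have "Z \<tau> s \<omega> = Z \<tau> (real j * \<tau>) \<omega> + ((s - real j * \<tau>) *\<^sub>R tamed_drift q b \<tau> (Z \<tau> (real j * \<tau>) \<omega>)
       + B *v (W s \<omega> - W (real j * \<tau>) \<omega>))" if s: "s \<in> {real j * \<tau>..real (Suc j) * \<tau>}" for j s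
    proof -
      let ?a = "real j * \<tau>"
      have a0: "0 \<le> ?a" using \<tau> by simp
      have s0: "0 \<le> s" "?a \<le> s" using s a0 by auto
      have "integral {?a..s} f = integral {?a..s} (\<lambda>u. tamed_drift q b \<tau> (Z \<tau> ?a \<omega>))"
      proof (rule integral_spike[of "{real (Suc j) * \<tau>}"])
        fix u assume u: "u \<in> {?a..s} - {real (Suc j) * \<tau>}"
        then have "grid_floor \<tau> u = ?a" using s \<tau> by (intro grid_floor_eq) auto
        then show "tamed_drift q b \<tau> (Z \<tau> ?a \<omega>) = f u" by (simp add: f_def)
      qed simp
      also have "\<dots> = (s - ?a) *\<^sub>R tamed_drift q b \<tau> (Z \<tau> ?a \<omega>)" using s0 by simp
      finally have i: "integral {?a..s} f = (s - ?a) *\<^sub>R tamed_drift q b \<tau> (Z \<tau> ?a \<omega>)" .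
      have "integral {0..?a} f + integral {?a..s} f = integral {0..s} f"
        using Henstock_Kurzweil_Integration.integral_combine[OF a0 s0(2) f(1)[OF s0(1)]] .
      then have "integral {0..s} f = integral {0..?a} f + (s - ?a) *\<^sub>R tamed_drift q b \<tau> (Z \<tau> ?a \<omega>)"
        unfolding i by (rule sym)
      then show ?thesis unfolding f(2)[OF s0(1)] f(2)[OF a0]
        by (simp add: matrix_vector_mult_diff_distrib)
    qed
    ultimately show ?case by blast
  qed
qed

text \<open>The scale \<open>\<tau>\<close> is only required to dominate \<open>t - s\<close>, so that the same constant serves all times of a cell.\<close>

lemma increment_moment:
  assumes K: "0 \<le> K"
  shows "\<exists>c>0. \<forall>s t \<tau>. 0 \<le> s \<and> s \<le> t \<and> t - s \<le> \<tau> \<and> 0 < \<tau>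
           \<longrightarrow> mean_le M (\<lambda>\<omega>. (norm (W t \<omega> - W s \<omega>) / sqrt \<tau>) powr K) c"
proof -
  obtain c where c: "c > 0" "\<And>\<sigma> (D :: 'a \<Rightarrow> real ^ 'm). \<sigma> > 0 \<Longrightarrow>
     distributed M lborel D (\<lambda>x. ennreal (\<Prod>i\<in>UNIV. normal_density 0 \<sigma> (x $ i)))
       \<Longrightarrow> mean_le M (\<lambda>\<omega>. (norm (D \<omega>) / \<sigma>) powr K) c"
    using Gaussian_vector_moment[OF K, where 'm='m] by blast
  show ?thesis
  proof (intro exI[of _ c] conjI allI impI)
    fix s t \<tau> :: real assume st: "0 \<le> s \<and> s \<le> t \<and> t - s \<le> \<tau> \<and> 0 < \<tau>"
    show "mean_le M (\<lambda>\<omega>. (norm (W t \<omega> - W s \<omega>) / sqrt \<tau>) powr K) c"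
    proof (cases "s = t")
      case True
      then show ?thesis using c(1) by (simp add: mean_le_def)
    next
      case False
      then have "distributed M lborel (\<lambda>\<omega>. W t \<omega> - W s \<omega>) (\<lambda>x. ennreal (\<Prod>i\<in>UNIV. normal_density 0 (sqrt (t - s)) (x $ i)))"
        using st wiener unfolding wiener_process_def by auto
      then have "mean_le M (\<lambda>\<omega>. (norm (W t \<omega> - W s \<omega>) / sqrt (t - s)) powr K) c"
        using False st by (intro c(2)) auto
      then show ?thesis
      proof (rule mean_le_AE_mono)
        show "(\<lambda>\<omega>. (norm (W t \<omega> - W s \<omega>) / sqrt \<tau>) powr K) \<in> borel_measurable M"
        proof -
          have "W t \<in> borel_measurable M" "W s \<in> borel_measurable M" using st by (auto intro!: W_meas)
          then show ?thesis by simp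
        qed
        show "AE \<omega> in M. 0 \<le> (norm (W t \<omega> - W s \<omega>) / sqrt \<tau>) powr K \<and>
            (norm (W t \<omega> - W s \<omega>) / sqrt \<tau>) powr K \<le> (norm (W t \<omega> - W s \<omega>) / sqrt (t - s)) powr K"
        proof (rule AE_I2)
          fix \<omega>
          have "norm (W t \<omega> - W s \<omega>) / sqrt \<tau> \<le> norm (W t \<omega> - W s \<omega>) / sqrt (t - s)"
            using st False by (intro divide_left_mono mult_pos_pos) auto
          then show "0 \<le> (norm (W t \<omega> - W s \<omega>) / sqrt \<tau>) powr K \<and>
            (norm (W t \<omega> - W s \<omega>) / sqrt \<tau>) powr K \<le> (norm (W t \<omega> - W s \<omega>) / sqrt (t - s)) powr K"
            using st K by (auto intro!: powr_mono2)
        qed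
      qed
    qed
  qed (rule c(1))
qed

text \<open>The increment after time \<open>s\<close> is independent of everything known at time \<open>s\<close>.\<close>

lemma increment_component_product:
  assumes st: "0 \<le> s" "s < t" and H: "H \<in> borel_measurable (F s)" "integrable M H"
  shows "integrable M (\<lambda>\<omega>. H \<omega> * (W t \<omega> - W s \<omega>) $ i)"
    and "(\<integral>\<omega>. H \<omega> * (W t \<omega> - W s \<omega>) $ i \<partial>M) = 0"
    and "(\<integral>\<omega>. \<bar>H \<omega> * (W t \<omega> - W s \<omega>) $ i\<bar> \<partial>M) = (\<integral>\<omega>. \<bar>H \<omega>\<bar> \<partial>M) * (\<integral>\<omega>. \<bar>(W t \<omega> - W s \<omega>) $ i\<bar> \<partial>M)"
proof -
  let ?D = "\<lambda>\<omega>. W t \<omega> - W s \<omega>" and ?d = "\<lambda>\<omega>. (W t \<omega> - W s \<omega>) $ i"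
  have D: "distributed M lborel ?D (\<lambda>x. ennreal (\<Prod>i\<in>UNIV. normal_density 0 (sqrt (t - s)) (x $ i)))"
    and ind: "indep_set (sets (F s)) (sets (vimage_algebra (space M) ?D borel))"
    using wiener st unfolding wiener_process_def by auto
  have d: "distributed M lborel ?d (normal_density 0 (sqrt (t - s)))"
    using distributed_normal_component[OF D, of i] st by simp
  have dm: "?d \<in> borel_measurable M" using distributed_measurable[OF d] by simp
  have d_int: "integrable M ?d"
    using integrable_normal_moment_nz_1[of "sqrt (t - s)" 0] st by (intro distributed_integrable_var[OF d]) auto
  have d0: "(\<integral>\<omega>. ?d \<omega> \<partial>M) = 0"
    using normal_distributed_expectation[OF _ d] st by simp
  have indep: "indep_var borel H' borel (\<lambda>\<omega>. \<phi> (?D \<omega>))"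
    if H': "H' \<in> borel_measurable (F s)" and \<phi>: "\<phi> \<in> borel_measurable borel"
    for H' :: "'a \<Rightarrow> real" and \<phi> :: "real ^ 'm \<Rightarrow> real"
    unfolding indep_var_eq
  proof (intro conjI)
    show H'M: "random_variable borel H'" using F_measurable_M[OF H' st(1)] .
    have Dm: "?D \<in> borel_measurable M" using distributed_measurable[OF D] by simp
    show "random_variable borel (\<lambda>\<omega>. \<phi> (?D \<omega>))" by (rule measurable_compose[OF Dm \<phi>])
    have sp: "space (F s) = space M" using sub[OF st(1)] by (simp add: subalgebra_def)
    have "indep_set {H' -` A \<inter> space M |A. A \<in> sets borel} {(\<lambda>\<omega>. \<phi> (?D \<omega>)) -` A \<inter> space M |A. A \<in> sets borel}"
      unfolding indep_sets2_eq
    proof (intro conjI ballI)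
      have 1: "{H' -` A \<inter> space M |A. A \<in> sets borel} \<subseteq> sets (F s)"
        using measurable_sets[OF H'] sp by auto
      have 2: "{(\<lambda>\<omega>. \<phi> (?D \<omega>)) -` A \<inter> space M |A. A \<in> sets borel} \<subseteq> sets (vimage_algebra (space M) ?D borel)"
      proof safe
        fix A :: "real set" assume "A \<in> sets borel"
        then have "\<phi> -` A \<in> sets borel" using measurable_sets[OF \<phi>, of A] by simp
        from in_vimage_algebra[OF this, of ?D "space M"]
        show "(\<lambda>\<omega>. \<phi> (?D \<omega>)) -` A \<inter> space M \<in> sets (vimage_algebra (space M) ?D borel)"
          by (simp add: vimage_def)
      qed
      note i = iffD1[OF indep_sets2_eq ind]
      show "{H' -` A \<inter> space M |A. A \<in> sets borel} \<subseteq> events" using 1 conjunct1[OF i] by (rule subset_trans)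
      show "{(\<lambda>\<omega>. \<phi> (?D \<omega>)) -` A \<inter> space M |A. A \<in> sets borel} \<subseteq> events"
        using 2 conjunct1[OF conjunct2[OF i]] by (rule subset_trans)
      show "prob (x \<inter> y) = prob x * prob y" if "x \<in> {H' -` A \<inter> space M |A. A \<in> sets borel}"
        "y \<in> {(\<lambda>\<omega>. \<phi> (?D \<omega>)) -` A \<inter> space M |A. A \<in> sets borel}" for x y
        using bspec[OF bspec[OF conjunct2[OF conjunct2[OF i]] subsetD[OF 1 that(1)]] subsetD[OF 2 that(2)]] .
    qed
    then show "indep_set (sigma_sets (space M) {H' -` A \<inter> space M |A. A \<in> sets borel})
       (sigma_sets (space M) {(\<lambda>\<omega>. \<phi> (?D \<omega>)) -` A \<inter> space M |A. A \<in> sets borel})"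
    proof (rule indep_set_sigma_sets)
      have *: "Int_stable {f -` A \<inter> space M |A. A \<in> sets borel}" for f :: "'a \<Rightarrow> real"
      proof (rule Int_stableI, safe)
        fix A A' :: "real set" assume "A \<in> sets borel" "A' \<in> sets borel"
        then show "\<exists>C. f -` A \<inter> space M \<inter> (f -` A' \<inter> space M) = f -` C \<inter> space M \<and> C \<in> sets borel"
          by (intro exI[of _ "A \<inter> A'"]) auto
      qed
      show "Int_stable {H' -` A \<inter> space M |A. A \<in> sets borel}" by (rule *)
      show "Int_stable {(\<lambda>\<omega>. \<phi> (?D \<omega>)) -` A \<inter> space M |A. A \<in> sets borel}" by (rule *)
    qed
  qed
  have nth: "(\<lambda>x :: real ^ 'm. x $ i) \<in> borel_measurable borel"
    by (intro borel_measurable_continuous_onI continuous_intros)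
  have ind1: "indep_var borel H borel ?d" using indep[OF H(1) nth] by simp
  show "integrable M (\<lambda>\<omega>. H \<omega> * ?d \<omega>)" by (rule indep_var_integrable[OF ind1 H(2) d_int])
  show "(\<integral>\<omega>. H \<omega> * ?d \<omega> \<partial>M) = 0"
    using indep_var_lebesgue_integral[OF ind1 H(2) d_int] d0 by simp
  have "indep_var borel (\<lambda>\<omega>. \<bar>H \<omega>\<bar>) borel (\<lambda>\<omega>. \<bar>?d \<omega>\<bar>)"
    by (rule indep) (use H(1) nth in measurable)
  from indep_var_lebesgue_integral[OF this] H(2) d_int
  show "(\<integral>\<omega>. \<bar>H \<omega> * ?d \<omega>\<bar> \<partial>M) = (\<integral>\<omega>. \<bar>H \<omega>\<bar> \<partial>M) * (\<integral>\<omega>. \<bar>?d \<omega>\<bar> \<partial>M)"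
    by (simp add: abs_mult)
qed

end

section \<open>Moment bounds\<close>

text \<open>The discrete Gronwall inequality for means. The step is an implication between mean bounds and not an
inequality between the functions, because for the martingale below it holds only in expectation.\<close>

lemma mean_le_gronwall:
  assumes "0 \<le> c" "0 \<le> \<tau>" "0 \<le> K" "mean_le M (f 0) A"
    and "\<And>j a. j < n \<Longrightarrow> mean_le M (f j) a \<Longrightarrow> mean_le M (f (Suc j)) (exp (c * \<tau>) * (a + \<tau> * K))"
  shows "mean_le M (f n) (exp (c * (real n * \<tau>)) * (A + real n * \<tau> * K))"
  using assms(5)
proof (induction n)
  case 0
  show ?case using assms(4) by simp
next
  case (Suc n)
  let ?e = "exp (c * (real n * \<tau>))"
  have "mean_le M (f (Suc n)) (exp (c * \<tau>) * (?e * (A + real n * \<tau> * K) + \<tau> * K))"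
    using Suc by simp
  then show ?case
  proof (rule mean_le_mono)
    have "\<tau> * K * 1 \<le> \<tau> * K * ?e" using assms by (intro mult_left_mono) auto
    then have "exp (c * \<tau>) * (?e * (A + real n * \<tau> * K) + \<tau> * K) \<le> exp (c * \<tau>) * (?e * (A + real n * \<tau> * K) + \<tau> * K * ?e)"
      by (intro mult_left_mono) auto
    also have "\<dots> = exp (c * (real (Suc n) * \<tau>)) * (A + real (Suc n) * \<tau> * K)"
      by (simp add: algebra_simps exp_add)
    finally show "exp (c * \<tau>) * (?e * (A + real n * \<tau> * K) + \<tau> * K) \<le> exp (c * (real (Suc n) * \<tau>)) * (A + real (Suc n) * \<tau> * K)" .
  qed
qed

context tamed_scheme
begin

text \<open>The order of the moment that the initial value is assumed to have. All powers below have to fit into it.\<close>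

definition \<Lambda> :: real where "\<Lambda> = 2 * p * r2"
definition \<mu> :: real where "\<mu> = (\<integral>\<omega>. norm (X0 \<omega>) powr \<Lambda> \<partial>M)"

text \<open>The shape of all bounds on moments up to time \<open>t\<close>. The following lemmas show that, up to a change of the
constant \<open>C\<close>, this shape is stable under sums, multiples, exponential factors and accumulation over time.\<close>

definition growth :: "real \<Rightarrow> real \<Rightarrow> real" where "growth C t = C * exp (C * t) * (1 + \<mu>)"

lemma \<Lambda>_bounds: "12 < \<Lambda>" "4 * p * q \<le> \<Lambda>" "4 * p * q + 2 * p \<le> \<Lambda>"
proof -
  have "2 * 2 * 3 < (2 * p) * r2" using p r2_bounds by (intro mult_le_less_imp_less) auto
  then show "12 < \<Lambda>" by (simp add: \<Lambda>_def)
  have "2 * p * (2 * q + 1) \<le> \<Lambda>" unfolding \<Lambda>_def using p r2_bounds by (intro mult_left_mono) auto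
  then show "4 * p * q + 2 * p \<le> \<Lambda>" by (simp add: algebra_simps)
  then show "4 * p * q \<le> \<Lambda>" using p by linarith
qed

lemma \<Lambda>_nonneg: "0 \<le> \<Lambda>" using \<Lambda>_bounds by simp

lemma \<mu>_nonneg: "0 \<le> \<mu>" unfolding \<mu>_def by (intro integral_nonneg_AE) auto

lemma mean_X0: "mean_le M (\<lambda>\<omega>. norm (X0 \<omega>) powr \<Lambda>) \<mu>"
  using X0_moment by (simp add: mean_le_def \<mu>_def \<Lambda>_def)

lemma growth_nonneg: "0 \<le> C \<Longrightarrow> 0 \<le> growth C t"
  using \<mu>_nonneg by (simp add: growth_def)

lemma growth_mono: "0 \<le> C \<Longrightarrow> C \<le> C' \<Longrightarrow> 0 \<le> t \<Longrightarrow> t \<le> t' \<Longrightarrow> growth C t \<le> growth C' t'"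
  unfolding growth_def using \<mu>_nonneg by (intro mult_right_mono mult_mono) (auto intro!: mult_mono)

lemma growth_const: "0 \<le> c \<Longrightarrow> 0 \<le> t \<Longrightarrow> c \<le> growth c t"
proof -
  assume a: "0 \<le> c" "0 \<le> t"
  then have "1 * 1 \<le> exp (c * t) * (1 + \<mu>)" using \<mu>_nonneg by (intro mult_mono) auto
  then have "c * 1 \<le> c * (exp (c * t) * (1 + \<mu>))" using a by (intro mult_left_mono) auto
  then show ?thesis by (simp add: growth_def mult.assoc)
qed

lemma growth_\<mu>: "0 \<le> t \<Longrightarrow> \<mu> \<le> growth 1 t"
  using \<mu>_nonneg mult_mono[of 1 "exp t" \<mu> "1 + \<mu>"] by (simp add: growth_def)

lemma growth_add:
  assumes "0 \<le> C" "0 \<le> D" "0 \<le> t" shows "growth C t + growth D t \<le> growth (C + D) t"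
proof -
  have "C * exp (C * t) + D * exp (D * t) \<le> C * exp ((C + D) * t) + D * exp ((C + D) * t)"
    using assms by (intro add_mono mult_left_mono) (auto intro!: mult_right_mono)
  then have "(C * exp (C * t) + D * exp (D * t)) * (1 + \<mu>) \<le> (C * exp ((C + D) * t) + D * exp ((C + D) * t)) * (1 + \<mu>)"
    using \<mu>_nonneg by (intro mult_right_mono) auto
  then show ?thesis by (simp add: growth_def algebra_simps)
qed

lemma growth_cmult:
  assumes "0 \<le> c" "0 \<le> C" "0 \<le> t" shows "c * growth C t \<le> growth (c * C + C) t"
proof -
  have "(c * C) * exp (C * t) \<le> (c * C + C) * exp ((c * C + C) * t)"
    using assms by (intro mult_mono) (auto intro!: mult_right_mono)
  then have "(c * C) * exp (C * t) * (1 + \<mu>) \<le> (c * C + C) * exp ((c * C + C) * t) * (1 + \<mu>)"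
    using \<mu>_nonneg by (intro mult_right_mono) auto
  then show ?thesis by (simp add: growth_def mult.assoc)
qed

lemma growth_exp:
  assumes "0 \<le> c" "0 \<le> C" "0 \<le> t" shows "exp (c * t) * growth C t \<le> growth (C + c) t"
proof -
  have "C * exp ((C + c) * t) * (1 + \<mu>) \<le> (C + c) * exp ((C + c) * t) * (1 + \<mu>)"
    using assms \<mu>_nonneg by (intro mult_right_mono) auto
  then show ?thesis by (simp add: growth_def exp_add algebra_simps)
qed

lemma growth_time:
  assumes "0 \<le> C" "0 \<le> t" shows "t * growth C t \<le> growth (C + 1) t"
proof -
  have "t \<le> exp (1 * t)" unfolding mult_1 using exp_ge_add_one_self[of t] by linarith
  then have "t * growth C t \<le> exp (1 * t) * growth C t" using growth_nonneg assms by (intro mult_right_mono) auto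
  also have "\<dots> \<le> growth (C + 1) t" using assms by (intro growth_exp) auto
  finally show ?thesis .
qed

lemma growth_accumulated:
  assumes "0 \<le> c" "0 \<le> C" "0 \<le> t" shows "exp (c * t) * (\<mu> + t * growth C t) \<le> growth (C + c + 2) t"
proof -
  have "\<mu> + t * growth C t \<le> growth 1 t + growth (C + 1) t" using growth_\<mu> growth_time assms by (intro add_mono) auto
  also have "\<dots> \<le> growth (1 + (C + 1)) t" using assms by (intro growth_add) auto
  finally have "exp (c * t) * (\<mu> + t * growth C t) \<le> exp (c * t) * growth (C + 2) t"
    by (intro mult_left_mono) (auto simp: add.commute)
  also have "\<dots> \<le> growth (C + 2 + c) t" using assms by (intro growth_exp) auto
  finally show ?thesis by (simp add: algebra_simps)
qed

lemma mean_growth_add: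
  assumes "0 \<le> C" "0 \<le> D" "0 \<le> t" "mean_le M f (growth C t)" "mean_le M g (growth D t)"
  shows "mean_le M (\<lambda>\<omega>. f \<omega> + g \<omega>) (growth (C + D) t)"
  using mean_le_add[OF assms(4,5)] growth_add[OF assms(1-3)] by (rule mean_le_mono)

lemma mean_growth_cmult:
  assumes "0 \<le> c" "0 \<le> C" "0 \<le> t" "mean_le M f (growth C t)"
  shows "mean_le M (\<lambda>\<omega>. c * f \<omega>) (growth (c * C + C) t)"
  using mean_le_cmult[OF assms(4,1)] growth_cmult[OF assms(1-3)] by (rule mean_le_mono)

lemma mean_growth_const:
  assumes "0 \<le> c" "0 \<le> t" shows "mean_le M (\<lambda>\<omega>. c) (growth c t)"
  using mean_le_const growth_const[OF assms] by (rule mean_le_mono)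

lemma mean_growth_mono:
  assumes "mean_le M f (growth C s)" "0 \<le> C" "C \<le> D" "0 \<le> s" "s \<le> t"
  shows "mean_le M f (growth D t)"
  using assms(1) growth_mono[OF assms(2-5)] by (rule mean_le_mono)

definition B_opnorm :: real where "B_opnorm = onorm (\<lambda>x. B *v x)"

lemma norm_B_le: "norm (B *v x) \<le> B_opnorm * norm x" and B_opnorm_nonneg: "0 \<le> B_opnorm"
  unfolding B_opnorm_def by (auto intro!: onorm onorm_pos_le matrix_vector_mul_bounded_linear)

text \<open>The increment is normalised by \<open>1 + t\<close>, which is positive also at \<open>t = 0\<close>.\<close>

lemma noise_moment:
  assumes K: "0 \<le> K"
  shows "\<exists>C>0. \<forall>t\<ge>0. mean_le M (\<lambda>\<omega>. norm (W t \<omega> - W 0 \<omega>) powr K) (growth C t)"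
proof -
  obtain c where c: "c > 0" "\<And>s t \<tau>. 0 \<le> s \<Longrightarrow> s \<le> t \<Longrightarrow> t - s \<le> \<tau> \<Longrightarrow> 0 < \<tau> \<Longrightarrow>
     mean_le M (\<lambda>\<omega>. (norm (W t \<omega> - W s \<omega>) / sqrt \<tau>) powr K) c"
    using increment_moment[OF K] by blast
  show ?thesis
  proof (intro exI[of _ "c + K"] conjI allI impI)
    fix t :: real assume t: "0 \<le> t"
    have "sqrt (1 + t) powr K \<le> exp t powr K"
    proof (intro powr_mono2)
      have "sqrt (1 + t) \<le> sqrt ((1 + t)\<^sup>2)" using t by (intro real_sqrt_le_mono) (simp add: power2_eq_square)
      also have "\<dots> \<le> exp t" using t by simp
      finally show "sqrt (1 + t) \<le> exp t" .
    qed (use K t in auto)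
    also have "\<dots> = exp (K * t)" by (simp add: exp_powr_real mult.commute)
    finally have e: "sqrt (1 + t) powr K \<le> exp (K * t)" .
    have "mean_le M (\<lambda>\<omega>. sqrt (1 + t) powr K * (norm (W t \<omega> - W 0 \<omega>) / sqrt (1 + t)) powr K) (sqrt (1 + t) powr K * c)"
      using t by (intro mean_le_cmult c(2)) auto
    moreover have "sqrt (1 + t) powr K * (norm (W t \<omega> - W 0 \<omega>) / sqrt (1 + t)) powr K = norm (W t \<omega> - W 0 \<omega>) powr K" for \<omega>
      using t by (subst powr_mult[symmetric]) auto
    moreover have "sqrt (1 + t) powr K * c \<le> exp (K * t) * growth c t"
      using e c(1) t growth_const[of c t] by (intro mult_mono) auto
    moreover have "\<dots> \<le> growth (c + K) t" using c K t by (intro growth_exp) auto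
    ultimately show "mean_le M (\<lambda>\<omega>. norm (W t \<omega> - W 0 \<omega>) powr K) (growth (c + K) t)"
      by (metis (no_types, lifting) ext mean_le_mono order_trans)
  qed (use c K in auto)
qed

text \<open>The powers of the noise at time \<open>t\<close> that drive the moments of the solution and of the scheme.\<close>

definition noise_load :: "real \<Rightarrow> 'a \<Rightarrow> real" where
  "noise_load t \<omega> = 1 + norm (B *v (W t \<omega> - W 0 \<omega>)) powr \<Lambda> + norm (b (B *v (W t \<omega> - W 0 \<omega>))) powr \<Lambda>"

lemma noise_load_ge: "1 \<le> noise_load t \<omega>" "norm (B *v (W t \<omega> - W 0 \<omega>)) powr \<Lambda> \<le> noise_load t \<omega>"
  "norm (b (B *v (W t \<omega> - W 0 \<omega>))) powr \<Lambda> \<le> noise_load t \<omega>"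
  by (auto simp: noise_load_def add_increasing add_increasing2)

lemma measurable_B: "f \<in> borel_measurable N \<Longrightarrow> (\<lambda>\<omega>. B *v f \<omega>) \<in> borel_measurable N"
  by (rule measurable_compose[OF _ borel_measurable_continuous_onI[OF linear_continuous_on]])
     (auto intro: matrix_vector_mul_bounded_linear)

lemma measurable_b: "f \<in> borel_measurable N \<Longrightarrow> (\<lambda>\<omega>. b (f \<omega>)) \<in> borel_measurable N"
  by (rule measurable_compose[OF _ borel_measurable_continuous_onI[OF continuous_on_b]])

lemma W_diff_measurable: "0 \<le> s \<Longrightarrow> 0 \<le> t \<Longrightarrow> (\<lambda>\<omega>. W t \<omega> - W s \<omega>) \<in> borel_measurable M"
  by (intro borel_measurable_diff W_meas)

lemma noise_load_measurable: "0 \<le> t \<Longrightarrow> noise_load t \<in> borel_measurable M"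
proof -
  assume "0 \<le> t"
  then have "(\<lambda>\<omega>. W t \<omega> - W 0 \<omega>) \<in> borel_measurable M" by (intro W_diff_measurable) auto
  note measurable_B[OF this]
  with measurable_b[OF this] show ?thesis unfolding noise_load_def[abs_def] by simp
qed

lemma noise_load_mean: "\<exists>C>0. \<forall>t\<ge>0. mean_le M (noise_load t) (growth C t)"
proof -
  obtain D where D: "D \<ge> 1" "\<And>x. norm (b x) \<le> D * (1 + norm x) powr (q + 1)" using drift_growth by blast
  define K where "K = (q + 1) * \<Lambda>"
  have K: "1 \<le> K" "0 \<le> \<Lambda>" "\<Lambda> \<le> K"
  proof -
    have "1 * \<Lambda> \<le> (q + 1) * \<Lambda>" using \<Lambda>_bounds q by (intro mult_right_mono) auto
    then show "\<Lambda> \<le> K" by (simp add: K_def)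
    then show "1 \<le> K" "0 \<le> \<Lambda>" using \<Lambda>_bounds by auto
  qed
  obtain C1 where C1: "C1 > 0" "\<And>t. t \<ge> 0 \<Longrightarrow> mean_le M (\<lambda>\<omega>. norm (W t \<omega> - W 0 \<omega>) powr K) (growth C1 t)"
    using noise_moment[of K] K by auto
  define c1 c2 where "c1 = 1 + (1 + D powr \<Lambda>) * 2 powr K" and "c2 = (1 + D powr \<Lambda>) * 2 powr K * B_opnorm powr K"
  have cpos: "0 < c1" "0 \<le> c2" using B_opnorm_nonneg unfolding c1_def c2_def by (auto intro!: add_pos_nonneg mult_nonneg_nonneg)
  show ?thesis
  proof (intro exI[of _ "c1 + (c2 * C1 + C1)"] conjI allI impI)
    fix t :: real assume t: "0 \<le> t"
    have "mean_le M (\<lambda>\<omega>. c1 + c2 * norm (W t \<omega> - W 0 \<omega>) powr K) (growth (c1 + (c2 * C1 + C1)) t)"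
      using t cpos C1 by (intro mean_growth_add mean_growth_cmult mean_growth_const) auto
    then show "mean_le M (noise_load t) (growth (c1 + (c2 * C1 + C1)) t)"
    proof (rule mean_le_AE_mono[OF _ noise_load_measurable[OF t] AE_I2])
      fix \<omega>
      define w where "w = W t \<omega> - W 0 \<omega>"
      define y where "y = 1 + B_opnorm * norm w"
      have y: "1 \<le> y" "norm (B *v w) \<le> y" "1 + norm (B *v w) \<le> y"
        using B_opnorm_nonneg norm_B_le[of w] by (auto simp: y_def)
      have "norm (B *v w) powr \<Lambda> \<le> y powr \<Lambda>" using y K by (intro powr_mono2) auto
      also have "\<dots> \<le> y powr K" using y K by (intro powr_mono) auto
      finally have i: "norm (B *v w) powr \<Lambda> \<le> y powr K" .
      have "norm (b (B *v w)) \<le> D * y powr (q + 1)"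
        using D(2)[of "B *v w"] D(1) y q
        by (elim order_trans) (intro mult_left_mono powr_mono2, auto)
      then have "norm (b (B *v w)) powr \<Lambda> \<le> (D * y powr (q + 1)) powr \<Lambda>" using K by (intro powr_mono2) auto
      also have "\<dots> = D powr \<Lambda> * y powr K" by (simp add: powr_mult powr_powr K_def)
      finally have "noise_load t \<omega> \<le> 1 + (1 + D powr \<Lambda>) * y powr K"
        using i by (simp add: noise_load_def w_def algebra_simps)
      also have "\<dots> \<le> 1 + (1 + D powr \<Lambda>) * (2 powr K * (1 powr K + (B_opnorm * norm w) powr K))"
        unfolding y_def using B_opnorm_nonneg K by (intro add_left_mono mult_left_mono powr_add_le) auto
      also have "\<dots> = c1 + c2 * norm w powr K"
        by (simp add: c1_def c2_def powr_mult algebra_simps)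
      finally show "0 \<le> noise_load t \<omega> \<and> noise_load t \<omega> \<le> c1 + c2 * norm (W t \<omega> - W 0 \<omega>) powr K"
        using noise_load_ge(1)[of t \<omega>] by (simp add: w_def)
    qed
  next
    show "0 < c1 + (c2 * C1 + C1)" using cpos C1 by (intro add_pos_nonneg add_nonneg_nonneg mult_nonneg_nonneg) auto
  qed
qed

lemma noise_load_continuous: "AE \<omega> in M. \<forall>a\<ge>0. \<forall>c. continuous_on {a..c} (\<lambda>s. norm (b (B *v (W s \<omega> - W 0 \<omega>))) powr \<Lambda>)"
  using W_continuous
proof eventually_elim
  case (elim \<omega>)
  show ?case
  proof (intro allI impI)
    fix a c :: real assume "0 \<le> a"
    then have "continuous_on {a..c} (\<lambda>s. W s \<omega>)" by (intro continuous_on_subset[OF elim]) auto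
    then have "continuous_on {a..c} (\<lambda>s. B *v (W s \<omega> - W 0 \<omega>))"
      by (intro linear_continuous_on_compose[OF _ matrix_vector_mul_linear] continuous_on_diff continuous_on_const)
    then have "continuous_on {a..c} (\<lambda>s. b (B *v (W s \<omega> - W 0 \<omega>)))"
      by (rule continuous_on_compose2[OF continuous_on_b[of UNIV]]) auto
    then show "continuous_on {a..c} (\<lambda>s. norm (b (B *v (W s \<omega> - W 0 \<omega>))) powr \<Lambda>)"
      using \<Lambda>_bounds by (intro continuous_on_powr' continuous_intros) auto
  qed
qed

lemma sqr_powr: "0 \<le> z \<Longrightarrow> (z\<^sup>2) powr (\<Lambda> / 2) = z powr \<Lambda>" for z :: real
  using powr_powr[of z 2 "\<Lambda> / 2"] by simp

text \<open>The path \<open>v = X - B (W - W 0)\<close> satisfies the differential inequality \<open>dissipativity_shifted\<close>, in which the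
noise enters only through \<open>b\<close> at its current value.\<close>

lemma X_moment: "\<exists>C>0. \<forall>t\<ge>0. mean_le M (\<lambda>\<omega>. norm (X t \<omega>) powr \<Lambda>) (growth C t)"
proof -
  obtain C1 where C1: "C1 > 0" "\<And>t. t \<ge> 0 \<Longrightarrow> mean_le M (noise_load t) (growth C1 t)"
    using noise_load_mean by blast
  define c where "c = (L0' + 2) * (\<Lambda> / 2)"
  have c0: "0 \<le> c" using const_pos \<Lambda>_bounds by (simp add: c_def)
  define D where "D = C1 + c + 2"
  define E where "E = 2 powr \<Lambda> * (D + C1) + (D + C1)"
  have DE: "0 < D" "0 < E" proof -
    show "0 < D" unfolding D_def using C1 c0 by (intro add_nonneg_pos add_nonneg_nonneg mult_nonneg_nonneg) auto
    then show "0 < E" unfolding E_def using C1 by (intro add_nonneg_pos add_nonneg_nonneg mult_nonneg_nonneg) auto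
  qed
  show ?thesis
  proof (intro exI[of _ E] conjI allI impI)
    fix t :: real assume t: "0 \<le> t"
    define I where "I \<omega> = integral {0..t} (\<lambda>s. norm (b (B *v (W s \<omega> - W 0 \<omega>))) powr \<Lambda>)" for \<omega>
    have mI: "mean_le M I (growth C1 t * (t - 0))"
      unfolding I_def
    proof (rule mean_le_process_integral[OF prob_space_M complete_M t])
      show "AE \<omega> in M. continuous_on {0..t} (\<lambda>s. norm (b (B *v (W s \<omega> - W 0 \<omega>))) powr \<Lambda>)"
        using noise_load_continuous by eventually_elim auto
      fix s assume s: "s \<in> {0..t}"
      show m: "mean_le M (\<lambda>\<omega>. norm (b (B *v (W s \<omega> - W 0 \<omega>))) powr \<Lambda>) (growth C1 t)"
      proof (rule mean_le_AE_mono)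
        show "mean_le M (noise_load s) (growth C1 t)"
          using C1(2)[of s] s C1(1) by (intro mean_growth_mono[of _ C1 s C1 t]) auto
        show "(\<lambda>\<omega>. norm (b (B *v (W s \<omega> - W 0 \<omega>))) powr \<Lambda>) \<in> borel_measurable M"
        proof -
          have "(\<lambda>\<omega>. W s \<omega> - W 0 \<omega>) \<in> borel_measurable M" using s by (intro W_diff_measurable) auto
          from measurable_b[OF measurable_B[OF this]] show ?thesis by simp
        qed
      qed (use noise_load_ge in auto)
      then show "mean_le M (\<lambda>\<omega>. \<bar>norm (b (B *v (W s \<omega> - W 0 \<omega>))) powr \<Lambda>\<bar>) (growth C1 t)" by simp
    qed
    have "mean_le M (\<lambda>\<omega>. exp (c * t) * (norm (X0 \<omega>) powr \<Lambda> + I \<omega>)) (exp (c * t) * (\<mu> + growth C1 t * (t - 0)))"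
      by (intro mean_le_cmult mean_le_add mean_X0 mI) auto
    then have "mean_le M (\<lambda>\<omega>. exp (c * t) * (norm (X0 \<omega>) powr \<Lambda> + I \<omega>)) (growth D t)"
      by (rule mean_le_mono) (use growth_accumulated[of c C1 t] t c0 C1 in \<open>simp add: D_def mult.commute\<close>)
    then have "mean_le M (\<lambda>\<omega>. 2 powr \<Lambda> * (exp (c * t) * (norm (X0 \<omega>) powr \<Lambda> + I \<omega>) + noise_load t \<omega>)) (growth E t)"
      unfolding E_def using C1 DE t by (intro mean_growth_cmult mean_growth_add) auto
    then show "mean_le M (\<lambda>\<omega>. norm (X t \<omega>) powr \<Lambda>) (growth E t)"
    proof (rule mean_le_AE_mono)
      show "(\<lambda>\<omega>. norm (X t \<omega>) powr \<Lambda>) \<in> borel_measurable M" using X_meas[OF t] by simp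
      show "AE \<omega> in M. 0 \<le> norm (X t \<omega>) powr \<Lambda> \<and> norm (X t \<omega>) powr \<Lambda>
          \<le> 2 powr \<Lambda> * (exp (c * t) * (norm (X0 \<omega>) powr \<Lambda> + I \<omega>) + noise_load t \<omega>)"
        using X_derivative W_continuous
      proof eventually_elim
        case (elim \<omega>)
        define w where "w s = B *v (W s \<omega> - W 0 \<omega>)" for s
        define v where "v s = X s \<omega> - w s" for s
        have v0: "v 0 = X0 \<omega>" using elim by (simp add: v_def w_def)
        have "norm (v t) powr \<Lambda> \<le> exp (c * t) * (norm (X0 \<omega>) powr \<Lambda> + I \<omega>)"
        proof (cases "t = 0")
          case True
          then show ?thesis using v0 by (simp add: I_def)
        next
          case False
          have "norm (v t) powr (2 * (\<Lambda> / 2))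
           \<le> exp ((L0' + 1 + 1) * (\<Lambda> / 2) * (t - 0)) * (norm (v 0) powr (2 * (\<Lambda> / 2)) + integral {0..t} (\<lambda>s. ((norm (b (w s)))\<^sup>2) powr (\<Lambda> / 2)))"
          proof (rule norm_powr_gronwall)
            show "(v has_vector_derivative b (X s \<omega>)) (at s within {0..t})" if "s \<in> {0..t}" for s
            proof -
              have "((\<lambda>s. (X s \<omega> - B *v W s \<omega>) + B *v W 0 \<omega>) has_vector_derivative b (X s \<omega>) + 0) (at s within {0..t})"
                using elim that by (intro has_vector_derivative_add has_vector_derivative_const) auto
              then show ?thesis by (simp add: v_def[abs_def] w_def matrix_vector_mult_diff_distrib algebra_simps)
            qed
            show "2 * (v s \<bullet> b (X s \<omega>)) \<le> (L0' + 1) * (norm (v s))\<^sup>2 + (norm (b (w s)))\<^sup>2" for s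
              using dissipativity_shifted[of "v s" "w s"] by (simp add: v_def)
            have "continuous_on {0..t} (\<lambda>s. W s \<omega>)" by (rule continuous_on_subset[OF elim(2)]) auto
            then have "continuous_on {0..t} w" unfolding w_def
              by (intro linear_continuous_on_compose[OF _ matrix_vector_mul_linear] continuous_on_diff continuous_on_const)
            then have "continuous_on {0..t} (\<lambda>s. b (w s))"
              by (rule continuous_on_compose2[OF continuous_on_b[of UNIV]]) auto
            then show "continuous_on {0..t} (\<lambda>s. (norm (b (w s)))\<^sup>2)" by (intro continuous_intros)
          qed (use False t const_pos \<Lambda>_bounds in auto)
          then show ?thesis by (simp add: sqr_powr v0 I_def w_def c_def add.commute)
        qed
        then have vw: "norm (v t) powr \<Lambda> + norm (w t) powr \<Lambda> \<le> exp (c * t) * (norm (X0 \<omega>) powr \<Lambda> + I \<omega>) + noise_load t \<omega>"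
          using noise_load_ge(2)[of t \<omega>] by (simp add: w_def)
        have "norm (X t \<omega>) powr \<Lambda> \<le> (norm (v t) + norm (w t)) powr \<Lambda>"
          using \<Lambda>_bounds norm_triangle_ineq[of "v t" "w t"] by (intro powr_mono2) (auto simp: v_def)
        also have "\<dots> \<le> 2 powr \<Lambda> * (norm (v t) powr \<Lambda> + norm (w t) powr \<Lambda>)"
          using \<Lambda>_bounds by (intro powr_add_le) auto
        also have "\<dots> \<le> 2 powr \<Lambda> * (exp (c * t) * (norm (X0 \<omega>) powr \<Lambda> + I \<omega>) + noise_load t \<omega>)"
          using vw by (intro mult_left_mono) auto
        finally show ?case by simp
      qed
    qed
  qed (use DE in auto)
qed

text \<open>The scheme with the noise subtracted, \<open>Y\<close>, satisfies \<open>tamed_step_bound\<close> in every step, path by path.\<close>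

lemma Z_grid_moment:
  "\<exists>C>0. \<forall>\<tau>\<in>{0<..<1}. \<forall>n. mean_le M (\<lambda>\<omega>. norm (Z \<tau> (real n * \<tau>) \<omega>) powr \<Lambda>) (growth C (real n * \<tau>))"
proof -
  obtain C1 where C1: "C1 > 0" "\<And>t. t \<ge> 0 \<Longrightarrow> mean_le M (noise_load t) (growth C1 t)"
    using noise_load_mean by blast
  define \<kappa> where "\<kappa> = \<Lambda> / 2"
  define c where "c = L0' + 1 + K3 + 2 * K4"
  define a where "a = (1 + K3 + 2 * K4) powr \<kappa> * 4 powr \<kappa>"
  have \<kappa>: "1 \<le> \<kappa>" using \<Lambda>_bounds by (simp add: \<kappa>_def)
  have c0: "0 \<le> c" "0 \<le> a" using const_pos by (auto simp: c_def a_def)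
  define C2 where "C2 = a * C1 + C1"
  define D where "D = C2 + (c + 1) * \<kappa> + 2"
  define E where "E = 2 powr \<Lambda> * (D + C1) + (D + C1)"
  have pos: "0 < C2" "0 < D" "0 < E" proof -
    show C2: "0 < C2" unfolding C2_def using C1 c0 by (intro add_nonneg_pos add_nonneg_nonneg mult_nonneg_nonneg) auto
    then show D: "0 < D" unfolding D_def using \<kappa> c0 by (intro add_nonneg_pos add_nonneg_nonneg mult_nonneg_nonneg) auto
    show "0 < E" unfolding E_def using C1 D by (intro add_nonneg_pos add_nonneg_nonneg mult_nonneg_nonneg) auto
  qed
  show ?thesis
  proof (intro exI[of _ E] conjI allI ballI)
    fix \<tau> :: real and n :: nat assume \<tau>: "\<tau> \<in> {0<..<1}"
    define t where "t = real n * \<tau>"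
    have t0: "0 \<le> t" using \<tau> by (simp add: t_def)
    define w where "w j \<omega> = B *v (W (real j * \<tau>) \<omega> - W 0 \<omega>)" for j \<omega>
    define Y where "Y j \<omega> = Z \<tau> (real j * \<tau>) \<omega> - w j \<omega>" for j \<omega>
    have wm: "w j \<in> borel_measurable M" for j
      unfolding w_def[abs_def] using \<tau> by (intro measurable_B W_diff_measurable) auto
    have Ym: "Y j \<in> borel_measurable M" for j
      unfolding Y_def[abs_def] using \<tau> wm by (intro borel_measurable_diff Z_meas) auto
    have step: "AE \<omega> in M. norm (Y (Suc j) \<omega>) powr \<Lambda> \<le> exp ((c + 1) * \<kappa> * \<tau>) * (norm (Y j \<omega>) powr \<Lambda> + \<tau> * (a * noise_load (real j * \<tau>) \<omega>))" for j
      using Z_step[OF \<tau>]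
    proof eventually_elim
      case (elim \<omega>)
      define bt where "bt = tamed_drift q b \<tau> (Z \<tau> (real j * \<tau>) \<omega>)"
      define G where "G = (1 + K3 + 2 * K4) * (1 + (norm (w j \<omega>))\<^sup>2 + (norm (b (w j \<omega>)))\<^sup>2)"
      have G0: "0 \<le> G" using const_pos by (simp add: G_def)
      have "Z \<tau> (real (Suc j) * \<tau>) \<omega> = Z \<tau> (real j * \<tau>) \<omega> + ((real (Suc j) * \<tau> - real j * \<tau>) *\<^sub>R bt
         + B *v (W (real (Suc j) * \<tau>) \<omega> - W (real j * \<tau>) \<omega>))"
        using elim \<tau> unfolding bt_def by (auto simp del: of_nat_Suc intro!: mult_right_mono)
      moreover have "real (Suc j) * \<tau> - real j * \<tau> = \<tau>" by (simp add: algebra_simps)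
      ultimately have "Y (Suc j) \<omega> = Y j \<omega> + \<tau> *\<^sub>R bt"
        by (simp add: Y_def w_def matrix_vector_mult_diff_distrib del: of_nat_Suc)
      moreover have "bt = tamed_drift q b \<tau> (Y j \<omega> + w j \<omega>)" by (simp add: bt_def Y_def)
      ultimately have "(norm (Y (Suc j) \<omega>))\<^sup>2 \<le> exp (c * \<tau>) * ((norm (Y j \<omega>))\<^sup>2 + \<tau> * G)"
        using tamed_step_bound[OF \<tau>, of "Y j \<omega>" "w j \<omega>"] by (simp add: c_def G_def)
      then have "((norm (Y (Suc j) \<omega>))\<^sup>2) powr \<kappa> \<le> (exp (c * \<tau>) * ((norm (Y j \<omega>))\<^sup>2 + \<tau> * G)) powr \<kappa>"
        using \<kappa> by (intro powr_mono2) auto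
      also have "\<dots> = exp (c * \<tau> * \<kappa>) * ((norm (Y j \<omega>))\<^sup>2 + \<tau> * G) powr \<kappa>"
        by (simp add: powr_mult exp_powr_real)
      also have "\<dots> \<le> exp (c * \<tau> * \<kappa>) * ((1 + \<tau>) powr (\<kappa> - 1) * (((norm (Y j \<omega>))\<^sup>2) powr \<kappa> + \<tau> * G powr \<kappa>))"
        using \<tau> G0 \<kappa> by (intro mult_left_mono powr_weighted_sum_le) auto
      also have "\<dots> \<le> exp (c * \<tau> * \<kappa>) * (exp (\<tau> * \<kappa>) * (((norm (Y j \<omega>))\<^sup>2) powr \<kappa> + \<tau> * (a * noise_load (real j * \<tau>) \<omega>)))"
      proof (intro mult_left_mono mult_mono add_left_mono)
        have "(1 + \<tau>) powr (\<kappa> - 1) \<le> exp \<tau> powr (\<kappa> - 1)" using \<tau> \<kappa> by (intro powr_mono2) auto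
        also have "\<dots> \<le> exp (\<tau> * \<kappa>)" using \<tau> by (simp add: exp_powr_real)
        finally show "(1 + \<tau>) powr (\<kappa> - 1) \<le> exp (\<tau> * \<kappa>)" .
        have "G powr \<kappa> \<le> (1 + K3 + 2 * K4) powr \<kappa> * (4 powr \<kappa> * (1 powr \<kappa> + ((norm (w j \<omega>))\<^sup>2) powr \<kappa> + ((norm (b (w j \<omega>)))\<^sup>2) powr \<kappa>))"
          unfolding G_def powr_mult using \<kappa> by (intro mult_left_mono powr_add3_le) auto
        also have "\<dots> = a * noise_load (real j * \<tau>) \<omega>"
          by (simp add: a_def \<kappa>_def sqr_powr noise_load_def w_def)
        finally show "G powr \<kappa> \<le> a * noise_load (real j * \<tau>) \<omega>" .
      qed (use \<tau> in auto)
      also have "\<dots> = exp ((c + 1) * \<kappa> * \<tau>) * (norm (Y j \<omega>) powr \<Lambda> + \<tau> * (a * noise_load (real j * \<tau>) \<omega>))"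
      proof -
        have "exp (c * \<tau> * \<kappa>) * exp (\<tau> * \<kappa>) = exp ((c + 1) * \<kappa> * \<tau>)"
          by (simp add: algebra_simps flip: exp_add)
        moreover have "((norm (Y j \<omega>))\<^sup>2) powr \<kappa> = norm (Y j \<omega>) powr \<Lambda>" by (simp add: \<kappa>_def sqr_powr)
        ultimately show ?thesis by (simp only: mult.assoc[symmetric])
      qed
      finally show ?case by (simp add: \<kappa>_def sqr_powr)
    qed
    have "mean_le M (\<lambda>\<omega>. norm (Y n \<omega>) powr \<Lambda>) (exp ((c + 1) * \<kappa> * (real n * \<tau>)) * (\<mu> + real n * \<tau> * growth C2 t))"
    proof (rule mean_le_gronwall[where f="\<lambda>j \<omega>. norm (Y j \<omega>) powr \<Lambda>"])
      show "mean_le M (\<lambda>\<omega>. norm (Y 0 \<omega>) powr \<Lambda>) \<mu>"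
      proof (rule mean_le_AE_mono[OF mean_X0])
        show "(\<lambda>\<omega>. norm (Y 0 \<omega>) powr \<Lambda>) \<in> borel_measurable M" using Ym[of 0] by simp
        show "AE \<omega> in M. 0 \<le> norm (Y 0 \<omega>) powr \<Lambda> \<and> norm (Y 0 \<omega>) powr \<Lambda> \<le> norm (X0 \<omega>) powr \<Lambda>"
          using Z_step[OF \<tau>] by eventually_elim (simp add: Y_def w_def)
      qed
      fix j A assume j: "j < n" and A: "mean_le M (\<lambda>\<omega>. norm (Y j \<omega>) powr \<Lambda>) A"
      have jt: "0 \<le> real j * \<tau>" "real j * \<tau> \<le> t" using j \<tau> by (auto simp: t_def)
      have "mean_le M (\<lambda>\<omega>. a * noise_load (real j * \<tau>) \<omega>) (growth C2 (real j * \<tau>))"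
        unfolding C2_def using c0 C1 jt by (intro mean_growth_cmult) auto
      then have "mean_le M (\<lambda>\<omega>. a * noise_load (real j * \<tau>) \<omega>) (growth C2 t)"
        by (rule mean_growth_mono) (use pos jt in auto)
      then have "mean_le M (\<lambda>\<omega>. exp ((c + 1) * \<kappa> * \<tau>) * (norm (Y j \<omega>) powr \<Lambda> + \<tau> * (a * noise_load (real j * \<tau>) \<omega>)))
         (exp ((c + 1) * \<kappa> * \<tau>) * (A + \<tau> * growth C2 t))"
        using \<tau> A by (intro mean_le_cmult mean_le_add) auto
      then show "mean_le M (\<lambda>\<omega>. norm (Y (Suc j) \<omega>) powr \<Lambda>) (exp ((c + 1) * \<kappa> * \<tau>) * (A + \<tau> * growth C2 t))"
        by (rule mean_le_AE_mono) (use Ym[of "Suc j"] step[of j] in auto)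
    qed (use \<tau> \<kappa> c0 growth_nonneg pos in auto)
    then have "mean_le M (\<lambda>\<omega>. norm (Y n \<omega>) powr \<Lambda>) (growth D t)"
      by (rule mean_le_mono) (use growth_accumulated[of "(c + 1) * \<kappa>" C2 t] pos \<kappa> c0 t0 in \<open>simp add: D_def t_def\<close>)
    then have "mean_le M (\<lambda>\<omega>. 2 powr \<Lambda> * (norm (Y n \<omega>) powr \<Lambda> + noise_load t \<omega>)) (growth E t)"
      unfolding E_def using C1 pos t0 by (intro mean_growth_cmult mean_growth_add) auto
    then show "mean_le M (\<lambda>\<omega>. norm (Z \<tau> (real n * \<tau>) \<omega>) powr \<Lambda>) (growth E (real n * \<tau>))"
      unfolding t_def[symmetric]
    proof (rule mean_le_AE_mono)
      show "(\<lambda>\<omega>. norm (Z \<tau> t \<omega>) powr \<Lambda>) \<in> borel_measurable M" using Z_meas[OF \<tau> t0] by simp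
      show "AE \<omega> in M. 0 \<le> norm (Z \<tau> t \<omega>) powr \<Lambda> \<and> norm (Z \<tau> t \<omega>) powr \<Lambda> \<le> 2 powr \<Lambda> * (norm (Y n \<omega>) powr \<Lambda> + noise_load t \<omega>)"
      proof (rule AE_I2)
        fix \<omega>
        have "norm (Z \<tau> t \<omega>) powr \<Lambda> \<le> (norm (Y n \<omega>) + norm (w n \<omega>)) powr \<Lambda>"
          using \<Lambda>_bounds norm_triangle_ineq[of "Y n \<omega>" "w n \<omega>"] by (intro powr_mono2) (auto simp: Y_def t_def)
        also have "\<dots> \<le> 2 powr \<Lambda> * (norm (Y n \<omega>) powr \<Lambda> + norm (w n \<omega>) powr \<Lambda>)"
          using \<Lambda>_bounds by (intro powr_add_le) auto
        also have "\<dots> \<le> 2 powr \<Lambda> * (norm (Y n \<omega>) powr \<Lambda> + noise_load t \<omega>)"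
          using noise_load_ge(2)[of t \<omega>] by (intro mult_left_mono add_left_mono) (auto simp: w_def t_def)
        finally show "0 \<le> norm (Z \<tau> t \<omega>) powr \<Lambda> \<and> norm (Z \<tau> t \<omega>) powr \<Lambda> \<le> 2 powr \<Lambda> * (norm (Y n \<omega>) powr \<Lambda> + noise_load t \<omega>)"
          by simp
      qed
    qed
  qed (use pos in auto)
qed

text \<open>Between grid points the drift contributes at most \<open>\<tau> |b\<^sub>\<tau>| \<le> (\<tau> |b\<^sub>\<tau>|\<^sup>2)\<^bsup>1/2\<^esup>\<close>, which grows linearly.\<close>

lemma Z_moment:
  "\<exists>C>0. \<forall>\<tau>\<in>{0<..<1}. \<forall>t\<ge>0. mean_le M (\<lambda>\<omega>. norm (Z \<tau> t \<omega>) powr \<Lambda>) (growth C t)"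
proof -
  obtain C1 where C1: "C1 > 0" and
    Z_grid: "\<forall>\<tau>\<in>{0<..<1}. \<forall>n. mean_le M (\<lambda>\<omega>. norm (Z \<tau> (real n * \<tau>) \<omega>) powr \<Lambda>) (growth C1 (real n * \<tau>))"
    using Z_grid_moment by (elim exE conjE) (rule that)
  obtain c where c: "c > 0" "\<And>s t \<tau>. 0 \<le> s \<Longrightarrow> s \<le> t \<Longrightarrow> t - s \<le> \<tau> \<Longrightarrow> 0 < \<tau> \<Longrightarrow>
     mean_le M (\<lambda>\<omega>. (norm (W t \<omega> - W s \<omega>) / sqrt \<tau>) powr \<Lambda>) c"
    using increment_moment[OF \<Lambda>_nonneg] by blast
  define a1 a2 a3 where "a1 = sqrt K3 powr \<Lambda>" and "a2 = (1 + sqrt K4) powr \<Lambda>" and "a3 = B_opnorm powr \<Lambda>"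
  have a0: "0 \<le> a1" "0 \<le> a2" "0 \<le> a3" by (auto simp: a1_def a2_def a3_def)
  define D where "D = a1 + (a2 * C1 + C1) + (a3 * c + c)"
  define E where "E = 4 powr \<Lambda> * D + D"
  have pos: "0 < D" "0 < E" proof -
    show "0 < D" unfolding D_def using a0 C1 c by (intro add_nonneg_pos add_nonneg_nonneg mult_nonneg_nonneg) auto
    then show "0 < E" unfolding E_def by (intro add_nonneg_pos add_nonneg_nonneg mult_nonneg_nonneg) auto
  qed
  show ?thesis
  proof (intro exI[of _ E] conjI allI ballI impI)
    fix \<tau> t :: real assume \<tau>: "\<tau> \<in> {0<..<1}" and t: "0 \<le> t"
    \<comment> \<open>the cell of the grid that contains \<open>t\<close>\<close>
    define j where "j = nat \<lfloor>t / \<tau>\<rfloor>"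
    define s where "s = real j * \<tau>"
    have "0 \<le> \<lfloor>t / \<tau>\<rfloor>" using t \<tau> by simp
    then have "real j \<le> t / \<tau>" "t / \<tau> \<le> real (Suc j)" unfolding j_def by linarith+
    then have s: "0 \<le> s" "s \<le> t" "t \<le> real (Suc j) * \<tau>" "t - s \<le> \<tau>"
      using \<tau> by (auto simp: s_def field_simps)
    have m1: "mean_le M (\<lambda>\<omega>. norm (Z \<tau> s \<omega>) powr \<Lambda>) (growth C1 t)"
      using Z_grid[rule_format, OF \<tau>, of j] unfolding s_def[symmetric] by (rule mean_growth_mono) (use C1 s in auto)
    have m2: "mean_le M (\<lambda>\<omega>. (norm (W t \<omega> - W s \<omega>) / sqrt \<tau>) powr \<Lambda>) (growth c t)"
      by (rule mean_le_mono[OF c(2) growth_const]) (use s \<tau> c(1) t in auto)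
    have "mean_le M (\<lambda>\<omega>. 4 powr \<Lambda> * (a1 + a2 * norm (Z \<tau> s \<omega>) powr \<Lambda> + a3 * (norm (W t \<omega> - W s \<omega>) / sqrt \<tau>) powr \<Lambda>)) (growth E t)"
      unfolding E_def D_def using m1 m2 a0 C1 c t
      by (intro mean_growth_cmult mean_growth_add mean_growth_const add_nonneg_nonneg mult_nonneg_nonneg) auto
    then show "mean_le M (\<lambda>\<omega>. norm (Z \<tau> t \<omega>) powr \<Lambda>) (growth E t)"
    proof (rule mean_le_AE_mono)
      show "(\<lambda>\<omega>. norm (Z \<tau> t \<omega>) powr \<Lambda>) \<in> borel_measurable M" using Z_meas[OF \<tau> t] by simp
      show "AE \<omega> in M. 0 \<le> norm (Z \<tau> t \<omega>) powr \<Lambda> \<and> norm (Z \<tau> t \<omega>) powr \<Lambda>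
        \<le> 4 powr \<Lambda> * (a1 + a2 * norm (Z \<tau> s \<omega>) powr \<Lambda> + a3 * (norm (W t \<omega> - W s \<omega>) / sqrt \<tau>) powr \<Lambda>)"
        using Z_step[OF \<tau>]
      proof eventually_elim
        case (elim \<omega>)
        define x where "x = Z \<tau> s \<omega>"
        define g where "g = norm (W t \<omega> - W s \<omega>) / sqrt \<tau>"
        have g0: "0 \<le> g" using \<tau> by (simp add: g_def)
        have "Z \<tau> t \<omega> = x + ((t - s) *\<^sub>R tamed_drift q b \<tau> x + B *v (W t \<omega> - W s \<omega>))"
          using elim s unfolding x_def s_def by auto
        then have "norm (Z \<tau> t \<omega>) \<le> norm x + (norm ((t - s) *\<^sub>R tamed_drift q b \<tau> x) + norm (B *v (W t \<omega> - W s \<omega>)))"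
          by (simp add: norm_triangle_le norm_triangle_mono)
        also have "norm ((t - s) *\<^sub>R tamed_drift q b \<tau> x) \<le> sqrt K3 + sqrt K4 * norm x"
        proof -
          have "norm ((t - s) *\<^sub>R tamed_drift q b \<tau> x) \<le> \<tau> * norm (tamed_drift q b \<tau> x)"
            using s by (simp add: mult_right_mono)
          also have "\<dots> \<le> sqrt \<tau> * norm (tamed_drift q b \<tau> x)"
            using \<tau> real_le_rsqrt[of \<tau> \<tau>] by (intro mult_right_mono) (auto simp: power2_eq_square mult_left_le_one_le)
          also have "\<dots> = sqrt (\<tau> * (norm (tamed_drift q b \<tau> x))\<^sup>2)" using \<tau> by (simp add: real_sqrt_mult)
          also have "\<dots> \<le> sqrt (K3 + K4 * (norm x)\<^sup>2)" using tamed_growth[OF \<tau>] by (intro real_sqrt_le_mono)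
          also have "\<dots> \<le> sqrt K3 + sqrt (K4 * (norm x)\<^sup>2)" using const_pos by (intro sqrt_add_le_add_sqrt) auto
          finally show ?thesis by (simp add: real_sqrt_mult)
        qed
        also have "norm (B *v (W t \<omega> - W s \<omega>)) \<le> B_opnorm * g"
        proof -
          have "norm (B *v (W t \<omega> - W s \<omega>)) \<le> B_opnorm * norm (W t \<omega> - W s \<omega>)" by (rule norm_B_le)
          also have "norm (W t \<omega> - W s \<omega>) = sqrt \<tau> * g" using \<tau> by (simp add: g_def)
          also have "B_opnorm * (sqrt \<tau> * g) \<le> B_opnorm * (1 * g)" using B_opnorm_nonneg \<tau> g0 by (intro mult_left_mono mult_right_mono) auto
          finally show ?thesis by simp
        qed
        finally have "norm (Z \<tau> t \<omega>) \<le> sqrt K3 + (1 + sqrt K4) * norm x + B_opnorm * g" by (simp add: algebra_simps)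
        then have "norm (Z \<tau> t \<omega>) powr \<Lambda> \<le> (sqrt K3 + (1 + sqrt K4) * norm x + B_opnorm * g) powr \<Lambda>"
          using \<Lambda>_bounds by (intro powr_mono2) auto
        also have "\<dots> \<le> 4 powr \<Lambda> * (sqrt K3 powr \<Lambda> + ((1 + sqrt K4) * norm x) powr \<Lambda> + (B_opnorm * g) powr \<Lambda>)"
          using \<Lambda>_bounds const_pos B_opnorm_nonneg g0 by (intro powr_add3_le) auto
        finally show ?case unfolding powr_mult a1_def a2_def a3_def x_def g_def by (rule conjI[OF powr_ge_zero])
      qed
    qed
  qed (use pos in auto)
qed

end

section \<open>The martingale part of the local error\<close>

context tamed_scheme
begin

definition increment_integral :: "real \<Rightarrow> nat \<Rightarrow> real \<Rightarrow> 'a \<Rightarrow> real ^ 'm" where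
  "increment_integral \<tau> j s \<omega> = integral {real j * \<tau>..s} (\<lambda>u. W u \<omega> - W (real j * \<tau>) \<omega>)"

text \<open>The mean over the cell of the normalised increments. It dominates \<open>increment_integral\<close> throughout the cell
(\<open>increment_integral_bound\<close>), and its moments are bounded uniformly in \<open>\<tau>\<close> and \<open>j\<close>.\<close>

definition mean_increment :: "real \<Rightarrow> nat \<Rightarrow> 'a \<Rightarrow> real" where
  "mean_increment \<tau> j \<omega> = integral {real j * \<tau>..real (Suc j) * \<tau>} (\<lambda>u. norm (W u \<omega> - W (real j * \<tau>) \<omega>) / sqrt \<tau>) / \<tau>"

text \<open>A bound for the contribution of the cell to \<open>\<tau> * correction\<close>, in units of \<open>\<tau> * sqrt \<tau>\<close>
(\<open>correction_bound\<close>).\<close>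

definition correction_size :: "real \<Rightarrow> nat \<Rightarrow> 'a \<Rightarrow> real" where
  "correction_size \<tau> j \<omega> = L9 * 2 powr q * B_opnorm * ((1 + norm (Z \<tau> (real j * \<tau>) \<omega>)) powr q * mean_increment \<tau> j \<omega>)"

text \<open>The accumulated first-order effect of the noise inside the cells on the drift. The factor \<open>1 / \<tau>\<close> makes its
moments bounded uniformly in \<open>\<tau>\<close>, so that the part of the error which it describes is \<open>\<tau> * correction\<close>.\<close>

definition correction :: "real \<Rightarrow> nat \<Rightarrow> 'a \<Rightarrow> real ^ 'd" where
  "correction \<tau> n \<omega> = (\<Sum>j<n. (1 / \<tau>) *\<^sub>R total_deriv b (Z \<tau> (real j * \<tau>) \<omega>) (B *v increment_integral \<tau> j (real (Suc j) * \<tau>) \<omega>))"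

lemma grid_step:
  assumes "0 < \<tau>"
  shows "0 \<le> real j * \<tau>" "real j * \<tau> < real (Suc j) * \<tau>" "real (Suc j) * \<tau> - real j * \<tau> = \<tau>"
  using assms by (auto simp: algebra_simps)

lemma increment_continuous: "AE \<omega> in M. \<forall>a\<ge>0. \<forall>c. continuous_on {a..c} (\<lambda>u. W u \<omega> - W a \<omega>)"
  using W_continuous
proof eventually_elim
  case (elim \<omega>)
  show ?case
    by (intro allI impI continuous_on_diff continuous_on_const continuous_on_subset[OF elim]) auto
qed

lemma increment_integral_bound:
  assumes \<tau>: "0 < \<tau>"
  shows "AE \<omega> in M. \<forall>j. 0 \<le> mean_increment \<tau> j \<omega> \<and> (\<forall>s\<in>{real j * \<tau>..real (Suc j) * \<tau>}. norm (increment_integral \<tau> j s \<omega>) \<le> \<tau> * sqrt \<tau> * mean_increment \<tau> j \<omega>)"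
  using increment_continuous
proof eventually_elim
  case (elim \<omega>)
  show ?case
  proof (intro allI conjI ballI)
    fix j
    let ?a = "real j * \<tau>" and ?b = "real (Suc j) * \<tau>"
    let ?D = "\<lambda>u. W u \<omega> - W ?a \<omega>"
    have c: "continuous_on {?a..c} ?D" for c using elim grid_step(1)[OF \<tau>] by blast
    have i: "?D integrable_on {?a..c}" "(\<lambda>u. norm (?D u)) integrable_on {?a..c}" for c
      by (intro integrable_continuous_real c continuous_on_norm)+
    have \<gamma>: "\<tau> * sqrt \<tau> * mean_increment \<tau> j \<omega> = integral {?a..?b} (\<lambda>u. norm (?D u))"
      using \<tau> by (simp add: mean_increment_def)
    have "0 \<le> integral {?a..?b} (\<lambda>u. norm (?D u))" by (rule integral_nonneg[OF i(2)]) simp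
    then have nn: "0 \<le> \<tau> * sqrt \<tau> * mean_increment \<tau> j \<omega>" unfolding \<gamma> .
    have "0 < \<tau> * sqrt \<tau>" using \<tau> by simp
    then show "0 \<le> mean_increment \<tau> j \<omega>" using nn by (metis mult_less_cancel_left_pos mult_zero_right not_less)
    fix s assume s: "s \<in> {?a..?b}"
    have "norm (increment_integral \<tau> j s \<omega>) \<le> integral {?a..s} (\<lambda>u. norm (?D u))"
      unfolding increment_integral_def by (rule integral_norm_bound_integral[OF i]) simp
    also have "\<dots> \<le> integral {?a..?b} (\<lambda>u. norm (?D u))"
      by (rule integral_subset_le[OF _ i(2) i(2)]) (use s in auto)
    finally show "norm (increment_integral \<tau> j s \<omega>) \<le> \<tau> * sqrt \<tau> * mean_increment \<tau> j \<omega>" by (simp add: \<gamma>)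
  qed
qed

lemma mean_increment_measurable: "0 < \<tau> \<Longrightarrow> mean_increment \<tau> j \<in> borel_measurable M"
proof -
  assume \<tau>: "0 < \<tau>"
  have "(\<lambda>\<omega>. integral {real j * \<tau>..real (Suc j) * \<tau>} (\<lambda>u. norm (W u \<omega> - W (real j * \<tau>) \<omega>) / sqrt \<tau>)) \<in> borel_measurable M"
  proof (rule measurable_process_integral[OF complete_M])
    show "AE \<omega> in M. continuous_on {real j * \<tau>..real (Suc j) * \<tau>} (\<lambda>u. norm (W u \<omega> - W (real j * \<tau>) \<omega>) / sqrt \<tau>)"
      using increment_continuous
    proof eventually_elim
      case (elim \<omega>)
      then have "continuous_on {real j * \<tau>..real (Suc j) * \<tau>} (\<lambda>u. W u \<omega> - W (real j * \<tau>) \<omega>)"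
        using grid_step(1)[OF \<tau>] by blast
      then show ?case using \<tau> by (intro continuous_on_divide continuous_on_norm continuous_on_const) auto
    qed
    fix s assume s: "s \<in> {real j * \<tau>..real (Suc j) * \<tau>}"
    have "(\<lambda>\<omega>. W s \<omega> - W (real j * \<tau>) \<omega>) \<in> borel_measurable M"
      by (rule W_diff_measurable[OF grid_step(1)[OF \<tau>]]) (use s grid_step(1)[OF \<tau>, of j] in auto)
    then show "(\<lambda>\<omega>. norm (W s \<omega> - W (real j * \<tau>) \<omega>) / sqrt \<tau>) \<in> borel_measurable M" by simp
  qed (use grid_step(2)[OF \<tau>, of j] in \<open>auto simp: subalgebra_def\<close>)
  from borel_measurable_divide[OF this borel_measurable_const] show ?thesis unfolding mean_increment_def[abs_def] .
qed

lemma mean_increment_moment: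
  assumes K: "1 \<le> K"
  shows "\<exists>c>0. \<forall>\<tau>\<in>{0<..<1}. \<forall>j. mean_le M (\<lambda>\<omega>. mean_increment \<tau> j \<omega> powr K) c"
proof -
  have K0: "0 \<le> K" using K by simp
  obtain c where c: "c > 0" "\<And>s t \<tau>. 0 \<le> s \<Longrightarrow> s \<le> t \<Longrightarrow> t - s \<le> \<tau> \<Longrightarrow> 0 < \<tau> \<Longrightarrow>
     mean_le M (\<lambda>\<omega>. (norm (W t \<omega> - W s \<omega>) / sqrt \<tau>) powr K) c"
    using increment_moment[OF K0] by blast
  show ?thesis
  proof (intro exI[of _ c] conjI ballI allI)
    fix \<tau> :: real and j assume \<tau>': "\<tau> \<in> {0<..<1}"
    then have \<tau>: "0 < \<tau>" by simp
    note g = grid_step[OF \<tau>, of j]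
    let ?a = "real j * \<tau>" and ?b = "real (Suc j) * \<tau>"
    let ?g = "\<lambda>u \<omega>. norm (W u \<omega> - W ?a \<omega>) / sqrt \<tau>"
    have cont: "AE \<omega> in M. continuous_on {?a..?b} (\<lambda>u. ?g u \<omega>)"
      using increment_continuous
    proof eventually_elim
      case (elim \<omega>)
      then have "continuous_on {?a..?b} (\<lambda>u. W u \<omega> - W ?a \<omega>)" using g(1) by blast
      then show ?case using \<tau> by (intro continuous_on_divide continuous_on_norm continuous_on_const) auto
    qed
    have "mean_le M (\<lambda>\<omega>. integral {?a..?b} (\<lambda>u. ?g u \<omega> powr K)) (c * (?b - ?a))"
    proof (rule mean_le_process_integral[OF prob_space_M complete_M])
      show "AE \<omega> in M. continuous_on {?a..?b} (\<lambda>u. ?g u \<omega> powr K)"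
        using cont by eventually_elim (use \<tau> K in \<open>auto intro!: continuous_on_powr' continuous_on_const\<close>)
      show "mean_le M (\<lambda>\<omega>. ?g u \<omega> powr K) c" if "u \<in> {?a..?b}" for u
        by (rule c(2)) (use that g \<tau> in auto)
      then show "mean_le M (\<lambda>\<omega>. \<bar>?g u \<omega> powr K\<bar>) c" if "u \<in> {?a..?b}" for u
        using that by simp
    qed (use g in auto)
    then have "mean_le M (\<lambda>\<omega>. (1 / \<tau>) * integral {?a..?b} (\<lambda>u. ?g u \<omega> powr K)) ((1 / \<tau>) * (c * (?b - ?a)))"
      by (rule mean_le_cmult) (use \<tau> in auto)
    then have m: "mean_le M (\<lambda>\<omega>. (1 / \<tau>) * integral {?a..?b} (\<lambda>u. ?g u \<omega> powr K)) c"
      unfolding g(3) using \<tau> by simp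
    show "mean_le M (\<lambda>\<omega>. mean_increment \<tau> j \<omega> powr K) c"
    proof (rule mean_le_AE_mono[OF m])
      show "(\<lambda>\<omega>. mean_increment \<tau> j \<omega> powr K) \<in> borel_measurable M" using mean_increment_measurable[OF \<tau>, of j] by simp
      show "AE \<omega> in M. 0 \<le> mean_increment \<tau> j \<omega> powr K \<and> mean_increment \<tau> j \<omega> powr K \<le> (1 / \<tau>) * integral {?a..?b} (\<lambda>u. ?g u \<omega> powr K)"
        using cont
      proof eventually_elim
        case (elim \<omega>)
        have "(integral {?a..?b} (\<lambda>u. ?g u \<omega>) / (?b - ?a)) powr K \<le> integral {?a..?b} (\<lambda>u. ?g u \<omega> powr K) / (?b - ?a)"
          by (rule powr_integral_le[OF g(2) K elim]) (use \<tau> in auto)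
        then show ?case unfolding g(3) mean_increment_def by simp
      qed
    qed
  qed (rule c(1))
qed

lemma one_plus_Z_moment:
  assumes K: "0 \<le> K" "K \<le> \<Lambda>"
  shows "\<exists>C>0. \<forall>\<tau>\<in>{0<..<1}. \<forall>t\<ge>0. mean_le M (\<lambda>\<omega>. (1 + norm (Z \<tau> t \<omega>)) powr K) (growth C t)"
proof -
  obtain C where C: "C > 0" and Z: "\<forall>\<tau>\<in>{0<..<1}. \<forall>t\<ge>0. mean_le M (\<lambda>\<omega>. norm (Z \<tau> t \<omega>) powr \<Lambda>) (growth C t)"
    using Z_moment by (elim exE conjE) (rule that)
  define D where "D = 2 powr \<Lambda> * (1 + C) + (1 + C)"
  show ?thesis
  proof (intro exI[of _ D] conjI ballI allI impI)
    show "0 < D" unfolding D_def using C by (intro add_nonneg_pos mult_nonneg_nonneg) auto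
    fix \<tau> t :: real assume \<tau>: "\<tau> \<in> {0<..<1}" and t: "0 \<le> t"
    have "mean_le M (\<lambda>\<omega>. 2 powr \<Lambda> * (1 + norm (Z \<tau> t \<omega>) powr \<Lambda>)) (growth D t)"
      unfolding D_def using C t Z[rule_format, OF \<tau> t]
      by (intro mean_growth_cmult mean_growth_add mean_growth_const) auto
    then show "mean_le M (\<lambda>\<omega>. (1 + norm (Z \<tau> t \<omega>)) powr K) (growth D t)"
    proof (rule mean_le_AE_mono[OF _ _ AE_I2])
      show "(\<lambda>\<omega>. (1 + norm (Z \<tau> t \<omega>)) powr K) \<in> borel_measurable M" using Z_meas[OF \<tau> t] by simp
      fix \<omega>
      have "(1 + norm (Z \<tau> t \<omega>)) powr K \<le> (1 + norm (Z \<tau> t \<omega>)) powr \<Lambda>" using K by (intro powr_mono) auto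
      also have "\<dots> \<le> 2 powr \<Lambda> * (1 powr \<Lambda> + norm (Z \<tau> t \<omega>) powr \<Lambda>)"
        using \<Lambda>_bounds by (intro powr_add_le) auto
      finally show "0 \<le> (1 + norm (Z \<tau> t \<omega>)) powr K \<and> (1 + norm (Z \<tau> t \<omega>)) powr K \<le> 2 powr \<Lambda> * (1 + norm (Z \<tau> t \<omega>) powr \<Lambda>)"
        by simp
    qed
  qed
qed

lemma correction_size_measurable: "\<tau> \<in> {0<..<1} \<Longrightarrow> correction_size \<tau> j \<in> borel_measurable M"
  using mean_increment_measurable[of \<tau> j] Z_meas[of \<tau> "real j * \<tau>"] unfolding correction_size_def[abs_def] by simp

text \<open>The state of the scheme has moments up to the order \<open>\<Lambda>\<close> only, but \<open>mean_increment\<close> has all moments, so that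
Young's inequality can put the larger exponent on it.\<close>

lemma correction_size_moment: "\<exists>C>0. \<forall>\<tau>\<in>{0<..<1}. \<forall>j. mean_le M (\<lambda>\<omega>. correction_size \<tau> j \<omega> powr (4 * p)) (growth C (real j * \<tau>))"
proof -
  \<comment> \<open>the exponent that \<open>product_powr_le_sum_powr\<close> yields for \<open>\<alpha> = q * (4 * p)\<close>, \<open>\<beta> = 4 * p\<close> and \<open>\<gamma> = 2 * p\<close>\<close>
  define K where "K = 4 * p * (q * (4 * p) + 2 * p) / (2 * p)"
  have "K = 8 * (p * q) + 4 * p" using p by (simp add: K_def field_simps)
  moreover have "0 \<le> p * q" using p q by simp
  ultimately have K: "1 \<le> K" using p by linarith
  obtain c where c: "c > 0" and \<gamma>: "\<forall>\<tau>\<in>{0<..<1}. \<forall>j. mean_le M (\<lambda>\<omega>. mean_increment \<tau> j \<omega> powr K) c"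
    using mean_increment_moment[OF K] by (elim exE conjE) (rule that)
  have pq: "0 \<le> q * (4 * p) + 2 * p" "q * (4 * p) + 2 * p \<le> \<Lambda>" using \<Lambda>_bounds p q by (auto simp: mult_ac)
  obtain C where C: "C > 0" and Z: "\<forall>\<tau>\<in>{0<..<1}. \<forall>t\<ge>0. mean_le M (\<lambda>\<omega>. (1 + norm (Z \<tau> t \<omega>)) powr (q * (4 * p) + 2 * p)) (growth C t)"
    using one_plus_Z_moment[OF pq] by (elim exE conjE) (rule that)
  define a where "a = (L9 * 2 powr q * B_opnorm) powr (4 * p)"
  define D where "D = a * (C + c) + (C + c)"
  show ?thesis
  proof (intro exI[of _ D] conjI ballI allI)
    show "0 < D" unfolding D_def using C c by (intro add_nonneg_pos mult_nonneg_nonneg) (auto simp: a_def)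
    fix \<tau> :: real and j assume \<tau>: "\<tau> \<in> {0<..<1}"
    define t where "t = real j * \<tau>"
    have t: "0 \<le> t" using \<tau> by (simp add: t_def)
    have "mean_le M (\<lambda>\<omega>. mean_increment \<tau> j \<omega> powr K) (growth c t)"
      by (rule mean_le_mono[OF \<gamma>[rule_format, OF \<tau>] growth_const]) (use c t in auto)
    then have "mean_le M (\<lambda>\<omega>. a * ((1 + norm (Z \<tau> t \<omega>)) powr (q * (4 * p) + 2 * p) + mean_increment \<tau> j \<omega> powr K)) (growth D t)"
      unfolding D_def using C c t Z[rule_format, OF \<tau> t]
      by (intro mean_growth_cmult mean_growth_add) (auto simp: a_def)
    then show "mean_le M (\<lambda>\<omega>. correction_size \<tau> j \<omega> powr (4 * p)) (growth D (real j * \<tau>))"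
      unfolding t_def[symmetric]
    proof (rule mean_le_AE_mono)
      show "(\<lambda>\<omega>. correction_size \<tau> j \<omega> powr (4 * p)) \<in> borel_measurable M" using correction_size_measurable[OF \<tau>, of j] by simp
      have \<tau>0: "0 < \<tau>" using \<tau> by simp
      show "AE \<omega> in M. 0 \<le> correction_size \<tau> j \<omega> powr (4 * p) \<and> correction_size \<tau> j \<omega> powr (4 * p)
          \<le> a * ((1 + norm (Z \<tau> t \<omega>)) powr (q * (4 * p) + 2 * p) + mean_increment \<tau> j \<omega> powr K)"
        using increment_integral_bound[OF \<tau>0]
      proof eventually_elim
        case (elim \<omega>)
        let ?y = "1 + norm (Z \<tau> t \<omega>)"
        have "correction_size \<tau> j \<omega> powr (4 * p) = a * (?y powr (q * (4 * p)) * mean_increment \<tau> j \<omega> powr (4 * p))"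
          by (simp only: correction_size_def t_def[symmetric] powr_mult powr_powr a_def)
        also have "?y powr (q * (4 * p)) * mean_increment \<tau> j \<omega> powr (4 * p) \<le> ?y powr (q * (4 * p) + 2 * p) + mean_increment \<tau> j \<omega> powr K"
          unfolding K_def using elim p q by (intro product_powr_le_sum_powr) auto
        finally show ?case by (simp add: a_def mult_left_mono)
      qed
    qed
  qed
qed

lemma increment_integral_measurable:
  assumes \<tau>: "0 < \<tau>"
  shows "increment_integral \<tau> j (real (Suc j) * \<tau>) \<in> borel_measurable (F (real (Suc j) * \<tau>))"
  unfolding increment_integral_def[abs_def]
proof (rule measurable_process_integral[OF complete_M])
  note g = grid_step[OF \<tau>, of j]
  have b0: "0 \<le> real (Suc j) * \<tau>" using g by linarith
  show "subalgebra M (F (real (Suc j) * \<tau>))" "null_sets M \<subseteq> sets (F (real (Suc j) * \<tau>))"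
    by (rule sub[OF b0], rule null_sets_F[OF b0])
  show "real j * \<tau> \<le> real (Suc j) * \<tau>" using g by linarith
  fix s assume "s \<in> {real j * \<tau>..real (Suc j) * \<tau>}"
  then have s: "0 \<le> s" "s \<le> real (Suc j) * \<tau>" using g(1) by auto
  show "(\<lambda>\<omega>. W s \<omega> - W (real j * \<tau>) \<omega>) \<in> borel_measurable (F (real (Suc j) * \<tau>))"
    using F_measurable_mono[OF W_measurable[OF s(1)] s] F_measurable_mono[OF W_measurable[OF g(1)] g(1), of "real (Suc j) * \<tau>"] g(2)
    by (intro borel_measurable_diff) auto
next
  show "AE \<omega> in M. continuous_on {real j * \<tau>..real (Suc j) * \<tau>} (\<lambda>u. W u \<omega> - W (real j * \<tau>) \<omega>)"
    using increment_continuous by eventually_elim (use grid_step(1)[OF \<tau>] in blast)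
qed

lemma measurable_total_deriv:
  assumes "f \<in> borel_measurable A" "g \<in> borel_measurable A"
  shows "(\<lambda>\<omega>. total_deriv b (f \<omega>) (g \<omega>)) \<in> borel_measurable A"
proof -
  have "continuous_on UNIV (\<lambda>x :: (real ^ 'd) \<times> (real ^ 'd). total_deriv b (fst x) (snd x))"
    by (intro bounded_bilinear.continuous_on[OF bounded_bilinear_blinfun_apply]
        continuous_on_compose2[OF continuous_on_total_deriv[of UNIV]] continuous_on_fst continuous_on_snd continuous_on_id) auto
  then show ?thesis by (rule borel_measurable_continuous_Pair[OF assms])
qed

lemma correction_measurable:
  assumes \<tau>: "\<tau> \<in> {0<..<1}"
  shows "correction \<tau> n \<in> borel_measurable (F (real n * \<tau>))"
  unfolding correction_def[abs_def]
proof (intro borel_measurable_sum borel_measurable_scaleR borel_measurable_const)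
  fix j assume "j \<in> {..<n}"
  then have jn: "real (Suc j) * \<tau> \<le> real n * \<tau>" using \<tau> by (intro mult_right_mono) auto
  have \<tau>0: "0 < \<tau>" using \<tau> by simp
  note g = grid_step[OF \<tau>0, of j]
  have "(\<lambda>\<omega>. total_deriv b (Z \<tau> (real j * \<tau>) \<omega>) (B *v increment_integral \<tau> j (real (Suc j) * \<tau>) \<omega>)) \<in> borel_measurable (F (real (Suc j) * \<tau>))"
    using g by (intro measurable_total_deriv measurable_B increment_integral_measurable[OF \<tau>0] F_measurable_mono[OF Z_measurable[OF \<tau> g(1)] g(1)]) auto
  then show "(\<lambda>\<omega>. total_deriv b (Z \<tau> (real j * \<tau>) \<omega>) (B *v increment_integral \<tau> j (real (Suc j) * \<tau>) \<omega>)) \<in> borel_measurable (F (real n * \<tau>))"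
    by (rule F_measurable_mono) (use g jn in linarith)+
qed

lemma correction_measurable_M: "\<tau> \<in> {0<..<1} \<Longrightarrow> correction \<tau> n \<in> borel_measurable M"
  by (rule F_measurable_M[OF correction_measurable]) auto

lemma correction_bound:
  assumes \<tau>: "\<tau> \<in> {0<..<1}"
  shows "AE \<omega> in M. \<forall>j. 0 \<le> correction_size \<tau> j \<omega> \<and> (\<forall>s\<in>{real j * \<tau>..real (Suc j) * \<tau>}.
    norm (total_deriv b (Z \<tau> (real j * \<tau>) \<omega>) (B *v increment_integral \<tau> j s \<omega>)) \<le> \<tau> * sqrt \<tau> * correction_size \<tau> j \<omega>)"
proof -
  have \<tau>0: "0 < \<tau>" using \<tau> by simp
  show ?thesis using increment_integral_bound[OF \<tau>0]
  proof eventually_elim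
    case (elim \<omega>)
    show ?case
    proof (intro allI conjI ballI)
      fix j
      let ?z = "Z \<tau> (real j * \<tau>) \<omega>"
      show "0 \<le> correction_size \<tau> j \<omega>" using elim const_pos B_opnorm_nonneg by (auto simp: correction_size_def)
      fix s assume s: "s \<in> {real j * \<tau>..real (Suc j) * \<tau>}"
      have "norm (total_deriv b ?z (B *v increment_integral \<tau> j s \<omega>)) \<le> norm (total_deriv b ?z) * norm (B *v increment_integral \<tau> j s \<omega>)"
        by (rule norm_blinfun)
      also have "\<dots> \<le> (L9 * 2 powr q * (1 + norm ?z) powr q) * (B_opnorm * norm (increment_integral \<tau> j s \<omega>))"
        using const_pos B_opnorm_nonneg by (intro mult_mono total_deriv_growth norm_B_le) auto
      also have "\<dots> \<le> (L9 * 2 powr q * (1 + norm ?z) powr q) * (B_opnorm * (\<tau> * sqrt \<tau> * mean_increment \<tau> j \<omega>))"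
        using elim s const_pos B_opnorm_nonneg by (intro mult_left_mono) auto
      finally show "norm (total_deriv b ?z (B *v increment_integral \<tau> j s \<omega>)) \<le> \<tau> * sqrt \<tau> * correction_size \<tau> j \<omega>"
        by (simp add: correction_size_def mult_ac)
    qed
  qed
qed

text \<open>A factor known at the beginning of the cell is orthogonal to the increment at each time of the cell, hence
by Fubini's theorem to the time integral of the increments.\<close>

lemma orthogonal_increment:
  assumes \<tau>: "\<tau> \<in> {0<..<1}" and H: "H \<in> borel_measurable (F (real j * \<tau>))" "integrable M H"
  shows "mean_le M (\<lambda>\<omega>. H \<omega> * increment_integral \<tau> j (real (Suc j) * \<tau>) \<omega> $ i) 0"
proof -
  have \<tau>0: "0 < \<tau>" using \<tau> by simp
  note g = grid_step[OF \<tau>0, of j]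
  let ?a = "real j * \<tau>" and ?b = "real (Suc j) * \<tau>"
  obtain c where c: "c > 0" "\<And>s t \<tau>. 0 \<le> s \<Longrightarrow> s \<le> t \<Longrightarrow> t - s \<le> \<tau> \<Longrightarrow> 0 < \<tau> \<Longrightarrow>
     mean_le M (\<lambda>\<omega>. (norm (W t \<omega> - W s \<omega>) / sqrt \<tau>) powr 1) c"
    using increment_moment[of 1] by auto
  define L where "L = (\<integral>\<omega>. \<bar>H \<omega>\<bar> \<partial>M) * (sqrt \<tau> * c)"
  have EH: "0 \<le> (\<integral>\<omega>. \<bar>H \<omega>\<bar> \<partial>M)" by (intro integral_nonneg_AE) auto
  have "mean_le M (\<lambda>\<omega>. integral {?a..?b} (\<lambda>u. H \<omega> * (W u \<omega> - W ?a \<omega>) $ i)) (0 * (?b - ?a))"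
  proof (rule mean_le_process_integral[OF prob_space_M complete_M])
    show "AE \<omega> in M. continuous_on {?a..?b} (\<lambda>u. H \<omega> * (W u \<omega> - W ?a \<omega>) $ i)"
      using increment_continuous
    proof eventually_elim
      case (elim \<omega>)
      then have "continuous_on {?a..?b} (\<lambda>u. W u \<omega> - W ?a \<omega>)" using g(1) by blast
      then show ?case by (intro continuous_on_mult continuous_on_const continuous_on_component)
    qed
    fix u assume u: "u \<in> {?a..?b}"
    show "mean_le M (\<lambda>\<omega>. H \<omega> * (W u \<omega> - W ?a \<omega>) $ i) 0"
    proof (cases "u = ?a")
      case False
      then have "?a < u" using u by simp
      with increment_component_product[OF g(1) this H] show ?thesis by (simp add: mean_le_def)
    qed (simp add: mean_le_def)
    show "mean_le M (\<lambda>\<omega>. \<bar>H \<omega> * (W u \<omega> - W ?a \<omega>) $ i\<bar>) L"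
    proof (cases "u = ?a")
      case True
      then show ?thesis using EH \<tau> c by (simp add: mean_le_def L_def)
    next
      case False
      then have au: "?a < u" using u by simp
      have "mean_le M (\<lambda>\<omega>. (norm (W u \<omega> - W ?a \<omega>) / sqrt \<tau>) powr 1) c"
        by (rule c(2)) (use g u \<tau> in auto)
      from mean_le_cmult[OF this, of "sqrt \<tau>"] have "mean_le M (\<lambda>\<omega>. norm (W u \<omega> - W ?a \<omega>)) (sqrt \<tau> * c)"
        using \<tau> by simp
      then have "mean_le M (\<lambda>\<omega>. \<bar>(W u \<omega> - W ?a \<omega>) $ i\<bar>) (sqrt \<tau> * c)"
      proof (rule mean_le_AE_mono)
        have "(\<lambda>\<omega>. W u \<omega> - W ?a \<omega>) \<in> borel_measurable M" by (rule W_diff_measurable[OF g(1)]) (use au g in linarith)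
        then show "(\<lambda>\<omega>. \<bar>(W u \<omega> - W ?a \<omega>) $ i\<bar>) \<in> borel_measurable M"
          by (rule measurable_compose[where g="\<lambda>x. \<bar>x $ i\<bar>"])
             (intro borel_measurable_continuous_onI continuous_intros)
        show "AE \<omega> in M. 0 \<le> \<bar>(W u \<omega> - W ?a \<omega>) $ i\<bar> \<and> \<bar>(W u \<omega> - W ?a \<omega>) $ i\<bar> \<le> norm (W u \<omega> - W ?a \<omega>)"
          by (intro AE_I2 conjI abs_ge_zero component_le_norm_cart)
      qed
      then have "(\<integral>\<omega>. \<bar>H \<omega>\<bar> \<partial>M) * (\<integral>\<omega>. \<bar>(W u \<omega> - W ?a \<omega>) $ i\<bar> \<partial>M) \<le> L"
        unfolding L_def using EH by (intro mult_left_mono) (auto simp: mean_le_def)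
      then show ?thesis using increment_component_product[OF g(1) au H, of i]
        by (simp add: mean_le_def)
    qed
  qed (use g in auto)
  then have m: "mean_le M (\<lambda>\<omega>. integral {?a..?b} (\<lambda>u. H \<omega> * (W u \<omega> - W ?a \<omega>) $ i)) 0" by simp
  have ae: "AE \<omega> in M. H \<omega> * increment_integral \<tau> j ?b \<omega> $ i = integral {?a..?b} (\<lambda>u. H \<omega> * (W u \<omega> - W ?a \<omega>) $ i)"
    using increment_continuous
  proof eventually_elim
    case (elim \<omega>)
    then have "continuous_on {?a..?b} (\<lambda>u. W u \<omega> - W ?a \<omega>)" using g(1) by blast
    then have "(\<lambda>u. W u \<omega> - W ?a \<omega>) integrable_on {?a..?b}" by (rule integrable_continuous_real)
    from integral_linear[OF this bounded_linear_vec_nth[of i]]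
    have "increment_integral \<tau> j ?b \<omega> $ i = integral {?a..?b} (\<lambda>u. (W u \<omega> - W ?a \<omega>) $ i)"
      by (simp add: increment_integral_def o_def)
    then show ?case by simp
  qed
  have Jm: "(\<lambda>\<omega>. increment_integral \<tau> j ?b \<omega> $ i) \<in> borel_measurable M"
    by (rule measurable_compose[OF F_measurable_M[OF increment_integral_measurable[OF \<tau>0]], where g="\<lambda>x. x $ i"])
       (use g in \<open>auto intro!: borel_measurable_continuous_onI continuous_intros\<close>)
  have meas: "(\<lambda>\<omega>. H \<omega> * increment_integral \<tau> j ?b \<omega> $ i) \<in> borel_measurable M"
    using H(2) Jm by simp
  show ?thesis using m integrable_cong_AE[OF meas _ ae] integral_cong_AE[OF meas _ ae]
    unfolding mean_le_def by (auto dest: borel_measurable_integrable)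
qed

text \<open>In units of \<open>\<tau>\<close> each step adds an increment of size \<open>\<tau>\<^bsup>1/2\<^esup>\<close> that is orthogonal to the past. By
\<open>norm_powr_small_increment_le\<close> it changes the moment by the order \<open>\<tau>\<close> only.\<close>

lemma correction_moment: "\<exists>C>0. \<forall>\<tau>\<in>{0<..<1}. \<forall>n. mean_le M (\<lambda>\<omega>. norm (correction \<tau> n \<omega>) powr (4 * p)) (growth C (real n * \<tau>))"
proof -
  define m where "m = 4 * p"
  have m: "4 \<le> m" "1 \<le> m" using p by (auto simp: m_def)
  define c where "c = m\<^sup>2 * 2 powr m"
  have c0: "0 \<le> c" by (simp add: c_def)
  obtain C1 where C1: "C1 > 0" and E\<eta>: "\<forall>\<tau>\<in>{0<..<1}. \<forall>j. mean_le M (\<lambda>\<omega>. correction_size \<tau> j \<omega> powr m) (growth C1 (real j * \<tau>))"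
    using correction_size_moment unfolding m_def[symmetric] by (elim exE conjE) (rule that)
  have qm: "0 \<le> q * m" "q * m \<le> \<Lambda>" using \<Lambda>_bounds p q by (auto simp: m_def mult_ac)
  obtain C2 where C2: "C2 > 0" and EZ: "\<forall>\<tau>\<in>{0<..<1}. \<forall>t\<ge>0. mean_le M (\<lambda>\<omega>. (1 + norm (Z \<tau> t \<omega>)) powr (q * m)) (growth C2 t)"
    using one_plus_Z_moment[OF qm] by (elim exE conjE) (rule that)
  define C3 where "C3 = c * C1 + C1"
  have C3: "0 < C3" unfolding C3_def using C1 c0 by (intro add_nonneg_pos mult_nonneg_nonneg) auto
  show ?thesis
  proof (intro exI[of _ "C3 + c + 2"] conjI ballI allI)
    show "0 < C3 + c + 2" using C3 c0 by simp
    fix \<tau> :: real and n assume \<tau>: "\<tau> \<in> {0<..<1}"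
    then have \<tau>0: "0 < \<tau>" by simp
    define t where "t = real n * \<tau>"
    have t0: "0 \<le> t" using \<tau> by (simp add: t_def)
    have "mean_le M (\<lambda>\<omega>. norm (correction \<tau> n \<omega>) powr m) (exp (c * (real n * \<tau>)) * (0 + real n * \<tau> * growth C3 t))"
    proof (rule mean_le_gronwall[where f="\<lambda>j \<omega>. norm (correction \<tau> j \<omega>) powr m"])
      show "mean_le M (\<lambda>\<omega>. norm (correction \<tau> 0 \<omega>) powr m) 0" using m by (simp add: correction_def mean_le_def)
      fix j a assume j: "j < n" and a: "mean_le M (\<lambda>\<omega>. norm (correction \<tau> j \<omega>) powr m) a"
      note g = grid_step[OF \<tau>0, of j]
      let ?a = "real j * \<tau>" and ?b = "real (Suc j) * \<tau>"
      define A where "A \<omega> = total_deriv b (Z \<tau> ?a \<omega>)" for \<omega>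
      \<comment> \<open>The increment of the correction is linear in \<open>increment_integral\<close>; its coefficients \<open>H i\<close> are known at time \<open>real j * \<tau>\<close>.\<close>
      define H where "H i \<omega> = m * norm (correction \<tau> j \<omega>) powr (m - 2) * (correction \<tau> j \<omega> \<bullet> ((1 / \<tau>) *\<^sub>R A \<omega> (B *v axis i 1)))" for i \<omega>
      have jt: "?a \<le> t" using j \<tau> by (simp add: t_def)
      have mart: "mean_le M (\<lambda>\<omega>. \<Sum>i\<in>UNIV. H i \<omega> * increment_integral \<tau> j ?b \<omega> $ i) 0"
      proof -
        have "mean_le M (\<lambda>\<omega>. H i \<omega> * increment_integral \<tau> j ?b \<omega> $ i) 0" for i
        proof (rule orthogonal_increment[OF \<tau>])
          have "(\<lambda>\<omega>. A \<omega> (B *v axis i 1)) \<in> borel_measurable (F ?a)"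
            unfolding A_def by (intro measurable_total_deriv Z_measurable[OF \<tau> g(1)] borel_measurable_const)
          then show Hm: "H i \<in> borel_measurable (F ?a)"
            unfolding H_def[abs_def] using correction_measurable[OF \<tau>, of j] by simp
          define h where "h = m * ((1 / \<tau>) * (L9 * 2 powr q * B_opnorm))"
          have h0: "0 \<le> h" using m \<tau> const_pos B_opnorm_nonneg by (simp add: h_def)
          have "mean_le M (\<lambda>\<omega>. h * (norm (correction \<tau> j \<omega>) powr m + (1 + norm (Z \<tau> ?a \<omega>)) powr (q * m))) (h * (a + growth C2 ?a))"
            using a EZ[rule_format, OF \<tau> g(1)] h0 by (intro mean_le_cmult mean_le_add)
          then have hi: "integrable M (\<lambda>\<omega>. h * (norm (correction \<tau> j \<omega>) powr m + (1 + norm (Z \<tau> ?a \<omega>)) powr (q * m)))"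
            by (simp add: mean_le_def)
          show "integrable M (H i)"
          proof (rule Bochner_Integration.integrable_bound[OF hi F_measurable_M[OF Hm g(1)] AE_I2])
            fix \<omega>
            let ?x = "norm (correction \<tau> j \<omega>)" and ?y = "1 + norm (Z \<tau> ?a \<omega>)"
            have "norm (A \<omega> (B *v axis i 1)) \<le> norm (A \<omega>) * (B_opnorm * norm (axis i 1 :: real ^ 'm))"
              by (rule order_trans[OF norm_blinfun]) (intro mult_left_mono norm_B_le norm_ge_zero)
            also have "norm (axis i 1 :: real ^ 'm) = 1" by (simp add: norm_eq_sqrt_inner inner_axis_axis)
            also have "norm (A \<omega>) * (B_opnorm * 1) \<le> (L9 * 2 powr q * ?y powr q) * (B_opnorm * 1)"
              unfolding A_def using B_opnorm_nonneg by (intro mult_right_mono total_deriv_growth) auto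
            finally have Ai: "norm (A \<omega> (B *v axis i 1)) \<le> L9 * 2 powr q * B_opnorm * ?y powr q" by (simp add: mult_ac)
            have "\<bar>correction \<tau> j \<omega> \<bullet> ((1 / \<tau>) *\<^sub>R A \<omega> (B *v axis i 1))\<bar> \<le> ?x * norm ((1 / \<tau>) *\<^sub>R A \<omega> (B *v axis i 1))"
              by (rule Cauchy_Schwarz_ineq2)
            also have "\<dots> \<le> ?x * ((1 / \<tau>) * (L9 * 2 powr q * B_opnorm * ?y powr q))"
            proof (rule mult_left_mono)
              show "norm ((1 / \<tau>) *\<^sub>R A \<omega> (B *v axis i 1)) \<le> (1 / \<tau>) * (L9 * 2 powr q * B_opnorm * ?y powr q)"
                using mult_left_mono[OF Ai, of "1 / \<tau>"] \<tau> by simp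
            qed simp
            finally have ip: "\<bar>correction \<tau> j \<omega> \<bullet> ((1 / \<tau>) *\<^sub>R A \<omega> (B *v axis i 1))\<bar> \<le> ?x * ((1 / \<tau>) * (L9 * 2 powr q * B_opnorm * ?y powr q))" .
            have "\<bar>H i \<omega>\<bar> = (m * ?x powr (m - 2)) * \<bar>correction \<tau> j \<omega> \<bullet> ((1 / \<tau>) *\<^sub>R A \<omega> (B *v axis i 1))\<bar>"
              unfolding H_def abs_mult using m by simp
            also have "\<dots> \<le> (m * ?x powr (m - 2)) * (?x * ((1 / \<tau>) * (L9 * 2 powr q * B_opnorm * ?y powr q)))"
              using ip m by (intro mult_left_mono) auto
            also have "\<dots> = h * ((?x * ?x powr (m - 2)) * ?y powr q)" by (simp add: h_def mult_ac)
            also have "?x * ?x powr (m - 2) = ?x powr (m - 1)"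
            proof -
              have "1 + (m - 2) = m - 1" by simp
              with powr_mult_base[of ?x "m - 2"] show ?thesis by simp
            qed
            also have "h * (?x powr (m - 1) * ?y powr q) \<le> h * (?x powr (m - 1 + 1) + ?y powr (q * (m - 1 + 1) / 1))"
              using m q h0 by (intro mult_left_mono product_powr_le_sum_powr) auto
            finally show "norm (H i \<omega>) \<le> norm (h * (?x powr m + ?y powr (q * m)))"
              using h0 by simp
          qed
        qed
        then have "integrable M (\<lambda>\<omega>. \<Sum>i\<in>UNIV. H i \<omega> * increment_integral \<tau> j ?b \<omega> $ i)"
          "(\<integral>\<omega>. (\<Sum>i\<in>UNIV. H i \<omega> * increment_integral \<tau> j ?b \<omega> $ i) \<partial>M) = (\<Sum>i\<in>UNIV. \<integral>\<omega>. H i \<omega> * increment_integral \<tau> j ?b \<omega> $ i \<partial>M)"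
          "\<And>i. (\<integral>\<omega>. H i \<omega> * increment_integral \<tau> j ?b \<omega> $ i \<partial>M) \<le> 0"
          by (auto simp: mean_le_def)
        then show ?thesis unfolding mean_le_def by (simp add: sum_nonpos)
      qed
      have E\<eta>j: "mean_le M (\<lambda>\<omega>. correction_size \<tau> j \<omega> powr m) (growth C1 t)"
        by (rule mean_growth_mono[OF E\<eta>[rule_format, OF \<tau>]]) (use C1 g jt in auto)
      have "mean_le M (\<lambda>\<omega>. norm (correction \<tau> j \<omega>) powr m + (\<Sum>i\<in>UNIV. H i \<omega> * increment_integral \<tau> j ?b \<omega> $ i)
            + c * \<tau> * (norm (correction \<tau> j \<omega>) powr m + correction_size \<tau> j \<omega> powr m)) (a + 0 + c * \<tau> * (a + growth C1 t))"
        using c0 \<tau> by (intro mean_le_add mean_le_cmult a mart E\<eta>j) auto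
      then have "mean_le M (\<lambda>\<omega>. norm (correction \<tau> j \<omega>) powr m + (\<Sum>i\<in>UNIV. H i \<omega> * increment_integral \<tau> j ?b \<omega> $ i)
            + c * \<tau> * (norm (correction \<tau> j \<omega>) powr m + correction_size \<tau> j \<omega> powr m)) (exp (c * \<tau>) * (a + \<tau> * growth C3 t))"
      proof (rule mean_le_mono)
        have a0: "0 \<le> a" by (rule mean_le_nonneg[OF a]) simp
        have "c * growth C1 t \<le> growth C3 t" unfolding C3_def using c0 C1 t0 by (intro growth_cmult) auto
        then have "\<tau> * (c * growth C1 t) \<le> \<tau> * growth C3 t" using \<tau> by (intro mult_left_mono) auto
        then have "a + 0 + c * \<tau> * (a + growth C1 t) \<le> (1 + c * \<tau>) * a + 1 * (\<tau> * growth C3 t)"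
          by (simp add: algebra_simps)
        also have "\<dots> \<le> exp (c * \<tau>) * a + exp (c * \<tau>) * (\<tau> * growth C3 t)"
          using a0 c0 \<tau> growth_nonneg[of C3 t] C3 by (intro add_mono mult_right_mono) auto
        finally show "a + 0 + c * \<tau> * (a + growth C1 t) \<le> exp (c * \<tau>) * (a + \<tau> * growth C3 t)"
          by (simp add: algebra_simps)
      qed
      then show "mean_le M (\<lambda>\<omega>. norm (correction \<tau> (Suc j) \<omega>) powr m) (exp (c * \<tau>) * (a + \<tau> * growth C3 t))"
      proof (rule mean_le_AE_mono)
        show "(\<lambda>\<omega>. norm (correction \<tau> (Suc j) \<omega>) powr m) \<in> borel_measurable M" using correction_measurable_M[OF \<tau>, of "Suc j"] by simp
        show "AE \<omega> in M. 0 \<le> norm (correction \<tau> (Suc j) \<omega>) powr m \<and> norm (correction \<tau> (Suc j) \<omega>) powr m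
            \<le> norm (correction \<tau> j \<omega>) powr m + (\<Sum>i\<in>UNIV. H i \<omega> * increment_integral \<tau> j ?b \<omega> $ i) + c * \<tau> * (norm (correction \<tau> j \<omega>) powr m + correction_size \<tau> j \<omega> powr m)"
          using correction_bound[OF \<tau>]
        proof eventually_elim
          case (elim \<omega>)
          define T where "T = A \<omega> (B *v increment_integral \<tau> j ?b \<omega>)"
          \<comment> \<open>the increment of the correction, normalised to be of order \<open>1\<close>\<close>
          define \<zeta> where "\<zeta> = (1 / (\<tau> * sqrt \<tau>)) *\<^sub>R T"
          have z: "sqrt \<tau> *\<^sub>R \<zeta> = (1 / \<tau>) *\<^sub>R T" using \<tau> by (simp add: \<zeta>_def)
          have N': "correction \<tau> (Suc j) \<omega> = correction \<tau> j \<omega> + sqrt \<tau> *\<^sub>R \<zeta>"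
            unfolding z by (simp add: correction_def T_def A_def)
          have "norm T \<le> \<tau> * sqrt \<tau> * correction_size \<tau> j \<omega>" unfolding T_def A_def using elim g(2) by (auto simp del: of_nat_Suc)
          then have "norm \<zeta> \<le> correction_size \<tau> j \<omega>" using \<tau> by (simp add: \<zeta>_def field_simps)
          then have \<zeta>: "norm \<zeta> powr m \<le> correction_size \<tau> j \<omega> powr m" using m by (intro powr_mono2) auto
          have "B *v increment_integral \<tau> j ?b \<omega> = (\<Sum>i\<in>UNIV. increment_integral \<tau> j ?b \<omega> $ i *\<^sub>R (B *v axis i 1))"
          proof -
            have "increment_integral \<tau> j ?b \<omega> = (\<Sum>i\<in>UNIV. increment_integral \<tau> j ?b \<omega> $ i *\<^sub>R axis i 1)"
              using basis_expansion[of "increment_integral \<tau> j ?b \<omega>"] by (simp add: scalar_mult_eq_scaleR)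
            then have "B *v increment_integral \<tau> j ?b \<omega> = B *v (\<Sum>i\<in>UNIV. increment_integral \<tau> j ?b \<omega> $ i *\<^sub>R axis i 1)" by simp
            also have "\<dots> = (\<Sum>i\<in>UNIV. increment_integral \<tau> j ?b \<omega> $ i *\<^sub>R (B *v axis i 1))"
              by (simp add: linear_sum[OF matrix_vector_mul_linear[of B]] linear_scale[OF matrix_vector_mul_linear[of B]])
            finally show ?thesis .
          qed
          then have T: "T = (\<Sum>i\<in>UNIV. increment_integral \<tau> j ?b \<omega> $ i *\<^sub>R A \<omega> (B *v axis i 1))"
            by (simp add: T_def blinfun.sum_right blinfun.scaleR_right)
          have "m * norm (correction \<tau> j \<omega>) powr (m - 2) * (correction \<tau> j \<omega> \<bullet> (sqrt \<tau> *\<^sub>R \<zeta>)) = (\<Sum>i\<in>UNIV. H i \<omega> * increment_integral \<tau> j ?b \<omega> $ i)"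
            unfolding z by (simp add: T H_def inner_sum_right sum_distrib_left mult_ac sum_divide_distrib)
          with norm_powr_small_increment_le[OF m(1), of \<tau> "correction \<tau> j \<omega>" \<zeta>] \<tau>
          have "norm (correction \<tau> (Suc j) \<omega>) powr m \<le> norm (correction \<tau> j \<omega>) powr m + (\<Sum>i\<in>UNIV. H i \<omega> * increment_integral \<tau> j ?b \<omega> $ i)
             + c * \<tau> * (norm (correction \<tau> j \<omega>) powr m + norm \<zeta> powr m)"
            unfolding N' c_def by simp
          also have "\<dots> \<le> norm (correction \<tau> j \<omega>) powr m + (\<Sum>i\<in>UNIV. H i \<omega> * increment_integral \<tau> j ?b \<omega> $ i)
             + c * \<tau> * (norm (correction \<tau> j \<omega>) powr m + correction_size \<tau> j \<omega> powr m)"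
            using \<zeta> c0 \<tau> by (intro add_left_mono mult_left_mono) auto
          finally show ?case by simp
        qed
      qed
    qed (use c0 \<tau> growth_nonneg C3 in auto)
    then show "mean_le M (\<lambda>\<omega>. norm (correction \<tau> n \<omega>) powr (4 * p)) (growth (C3 + c + 2) (real n * \<tau>))"
      unfolding m_def[symmetric] t_def[symmetric]
    proof (rule mean_le_mono)
      have "exp (c * t) * (0 + t * growth C3 t) \<le> exp (c * t) * (\<mu> + t * growth C3 t)"
        using \<mu>_nonneg by (intro mult_left_mono) auto
      also have "\<dots> \<le> growth (C3 + c + 2) t" using c0 C3 t0 by (intro growth_accumulated) auto
      finally show "exp (c * t) * (0 + t * growth C3 t) \<le> growth (C3 + c + 2) t" .
    qed
  qed
qed

end

section \<open>The error between the solution and the scheme\<close>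

context tamed_scheme
begin

definition corrected_error :: "real \<Rightarrow> nat \<Rightarrow> 'a \<Rightarrow> real ^ 'd" where
  "corrected_error \<tau> n \<omega> = X (real n * \<tau>) \<omega> - Z \<tau> (real n * \<tau>) \<omega> - \<tau> *\<^sub>R correction \<tau> n \<omega>"

text \<open>Up to a constant and the factor \<open>\<tau> powr (2 * p)\<close>, the inhomogeneity of the differential inequality
for the corrected error.\<close>

definition source :: "real \<Rightarrow> nat \<Rightarrow> real \<Rightarrow> 'a \<Rightarrow> real" where
  "source \<tau> j s \<omega> = norm (correction \<tau> j \<omega>) powr (4 * p) + correction_size \<tau> j \<omega> powr (4 * p) + 1
     + norm (X s \<omega>) powr \<Lambda> + norm (Z \<tau> s \<omega>) powr \<Lambda> + norm (Z \<tau> (real j * \<tau>) \<omega>) powr \<Lambda>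
     + (norm (W s \<omega> - W (real j * \<tau>) \<omega>) / sqrt \<tau>) powr \<Lambda>"

lemma source_nonneg: "0 \<le> source \<tau> j s \<omega>"
  unfolding source_def by (intro add_nonneg_nonneg) auto

lemma source_mean:
  "\<exists>C>0. \<forall>\<tau>\<in>{0<..<1}. \<forall>j. \<forall>s\<in>{real j * \<tau>..real (Suc j) * \<tau>}. mean_le M (source \<tau> j s) (growth C s)"
proof -
  obtain C1 where C1: "C1 > 0" and n: "\<forall>\<tau>\<in>{0<..<1}. \<forall>n. mean_le M (\<lambda>\<omega>. norm (correction \<tau> n \<omega>) powr (4 * p)) (growth C1 (real n * \<tau>))"
    using correction_moment by (elim exE conjE) (rule that)
  obtain C2 where C2: "C2 > 0" and e: "\<forall>\<tau>\<in>{0<..<1}. \<forall>j. mean_le M (\<lambda>\<omega>. correction_size \<tau> j \<omega> powr (4 * p)) (growth C2 (real j * \<tau>))"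
    using correction_size_moment by (elim exE conjE) (rule that)
  obtain C3 where C3: "C3 > 0" and x: "\<forall>t\<ge>0. mean_le M (\<lambda>\<omega>. norm (X t \<omega>) powr \<Lambda>) (growth C3 t)"
    using X_moment by (elim exE conjE) (rule that)
  obtain C4 where C4: "C4 > 0" and z: "\<forall>\<tau>\<in>{0<..<1}. \<forall>t\<ge>0. mean_le M (\<lambda>\<omega>. norm (Z \<tau> t \<omega>) powr \<Lambda>) (growth C4 t)"
    using Z_moment by (elim exE conjE) (rule that)
  obtain C5 where C5: "C5 > 0" and w: "\<forall>s t \<tau>. 0 \<le> s \<and> s \<le> t \<and> t - s \<le> \<tau> \<and> 0 < \<tau>
           \<longrightarrow> mean_le M (\<lambda>\<omega>. (norm (W t \<omega> - W s \<omega>) / sqrt \<tau>) powr \<Lambda>) C5"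
    using increment_moment[OF \<Lambda>_nonneg] by (elim exE conjE) (rule that)
  show ?thesis
  proof (intro exI[of _ "C1 + C2 + 1 + C3 + C4 + C4 + C5"] conjI ballI allI)
    show "0 < C1 + C2 + 1 + C3 + C4 + C4 + C5" using C1 C2 C3 C4 C5 by linarith
    fix \<tau> :: real and j s assume \<tau>: "\<tau> \<in> {0<..<1}" and s: "s \<in> {real j * \<tau>..real (Suc j) * \<tau>}"
    have \<tau>0: "0 < \<tau>" using \<tau> by simp
    note g = grid_step[OF \<tau>0, of j]
    have s0: "0 \<le> s" "real j * \<tau> \<le> s" using g(1) s unfolding atLeastAtMost_iff by linarith+
    have n': "mean_le M (\<lambda>\<omega>. norm (correction \<tau> j \<omega>) powr (4 * p)) (growth C1 s)"
      by (rule mean_growth_mono[OF n[rule_format, OF \<tau>]]) (use C1 g s0 in auto)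
    have e': "mean_le M (\<lambda>\<omega>. correction_size \<tau> j \<omega> powr (4 * p)) (growth C2 s)"
      by (rule mean_growth_mono[OF e[rule_format, OF \<tau>]]) (use C2 g s0 in auto)
    have z': "mean_le M (\<lambda>\<omega>. norm (Z \<tau> (real j * \<tau>) \<omega>) powr \<Lambda>) (growth C4 s)"
      by (rule mean_growth_mono[OF z[rule_format, OF \<tau> g(1)]]) (use C4 g s0 in auto)
    have w': "mean_le M (\<lambda>\<omega>. (norm (W s \<omega> - W (real j * \<tau>) \<omega>) / sqrt \<tau>) powr \<Lambda>) (growth C5 s)"
      by (rule mean_le_mono[OF w[rule_format] growth_const]) (use C5 g s s0 \<tau> in auto)
    show "mean_le M (source \<tau> j s) (growth (C1 + C2 + 1 + C3 + C4 + C4 + C5) s)"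
      unfolding source_def[abs_def]
      using C1 C2 C3 C4 C5 s0 n' e' z' w' x z \<tau>
      by (intro mean_growth_add[OF _ _ s0(1)] mean_growth_const) auto
  qed
qed

lemma source_continuous:
  assumes \<tau>: "\<tau> \<in> {0<..<1}"
  shows "AE \<omega> in M. \<forall>j. continuous_on {real j * \<tau>..real (Suc j) * \<tau>} (\<lambda>s. source \<tau> j s \<omega>)"
  using X_continuous Z_continuous[OF \<tau>] increment_continuous
proof eventually_elim
  case (elim \<omega>)
  have \<tau>0: "0 < \<tau>" using \<tau> by simp
  show ?case
  proof
    fix j
    note g = grid_step[OF \<tau>0, of j]
    have "continuous_on {real j * \<tau>..real (Suc j) * \<tau>} (\<lambda>s. X s \<omega>)"
      by (rule continuous_on_subset[OF elim(1)]) (use g in auto)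
    moreover have "continuous_on {real j * \<tau>..real (Suc j) * \<tau>} (\<lambda>s. Z \<tau> s \<omega>)"
      by (rule continuous_on_subset[OF elim(2)]) (use g in auto)
    moreover have "continuous_on {real j * \<tau>..real (Suc j) * \<tau>} (\<lambda>s. W s \<omega> - W (real j * \<tau>) \<omega>)"
      using elim(3) g by blast
    ultimately show "continuous_on {real j * \<tau>..real (Suc j) * \<tau>} (\<lambda>s. source \<tau> j s \<omega>)"
      unfolding source_def using \<Lambda>_bounds \<tau>0
      by (intro continuous_on_add continuous_on_const continuous_on_powr' continuous_on_norm continuous_on_divide) auto
  qed
qed

lemma source_integral_mean:
  "\<exists>C>0. \<forall>\<tau>\<in>{0<..<1}. \<forall>j. mean_le M (\<lambda>\<omega>. integral {real j * \<tau>..real (Suc j) * \<tau>} (\<lambda>s. source \<tau> j s \<omega>))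
      (\<tau> * growth C (real (Suc j) * \<tau>))"
proof -
  obtain C where C: "C > 0" and sm: "\<forall>\<tau>\<in>{0<..<1}. \<forall>j. \<forall>s\<in>{real j * \<tau>..real (Suc j) * \<tau>}. mean_le M (source \<tau> j s) (growth C s)"
    using source_mean by (elim exE conjE) (rule that)
  show ?thesis
  proof (intro exI[of _ C] conjI ballI allI C)
    fix \<tau> :: real and j assume \<tau>: "\<tau> \<in> {0<..<1}"
    have \<tau>0: "0 < \<tau>" using \<tau> by simp
    note g = grid_step[OF \<tau>0, of j]
    let ?a = "real j * \<tau>" and ?b = "real (Suc j) * \<tau>"
    have "mean_le M (\<lambda>\<omega>. integral {?a..?b} (\<lambda>s. source \<tau> j s \<omega>)) (growth C ?b * (?b - ?a))"
    proof (rule mean_le_process_integral[OF prob_space_M complete_M])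
      show "AE \<omega> in M. continuous_on {?a..?b} (\<lambda>s. source \<tau> j s \<omega>)"
        using source_continuous[OF \<tau>] by eventually_elim blast
      show m: "mean_le M (source \<tau> j s) (growth C ?b)" if "s \<in> {?a..?b}" for s
      proof (rule mean_growth_mono[OF sm[rule_format, OF \<tau> that]])
        show "0 \<le> s" using g(1) that unfolding atLeastAtMost_iff by linarith
      qed (use C that in auto)
      show "mean_le M (\<lambda>\<omega>. \<bar>source \<tau> j s \<omega>\<bar>) (growth C ?b)" if "s \<in> {?a..?b}" for s
        using m[OF that] by (simp add: source_nonneg)
    qed (use g in auto)
    then show "mean_le M (\<lambda>\<omega>. integral {?a..?b} (\<lambda>s. source \<tau> j s \<omega>)) (\<tau> * growth C ?b)"
      unfolding g(3) by (simp add: mult.commute)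
  qed
qed

text \<open>Inside the cell the correction is continued by \<open>n\<close>, so that the path \<open>v = X - Z - n\<close> interpolates the corrected
errors at the two ends, and the term of order \<open>\<tau>\<^bsup>1/2\<^esup>\<close> cancels in its derivative.\<close>

lemma error_step:
  "\<exists>c\<ge>0. \<exists>K\<ge>0. \<forall>\<tau>\<in>{0<..<1}. AE \<omega> in M. \<forall>j. norm (corrected_error \<tau> (Suc j) \<omega>) powr (2 * p)
     \<le> exp (c * \<tau>) * (norm (corrected_error \<tau> j \<omega>) powr (2 * p)
        + \<tau> powr (2 * p) * (K * integral {real j * \<tau>..real (Suc j) * \<tau>} (\<lambda>s. source \<tau> j s \<omega>)))"
proof -
  obtain C where C: "C > 0" and res: "\<forall>\<tau>\<in>{0<..<1}. \<forall>s\<in>{0..\<tau>}. \<forall>x w.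
     norm (b (x + (s *\<^sub>R tamed_drift q b \<tau> x + w)) - tamed_drift q b \<tau> x - total_deriv b x w)
       \<le> C * \<tau> * (1 + norm x + norm w / sqrt \<tau>) powr r2"
    using local_residual_bound by (elim exE conjE) (rule that)
  define C0 where "C0 = 2 * L0' + 3 + L9\<^sup>2"
  define c where "c = (2 * L0' + 3 + 1) * p"
  define K1 where "K1 = 2 powr (4 * p) + 4 powr \<Lambda> + C powr (2 * p) * 4 powr \<Lambda> * (1 + B_opnorm powr \<Lambda>)"
  define K where "K = C0 powr p * 2 powr p * K1"
  have C0: "0 \<le> C0" using const_pos by (simp add: C0_def)
  show ?thesis
  proof (rule exI[of _ c], intro conjI, simp add: c_def, use const_pos p in simp, rule exI[of _ K], intro conjI ballI)
    show "0 \<le> K" by (simp add: K_def K1_def)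
    fix \<tau> :: real assume \<tau>: "\<tau> \<in> {0<..<1}"
    have \<tau>0: "0 < \<tau>" using \<tau> by simp
    show "AE \<omega> in M. \<forall>j. norm (corrected_error \<tau> (Suc j) \<omega>) powr (2 * p)
     \<le> exp (c * \<tau>) * (norm (corrected_error \<tau> j \<omega>) powr (2 * p)
        + \<tau> powr (2 * p) * (K * integral {real j * \<tau>..real (Suc j) * \<tau>} (\<lambda>s. source \<tau> j s \<omega>)))"
      using X_derivative X_continuous Z_continuous[OF \<tau>] Z_step[OF \<tau>] increment_continuous correction_bound[OF \<tau>] source_continuous[OF \<tau>]
    proof eventually_elim
      case (elim \<omega>)
      show ?case
      proof
        fix j
        note g = grid_step[OF \<tau>0, of j]
        define a d where "a = real j * \<tau>" and "d = real (Suc j) * \<tau>"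
        have ad: "0 \<le> a" "a < d" "d - a = \<tau>" using g by (auto simp: a_def d_def)
        define z bt where "z = Z \<tau> a \<omega>" and "bt = tamed_drift q b \<tau> z"
        define A where "A = total_deriv b z"
        define \<Delta> where "\<Delta> s = W s \<omega> - W a \<omega>" for s
        define n where "n s = \<tau> *\<^sub>R correction \<tau> j \<omega> + A (B *v increment_integral \<tau> j s \<omega>)" for s
        define v where "v s = (X s \<omega> - B *v W s \<omega>) - ((z - B *v W a \<omega>) + (s - a) *\<^sub>R bt) - n s" for s
        define \<rho> where "\<rho> s = b (Z \<tau> s \<omega>) - bt - A (B *v \<Delta> s)" for s
        define Y where "Y s = 1 + norm (X s \<omega>) + norm (Z \<tau> s \<omega>)" for s
        define u where "u s = 1 + norm z + norm (B *v \<Delta> s) / sqrt \<tau>" for s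
        define G where "G = norm (correction \<tau> j \<omega>) + correction_size \<tau> j \<omega>"
        define h where "h s = C0 * (\<tau>\<^sup>2 * (G\<^sup>2 * Y s powr (2 * q) + (C * u s powr r2)\<^sup>2))" for s
        have \<eta>0: "0 \<le> correction_size \<tau> j \<omega>" and corr: "\<And>s. s \<in> {a..d} \<Longrightarrow> norm (A (B *v increment_integral \<tau> j s \<omega>)) \<le> \<tau> * sqrt \<tau> * correction_size \<tau> j \<omega>"
          using elim(6) unfolding A_def z_def a_def d_def by blast+
        have G0: "0 \<le> G" using \<eta>0 by (simp add: G_def)
        have Zs: "Z \<tau> s \<omega> = z + ((s - a) *\<^sub>R bt + B *v \<Delta> s)" if "s \<in> {a..d}" for s
          using elim(4) that unfolding z_def bt_def \<Delta>_def a_def d_def by blast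
        have vs: "v s = X s \<omega> - Z \<tau> s \<omega> - n s" if "s \<in> {a..d}" for s
          unfolding v_def Zs[OF that] by (simp add: \<Delta>_def matrix_vector_mult_diff_distrib)
        have cX: "continuous_on {a..d} (\<lambda>s. X s \<omega>)" by (rule continuous_on_subset[OF elim(2)]) (use ad in auto)
        have cZ: "continuous_on {a..d} (\<lambda>s. Z \<tau> s \<omega>)" by (rule continuous_on_subset[OF elim(3)]) (use ad in auto)
        have c\<Delta>: "continuous_on {a..d} \<Delta>" using elim(5) ad unfolding \<Delta>_def by blast
        have cB: "continuous_on {a..d} (\<lambda>s. B *v \<Delta> s)"
          by (rule linear_continuous_on_compose[OF c\<Delta> matrix_vector_mul_linear])
        have Y1: "1 \<le> Y s" and u1: "1 \<le> u s" for s using \<tau>0 by (auto simp: Y_def u_def)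
        have cY: "continuous_on {a..d} Y" unfolding Y_def by (intro continuous_intros cX cZ)
        have cu: "continuous_on {a..d} u" unfolding u_def using \<tau>0
          by (intro continuous_on_add continuous_on_const continuous_on_divide continuous_on_norm cB) auto
        have "\<forall>s\<in>{a..d}. Y s \<noteq> 0" "\<forall>s\<in>{a..d}. u s \<noteq> 0" using Y1 u1 by (metis not_one_le_zero)+
        then have ch: "continuous_on {a..d} h" unfolding h_def
          by (intro continuous_on_mult continuous_on_const continuous_on_add continuous_on_power continuous_on_powr cY cu)
        have h0: "0 \<le> h s" for s unfolding h_def using C0 by (intro mult_nonneg_nonneg add_nonneg_nonneg) auto
        have "norm (v d) powr (2 * p) \<le> exp ((2 * L0' + 3 + 1) * p * (d - a)) * (norm (v a) powr (2 * p) + integral {a..d} (\<lambda>s. h s powr p))"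
        proof (rule norm_powr_gronwall)
          fix s assume s: "s \<in> {a..d}"
          have "((\<lambda>s. increment_integral \<tau> j s \<omega>) has_vector_derivative \<Delta> s) (at s within {a..d})"
            unfolding increment_integral_def a_def[symmetric] using integral_has_vector_derivative[OF c\<Delta> s] by (simp add: \<Delta>_def[abs_def])
          then have "((\<lambda>s. B *v increment_integral \<tau> j s \<omega>) has_vector_derivative B *v \<Delta> s) (at s within {a..d})"
            by (rule bounded_linear.has_vector_derivative[OF matrix_vector_mul_bounded_linear])
          then have "((\<lambda>s. A (B *v increment_integral \<tau> j s \<omega>)) has_vector_derivative A (B *v \<Delta> s)) (at s within {a..d})"
            by (rule bounded_linear.has_vector_derivative[OF blinfun.bounded_linear_right])
          then have "(n has_vector_derivative 0 + A (B *v \<Delta> s)) (at s within {a..d})"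
            unfolding n_def by (intro has_vector_derivative_add has_vector_derivative_const)
          moreover have "((\<lambda>s. (z - B *v W a \<omega>) + (s - a) *\<^sub>R bt) has_vector_derivative bt) (at s within {a..d})"
            by (auto intro!: derivative_eq_intros)
          moreover have "((\<lambda>s. X s \<omega> - B *v W s \<omega>) has_vector_derivative b (X s \<omega>)) (at s within {a..d})"
            using elim(1) ad s by blast
          ultimately have "(v has_vector_derivative (b (X s \<omega>) - bt - (0 + A (B *v \<Delta> s)))) (at s within {a..d})"
            unfolding v_def by (intro has_vector_derivative_diff)
          moreover have "b (X s \<omega>) - bt - (0 + A (B *v \<Delta> s)) = b (X s \<omega>) - b (Z \<tau> s \<omega>) + \<rho> s"
            by (simp add: \<rho>_def)
          ultimately show "(v has_vector_derivative (b (X s \<omega>) - b (Z \<tau> s \<omega>) + \<rho> s)) (at s within {a..d})"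
            by (simp only:)
          have "norm (n s) \<le> \<tau> * norm (correction \<tau> j \<omega>) + \<tau> * sqrt \<tau> * correction_size \<tau> j \<omega>"
            unfolding n_def using corr[OF s] \<tau>0 by (intro norm_triangle_le add_mono) auto
          also have "\<tau> * sqrt \<tau> * correction_size \<tau> j \<omega> \<le> \<tau> * 1 * correction_size \<tau> j \<omega>"
            using \<tau> \<eta>0 by (intro mult_right_mono mult_left_mono) auto
          finally have "norm (n s) \<le> \<tau> * G" by (simp add: G_def algebra_simps)
          then have "(norm (n s))\<^sup>2 \<le> (\<tau> * G)\<^sup>2" by (intro power_mono) auto
          then have n2: "(norm (n s))\<^sup>2 * Y s powr (2 * q) \<le> (\<tau> * G)\<^sup>2 * Y s powr (2 * q)"
            by (intro mult_right_mono) auto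
          have "s - a \<in> {0..\<tau>}" using s ad by auto
          from res[rule_format, OF \<tau> this, of z "B *v \<Delta> s"]
          have "norm (\<rho> s) \<le> C * \<tau> * u s powr r2"
            unfolding \<rho>_def Zs[OF s] bt_def A_def u_def .
          then have "(norm (\<rho> s))\<^sup>2 \<le> (C * \<tau> * u s powr r2)\<^sup>2" by (intro power_mono) auto
          then have "C0 * ((norm (n s))\<^sup>2 * Y s powr (2 * q) + (norm (\<rho> s))\<^sup>2)
              \<le> C0 * ((\<tau> * G)\<^sup>2 * Y s powr (2 * q) + (C * \<tau> * u s powr r2)\<^sup>2)"
            using n2 C0 by (intro mult_left_mono add_mono)
          also have "\<dots> = h s" by (simp add: h_def power_mult_distrib algebra_simps)
          finally show "2 * (v s \<bullet> (b (X s \<omega>) - b (Z \<tau> s \<omega>) + \<rho> s)) \<le> (2 * L0' + 3) * (norm (v s))\<^sup>2 + h s"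
            using error_energy[of "X s \<omega>" "Z \<tau> s \<omega>" "n s" "\<rho> s"] unfolding vs[OF s] C0_def Y_def by linarith
        qed (use ad const_pos p h0 ch in auto)
        also have "v d = corrected_error \<tau> (Suc j) \<omega>"
        proof -
          have "\<tau> *\<^sub>R correction \<tau> (Suc j) \<omega> = n d"
            using \<tau>0 by (simp add: correction_def n_def A_def z_def a_def d_def scaleR_add_right)
          moreover have "v d = X d \<omega> - Z \<tau> d \<omega> - n d" by (rule vs) (use ad in auto)
          ultimately show ?thesis by (simp add: corrected_error_def d_def del: of_nat_Suc)
        qed
        also have "v a = corrected_error \<tau> j \<omega>"
        proof -
          have "n a = \<tau> *\<^sub>R correction \<tau> j \<omega>" by (simp add: n_def increment_integral_def a_def)
          moreover have "v a = X a \<omega> - Z \<tau> a \<omega> - n a" by (rule vs) (use ad in auto)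
          ultimately show ?thesis by (simp add: corrected_error_def a_def)
        qed
        also have "exp ((2 * L0' + 3 + 1) * p * (d - a)) = exp (c * \<tau>)" by (simp add: ad c_def)
        finally have "norm (corrected_error \<tau> (Suc j) \<omega>) powr (2 * p)
           \<le> exp (c * \<tau>) * (norm (corrected_error \<tau> j \<omega>) powr (2 * p) + integral {a..d} (\<lambda>s. h s powr p))" .
        also have "integral {a..d} (\<lambda>s. h s powr p) \<le> integral {a..d} (\<lambda>s. (\<tau> powr (2 * p) * K) * source \<tau> j s \<omega>)"
        proof (rule integral_le)
          show "(\<lambda>s. h s powr p) integrable_on {a..d}"
            using h0 p by (intro integrable_continuous_real continuous_on_powr' ch continuous_on_const) auto
          have cs: "continuous_on {a..d} (\<lambda>s. source \<tau> j s \<omega>)" using elim(7) by (simp add: a_def d_def)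
          show "(\<lambda>s. (\<tau> powr (2 * p) * K) * source \<tau> j s \<omega>) integrable_on {a..d}"
            by (intro integrable_continuous_real continuous_on_mult continuous_on_const cs)
          fix s assume s: "s \<in> {a..d}"
          have sq: "(x\<^sup>2) powr p = x powr (2 * p)" if "0 \<le> x" for x :: real
            using powr_powr[of x 2 p] that by simp
          define g where "g = norm (\<Delta> s) / sqrt \<tau>"
          have g0: "0 \<le> g" using \<tau>0 by (simp add: g_def)
          have "h s powr p = C0 powr p * (\<tau> powr (2 * p) * (G\<^sup>2 * Y s powr (2 * q) + (C * u s powr r2)\<^sup>2) powr p)"
            using \<tau>0 by (simp add: h_def powr_mult sq)
          also have "(G\<^sup>2 * Y s powr (2 * q) + (C * u s powr r2)\<^sup>2) powr p
              \<le> 2 powr p * ((G\<^sup>2 * Y s powr (2 * q)) powr p + ((C * u s powr r2)\<^sup>2) powr p)"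
            using p by (intro powr_add_le) auto
          also have "(G\<^sup>2 * Y s powr (2 * q)) powr p = G powr (2 * p) * Y s powr (2 * q * p)"
            using G0 by (simp add: powr_mult sq powr_powr)
          also have "((C * u s powr r2)\<^sup>2) powr p = C powr (2 * p) * u s powr \<Lambda>"
            using C by (simp add: sq powr_mult powr_powr \<Lambda>_def mult_ac)
          \<comment> \<open>Young: moments of order \<open>4 p\<close> of the correction and of order \<open>4 p q\<close> of \<open>X\<close> and \<open>Z\<close>\<close>
          also have "G powr (2 * p) * Y s powr (2 * q * p) \<le> G powr (2 * p + 2 * p) + Y s powr (2 * q * p * (2 * p + 2 * p) / (2 * p))"
            using G0 Y1[of s] p q by (intro product_powr_le_sum_powr) auto
          also have "2 * q * p * (2 * p + 2 * p) / (2 * p) = 4 * p * q" using p by (simp add: field_simps)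
          also have "2 * p + 2 * p = 4 * p" by simp
          also have "G powr (4 * p) \<le> 2 powr (4 * p) * (norm (correction \<tau> j \<omega>) powr (4 * p) + correction_size \<tau> j \<omega> powr (4 * p))"
            unfolding G_def using \<eta>0 p by (intro powr_add_le) auto
          also have "Y s powr (4 * p * q) \<le> Y s powr \<Lambda>" using Y1 \<Lambda>_bounds by (intro powr_mono) auto
          also have "Y s powr \<Lambda> \<le> 4 powr \<Lambda> * (1 powr \<Lambda> + norm (X s \<omega>) powr \<Lambda> + norm (Z \<tau> s \<omega>) powr \<Lambda>)"
            unfolding Y_def using \<Lambda>_bounds by (intro powr_add3_le) auto
          also have "u s powr \<Lambda> \<le> (1 + norm z + B_opnorm * g) powr \<Lambda>"
          proof (intro powr_mono2 \<Lambda>_nonneg)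
            show "u s \<le> 1 + norm z + B_opnorm * g"
              unfolding u_def g_def using norm_B_le[of "\<Delta> s"] \<tau>0 by (simp add: divide_right_mono)
          qed (use u1[of s] in auto)
          also have "(1 + norm z + B_opnorm * g) powr \<Lambda> \<le> 4 powr \<Lambda> * (1 powr \<Lambda> + norm z powr \<Lambda> + (B_opnorm * g) powr \<Lambda>)"
            using \<Lambda>_bounds B_opnorm_nonneg g0 by (intro powr_add3_le) auto
          finally have "h s powr p \<le> C0 powr p * (\<tau> powr (2 * p) * (2 powr p *
             (2 powr (4 * p) * (norm (correction \<tau> j \<omega>) powr (4 * p) + correction_size \<tau> j \<omega> powr (4 * p))
              + 4 powr \<Lambda> * (1 + norm (X s \<omega>) powr \<Lambda> + norm (Z \<tau> s \<omega>) powr \<Lambda>)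
              + C powr (2 * p) * (4 powr \<Lambda> * (1 + norm z powr \<Lambda> + B_opnorm powr \<Lambda> * g powr \<Lambda>)))))"
            by (simp add: powr_mult mult_left_mono)
          also have "\<dots> \<le> C0 powr p * (\<tau> powr (2 * p) * (2 powr p * (K1 * source \<tau> j s \<omega>)))"
          proof (intro mult_left_mono)
            let ?S = "source \<tau> j s \<omega>"
            have S: "norm (correction \<tau> j \<omega>) powr (4 * p) + correction_size \<tau> j \<omega> powr (4 * p) \<le> ?S"
              "1 + norm (X s \<omega>) powr \<Lambda> + norm (Z \<tau> s \<omega>) powr \<Lambda> \<le> ?S"
              "1 + norm z powr \<Lambda> \<le> ?S" "g powr \<Lambda> \<le> ?S"
              unfolding source_def g_def \<Delta>_def z_def a_def by (smt (verit) powr_ge_zero)+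
            have "B_opnorm powr \<Lambda> * g powr \<Lambda> \<le> B_opnorm powr \<Lambda> * ?S" by (intro mult_left_mono S) auto
            with S(3) have "1 + norm z powr \<Lambda> + B_opnorm powr \<Lambda> * g powr \<Lambda> \<le> (1 + B_opnorm powr \<Lambda>) * ?S"
              by (simp add: algebra_simps)
            then have "C powr (2 * p) * (4 powr \<Lambda> * (1 + norm z powr \<Lambda> + B_opnorm powr \<Lambda> * g powr \<Lambda>)) \<le> C powr (2 * p) * (4 powr \<Lambda> * ((1 + B_opnorm powr \<Lambda>) * ?S))"
              by (intro mult_left_mono) auto
            moreover have "2 powr (4 * p) * (norm (correction \<tau> j \<omega>) powr (4 * p) + correction_size \<tau> j \<omega> powr (4 * p)) \<le> 2 powr (4 * p) * ?S"
              by (intro mult_left_mono S) auto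
            moreover have "4 powr \<Lambda> * (1 + norm (X s \<omega>) powr \<Lambda> + norm (Z \<tau> s \<omega>) powr \<Lambda>) \<le> 4 powr \<Lambda> * ?S"
              by (intro mult_left_mono S) auto
            ultimately show "2 powr (4 * p) * (norm (correction \<tau> j \<omega>) powr (4 * p) + correction_size \<tau> j \<omega> powr (4 * p))
              + 4 powr \<Lambda> * (1 + norm (X s \<omega>) powr \<Lambda> + norm (Z \<tau> s \<omega>) powr \<Lambda>)
              + C powr (2 * p) * (4 powr \<Lambda> * (1 + norm z powr \<Lambda> + B_opnorm powr \<Lambda> * g powr \<Lambda>)) \<le> K1 * ?S"
              by (simp add: K1_def algebra_simps)
          qed auto
          also have "\<dots> = (\<tau> powr (2 * p) * K) * source \<tau> j s \<omega>" by (simp add: K_def)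
          finally show "h s powr p \<le> (\<tau> powr (2 * p) * K) * source \<tau> j s \<omega>" .
        qed
        also have "integral {a..d} (\<lambda>s. (\<tau> powr (2 * p) * K) * source \<tau> j s \<omega>) = \<tau> powr (2 * p) * (K * integral {a..d} (\<lambda>s. source \<tau> j s \<omega>))"
          by simp
        finally show "norm (corrected_error \<tau> (Suc j) \<omega>) powr (2 * p)
           \<le> exp (c * \<tau>) * (norm (corrected_error \<tau> j \<omega>) powr (2 * p)
              + \<tau> powr (2 * p) * (K * integral {real j * \<tau>..real (Suc j) * \<tau>} (\<lambda>s. source \<tau> j s \<omega>)))"
          by (simp add: a_def d_def mult_left_mono)
      qed
    qed
  qed
qed

lemma corrected_error_measurable: "\<tau> \<in> {0<..<1} \<Longrightarrow> corrected_error \<tau> n \<in> borel_measurable M"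
  unfolding corrected_error_def[abs_def]
  by (intro borel_measurable_diff borel_measurable_scaleR borel_measurable_const X_meas Z_meas correction_measurable_M) auto

lemma corrected_error_moment:
  "\<exists>C>0. \<forall>\<tau>\<in>{0<..<1}. \<forall>n. mean_le M (\<lambda>\<omega>. norm (corrected_error \<tau> n \<omega>) powr (2 * p)) (\<tau> powr (2 * p) * growth C (real n * \<tau>))"
proof -
  obtain C1 where C1: "C1 > 0" and src: "\<forall>\<tau>\<in>{0<..<1}. \<forall>j. mean_le M (\<lambda>\<omega>. integral {real j * \<tau>..real (Suc j) * \<tau>} (\<lambda>s. source \<tau> j s \<omega>))
      (\<tau> * growth C1 (real (Suc j) * \<tau>))"
    using source_integral_mean by (elim exE conjE) (rule that)
  obtain c K where c: "c \<ge> 0" and K: "K \<ge> 0" and step: "\<forall>\<tau>\<in>{0<..<1}. AE \<omega> in M. \<forall>j. norm (corrected_error \<tau> (Suc j) \<omega>) powr (2 * p)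
     \<le> exp (c * \<tau>) * (norm (corrected_error \<tau> j \<omega>) powr (2 * p)
        + \<tau> powr (2 * p) * (K * integral {real j * \<tau>..real (Suc j) * \<tau>} (\<lambda>s. source \<tau> j s \<omega>)))"
    using error_step by (elim exE conjE) (rule that)
  define C2 where "C2 = K * C1 + C1"
  have C2: "0 < C2" unfolding C2_def using C1 K by (intro add_nonneg_pos mult_nonneg_nonneg) auto
  show ?thesis
  proof (intro exI[of _ "C2 + c + 2"] conjI ballI allI)
    show "0 < C2 + c + 2" using C2 c by simp
    fix \<tau> :: real and n assume \<tau>: "\<tau> \<in> {0<..<1}"
    have \<tau>0: "0 < \<tau>" using \<tau> by simp
    define t where "t = real n * \<tau>"
    have t0: "0 \<le> t" using \<tau> by (simp add: t_def)
    have "mean_le M (\<lambda>\<omega>. norm (corrected_error \<tau> n \<omega>) powr (2 * p)) (exp (c * (real n * \<tau>)) * (0 + real n * \<tau> * (\<tau> powr (2 * p) * growth C2 t)))"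
    proof (rule mean_le_gronwall[where f="\<lambda>j \<omega>. norm (corrected_error \<tau> j \<omega>) powr (2 * p)"])
      have "mean_le M (\<lambda>\<omega>. 0) 0" by (simp add: mean_le_def)
      then show "mean_le M (\<lambda>\<omega>. norm (corrected_error \<tau> 0 \<omega>) powr (2 * p)) 0"
      proof (rule mean_le_AE_mono)
        show "(\<lambda>\<omega>. norm (corrected_error \<tau> 0 \<omega>) powr (2 * p)) \<in> borel_measurable M"
          using corrected_error_measurable[OF \<tau>, of 0] by simp
        show "AE \<omega> in M. 0 \<le> norm (corrected_error \<tau> 0 \<omega>) powr (2 * p) \<and> norm (corrected_error \<tau> 0 \<omega>) powr (2 * p) \<le> 0"
          using X_derivative Z_step[OF \<tau>] by eventually_elim (simp add: corrected_error_def correction_def)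
      qed
      fix j a assume j: "j < n" and a: "mean_le M (\<lambda>\<omega>. norm (corrected_error \<tau> j \<omega>) powr (2 * p)) a"
      have jt: "0 \<le> real (Suc j) * \<tau>" "real (Suc j) * \<tau> \<le> t"
        using j \<tau>0 unfolding t_def by (auto intro!: mult_right_mono simp del: of_nat_Suc)
      have "mean_le M (\<lambda>\<omega>. exp (c * \<tau>) * (norm (corrected_error \<tau> j \<omega>) powr (2 * p)
        + \<tau> powr (2 * p) * (K * integral {real j * \<tau>..real (Suc j) * \<tau>} (\<lambda>s. source \<tau> j s \<omega>))))
        (exp (c * \<tau>) * (a + \<tau> powr (2 * p) * (K * (\<tau> * growth C1 (real (Suc j) * \<tau>)))))"
        using K by (intro mean_le_cmult mean_le_add a src[rule_format, OF \<tau>]) auto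
      then have "mean_le M (\<lambda>\<omega>. exp (c * \<tau>) * (norm (corrected_error \<tau> j \<omega>) powr (2 * p)
        + \<tau> powr (2 * p) * (K * integral {real j * \<tau>..real (Suc j) * \<tau>} (\<lambda>s. source \<tau> j s \<omega>))))
        (exp (c * \<tau>) * (a + \<tau> * (\<tau> powr (2 * p) * growth C2 t)))"
      proof (rule mean_le_mono)
        have "K * growth C1 (real (Suc j) * \<tau>) \<le> growth C2 (real (Suc j) * \<tau>)"
          unfolding C2_def by (rule growth_cmult) (use K C1 jt in auto)
        also have "\<dots> \<le> growth C2 t" using C2 jt by (intro growth_mono) auto
        finally have "(\<tau> powr (2 * p) * \<tau>) * (K * growth C1 (real (Suc j) * \<tau>)) \<le> (\<tau> powr (2 * p) * \<tau>) * growth C2 t"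
          using \<tau>0 by (intro mult_left_mono) auto
        then show "exp (c * \<tau>) * (a + \<tau> powr (2 * p) * (K * (\<tau> * growth C1 (real (Suc j) * \<tau>)))) \<le> exp (c * \<tau>) * (a + \<tau> * (\<tau> powr (2 * p) * growth C2 t))"
          by (intro mult_left_mono add_left_mono) (simp_all add: mult_ac)
      qed
      then show "mean_le M (\<lambda>\<omega>. norm (corrected_error \<tau> (Suc j) \<omega>) powr (2 * p)) (exp (c * \<tau>) * (a + \<tau> * (\<tau> powr (2 * p) * growth C2 t)))"
      proof (rule mean_le_AE_mono)
        show "(\<lambda>\<omega>. norm (corrected_error \<tau> (Suc j) \<omega>) powr (2 * p)) \<in> borel_measurable M"
          using corrected_error_measurable[OF \<tau>, of "Suc j"] by simp
        show "AE \<omega> in M. 0 \<le> norm (corrected_error \<tau> (Suc j) \<omega>) powr (2 * p) \<and> norm (corrected_error \<tau> (Suc j) \<omega>) powr (2 * p)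
         \<le> exp (c * \<tau>) * (norm (corrected_error \<tau> j \<omega>) powr (2 * p)
        + \<tau> powr (2 * p) * (K * integral {real j * \<tau>..real (Suc j) * \<tau>} (\<lambda>s. source \<tau> j s \<omega>)))"
          using step[rule_format, OF \<tau>] by eventually_elim (intro conjI powr_ge_zero, blast)
      qed
    qed (use c \<tau>0 growth_nonneg C2 in auto)
    then show "mean_le M (\<lambda>\<omega>. norm (corrected_error \<tau> n \<omega>) powr (2 * p)) (\<tau> powr (2 * p) * growth (C2 + c + 2) (real n * \<tau>))"
      unfolding t_def[symmetric]
    proof (rule mean_le_mono)
      have "exp (c * t) * (0 + t * growth C2 t) \<le> exp (c * t) * (\<mu> + t * growth C2 t)"
        using \<mu>_nonneg by (intro mult_left_mono) auto
      also have "\<dots> \<le> growth (C2 + c + 2) t" using c C2 t0 by (intro growth_accumulated) auto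
      finally have "\<tau> powr (2 * p) * (exp (c * t) * (0 + t * growth C2 t)) \<le> \<tau> powr (2 * p) * growth (C2 + c + 2) t"
        by (intro mult_left_mono) auto
      then show "exp (c * t) * (0 + t * (\<tau> powr (2 * p) * growth C2 t)) \<le> \<tau> powr (2 * p) * growth (C2 + c + 2) t"
        by (simp add: mult_ac)
    qed
  qed
qed

text \<open>Both \<open>corrected_error\<close> and \<open>\<tau> * correction\<close> are of order \<open>\<tau>\<close>.\<close>

lemma strong_error_moment:
  "\<exists>C>0. \<forall>\<tau>\<in>{0<..<1}. \<forall>n. mean_le M (\<lambda>\<omega>. norm (X (real n * \<tau>) \<omega> - Z \<tau> (real n * \<tau>) \<omega>) powr (2 * p))
     (\<tau> powr (2 * p) * growth C (real n * \<tau>))"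
proof -
  obtain C1 where C1: "C1 > 0" and E: "\<forall>\<tau>\<in>{0<..<1}. \<forall>n. mean_le M (\<lambda>\<omega>. norm (corrected_error \<tau> n \<omega>) powr (2 * p)) (\<tau> powr (2 * p) * growth C1 (real n * \<tau>))"
    using corrected_error_moment by (elim exE conjE) (rule that)
  obtain C2 where C2: "C2 > 0" and n: "\<forall>\<tau>\<in>{0<..<1}. \<forall>n. mean_le M (\<lambda>\<omega>. norm (correction \<tau> n \<omega>) powr (4 * p)) (growth C2 (real n * \<tau>))"
    using correction_moment by (elim exE conjE) (rule that)
  define D where "D = C1 + (1 + C2)"
  have D: "0 < D" using C1 C2 by (simp add: D_def)
  show ?thesis
  proof (intro exI[of _ "2 powr (2 * p) * D + D"] conjI ballI allI)
    show "0 < 2 powr (2 * p) * D + D" using D by (intro add_pos_pos mult_pos_pos) auto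
    fix \<tau> :: real and m assume \<tau>: "\<tau> \<in> {0<..<1}"
    define t where "t = real m * \<tau>"
    have t0: "0 \<le> t" using \<tau> by (simp add: t_def)
    have "mean_le M (\<lambda>\<omega>. 2 powr (2 * p) * (norm (corrected_error \<tau> m \<omega>) powr (2 * p) + \<tau> powr (2 * p) * (1 + norm (correction \<tau> m \<omega>) powr (4 * p))))
       (2 powr (2 * p) * (\<tau> powr (2 * p) * growth C1 t + \<tau> powr (2 * p) * (1 + growth C2 t)))"
      unfolding t_def by (intro mean_le_cmult mean_le_add mean_le_const E[rule_format, OF \<tau>] n[rule_format, OF \<tau>]) auto
    then have "mean_le M (\<lambda>\<omega>. 2 powr (2 * p) * (norm (corrected_error \<tau> m \<omega>) powr (2 * p) + \<tau> powr (2 * p) * (1 + norm (correction \<tau> m \<omega>) powr (4 * p))))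
       (\<tau> powr (2 * p) * growth (2 powr (2 * p) * D + D) t)"
    proof (rule mean_le_mono)
      have "growth C1 t + (1 + growth C2 t) \<le> growth C1 t + growth (1 + C2) t"
        using growth_const[of 1 t] growth_add[of 1 C2 t] C2 t0 by simp
      also have "\<dots> \<le> growth D t" unfolding D_def using C1 C2 t0 by (intro growth_add) auto
      finally have "2 powr (2 * p) * (growth C1 t + (1 + growth C2 t)) \<le> 2 powr (2 * p) * growth D t" by (intro mult_left_mono) auto
      also have "\<dots> \<le> growth (2 powr (2 * p) * D + D) t" using D t0 by (intro growth_cmult) auto
      finally have "\<tau> powr (2 * p) * (2 powr (2 * p) * (growth C1 t + (1 + growth C2 t))) \<le> \<tau> powr (2 * p) * growth (2 powr (2 * p) * D + D) t"
        by (intro mult_left_mono) auto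
      then show "2 powr (2 * p) * (\<tau> powr (2 * p) * growth C1 t + \<tau> powr (2 * p) * (1 + growth C2 t)) \<le> \<tau> powr (2 * p) * growth (2 powr (2 * p) * D + D) t"
        by (simp add: algebra_simps)
    qed
    then show "mean_le M (\<lambda>\<omega>. norm (X (real m * \<tau>) \<omega> - Z \<tau> (real m * \<tau>) \<omega>) powr (2 * p)) (\<tau> powr (2 * p) * growth (2 powr (2 * p) * D + D) (real m * \<tau>))"
      unfolding t_def[symmetric]
    proof (rule mean_le_AE_mono[OF _ _ AE_I2])
      show "(\<lambda>\<omega>. norm (X t \<omega> - Z \<tau> t \<omega>) powr (2 * p)) \<in> borel_measurable M"
        using X_meas[OF t0] Z_meas[OF \<tau> t0] by simp
      fix \<omega>
      let ?v = "norm (corrected_error \<tau> m \<omega>)" and ?n = "norm (correction \<tau> m \<omega>)"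
      have "X t \<omega> - Z \<tau> t \<omega> = corrected_error \<tau> m \<omega> + \<tau> *\<^sub>R correction \<tau> m \<omega>" by (simp add: corrected_error_def t_def)
      then have "norm (X t \<omega> - Z \<tau> t \<omega>) \<le> ?v + \<tau> * ?n"
        using norm_triangle_ineq[of "corrected_error \<tau> m \<omega>" "\<tau> *\<^sub>R correction \<tau> m \<omega>"] \<tau> by simp
      then have "norm (X t \<omega> - Z \<tau> t \<omega>) powr (2 * p) \<le> (?v + \<tau> * ?n) powr (2 * p)" using p by (intro powr_mono2) auto
      also have "\<dots> \<le> 2 powr (2 * p) * (?v powr (2 * p) + (\<tau> * ?n) powr (2 * p))"
        using p \<tau> by (intro powr_add_le) auto
      also have "(\<tau> * ?n) powr (2 * p) = \<tau> powr (2 * p) * ?n powr (2 * p)" by (rule powr_mult)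
      also have "?n powr (2 * p) \<le> 1 + ?n powr (4 * p)"
      proof (cases "?n \<le> 1")
        case True
        then have "?n powr (2 * p) \<le> 1" using p by (intro powr_le1) auto
        then show ?thesis by (simp add: add_increasing2)
      next
        case False
        then have "?n powr (2 * p) \<le> ?n powr (4 * p)" using p by (intro powr_mono) auto
        then show ?thesis by simp
      qed
      finally show "0 \<le> norm (X t \<omega> - Z \<tau> t \<omega>) powr (2 * p) \<and> norm (X t \<omega> - Z \<tau> t \<omega>) powr (2 * p)
        \<le> 2 powr (2 * p) * (?v powr (2 * p) + \<tau> powr (2 * p) * (1 + ?n powr (4 * p)))"
        by (simp add: mult_left_mono)
    qed
  qed
qed

end

theorem theorem4:
  fixes M :: "'a measure" and F :: "real \<Rightarrow> 'a measure"
    and W :: "real \<Rightarrow> 'a \<Rightarrow> real ^ 'm"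
    and b :: "real ^ 'd \<Rightarrow> real ^ 'd" and B :: "real ^ 'm ^ 'd"
    and p q r L0' L3' L4' L7 L8 L9 K1 K2 K3 K4 K5 K6 K7 K8 r2 :: real
    and X0 :: "'a \<Rightarrow> real ^ 'd" and X :: "real \<Rightarrow> 'a \<Rightarrow> real ^ 'd"
    and X\<tau> :: "real \<Rightarrow> real \<Rightarrow> 'a \<Rightarrow> real ^ 'd"
  assumes "complete_filtered_prob_space M F" and "wiener_process M F W"
    and "p \<ge> 2" and "q > 1"
    and "twice_differentiable b"
    and "L0' > 0" "L7 > 0" "L8 > 0" "L9 > 0" "L3' > 0" "L4' > 0"
    and "\<And>x y. 2 * ((x - y) \<bullet> (b x - b y)) \<le> L0' * (norm (x - y))\<^sup>2"
    and "\<And>x. 2 * (x \<bullet> b x) + (2 * p - 1) * (norm B)\<^sup>2 \<le> L7 + L8 * (norm x)\<^sup>2"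
    and "\<And>x y. norm (b x - b y) \<le> L9 * (1 + norm x + norm y) powr q * norm (x - y)"
    and "\<And>x y z. norm (second_deriv b x y z)
           \<le> (L4' * norm x powr (q - 1) + L3') * norm y * norm z"
    and "K1 > 0" "K2 > 0" "K3 > 0" "K4 > 0" "K5 > 0" "K6 > 0" "K7 > 0" "K8 > 0" "r > 0"
    and "\<And>x \<tau>. \<tau> \<in> {0<..<1} \<Longrightarrow>
           2 * (x \<bullet> tamed_drift q b \<tau> x) + (2 * p - 1) * (norm B)\<^sup>2 \<le> K1 + K2 * (norm x)\<^sup>2"
    and "\<And>x \<tau>. \<tau> \<in> {0<..<1} \<Longrightarrow>
           \<tau> * (norm (tamed_drift q b \<tau> x))\<^sup>2 \<le> K3 + K4 * (norm x)\<^sup>2"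
    and "\<And>x :: real ^ 'd. \<And>\<tau>. \<tau> \<in> {0<..<1} \<Longrightarrow>
           sqrt \<tau> * (norm B)\<^sup>2 \<le> K5 + K6 * (norm x)\<^sup>2"
    and "\<And>x \<tau>. \<tau> \<in> {0<..<1} \<Longrightarrow>
           (norm (b x - tamed_drift q b \<tau> x))\<^sup>2
             \<le> K7 * \<tau>\<^sup>2 * (1 + norm x powr r) * (norm (b x))\<^sup>2"
    and "r2 = max (q + 1 + r / 2) (2 * q + 1)"
    and "X0 \<in> borel_measurable (F 0)"
    and "integrable M (\<lambda>\<omega>. norm (X0 \<omega>) powr (2 * p * r2))"
    and "additive_noise_sde M F W (\<lambda>s \<omega>. b (X s \<omega>)) B X0 X"
    and "\<And>\<tau>. \<tau> \<in> {0<..<1} \<Longrightarrow>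
           additive_noise_sde M F W
             (\<lambda>s \<omega>. tamed_drift q b \<tau> (X\<tau> \<tau> (grid_floor \<tau> s) \<omega>)) B X0 (X\<tau> \<tau>)"
  shows "\<exists>C>0. \<forall>\<tau>\<in>{0<..<1}. \<forall>n::nat. n \<ge> 1 \<longrightarrow>
           (let t = real n * \<tau> in
              integrable M (\<lambda>\<omega>. norm (X t \<omega> - X\<tau> \<tau> t \<omega>) powr (2 * p)) \<and>
              (LINT \<omega>|M. norm (X t \<omega> - X\<tau> \<tau> t \<omega>) powr (2 * p))
                \<le> C * exp (C * t) * \<tau> powr (2 * p)
                    * (1 + C * t + (LINT \<omega>|M. norm (X0 \<omega>) powr (2 * p * r2))))"
proof -
  interpret tamed_scheme b q r L0' L3' L4' L9 K3 K4 K7 r2 M F W B p X0 X X\<tau>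
  proof
    show "norm (second_deriv b x y z) \<le> (L4' * norm x powr (q - 1) + L3') * norm y * norm z" for x y z
      by (rule assms(15))
    show "norm (b x - b y) \<le> L9 * (1 + norm x + norm y) powr q * norm (x - y)" for x y
      by (rule assms(14))
  qed (use assms in auto)
  obtain C where C: "C > 0" and E: "\<forall>\<tau>\<in>{0<..<1}. \<forall>n.
      mean_le M (\<lambda>\<omega>. norm (X (real n * \<tau>) \<omega> - X\<tau> \<tau> (real n * \<tau>) \<omega>) powr (2 * p))
        (\<tau> powr (2 * p) * growth C (real n * \<tau>))"
    using strong_error_moment by (elim exE conjE) (rule that)
  show ?thesis
    unfolding Let_def
  proof (intro exI[of _ C] conjI C ballI allI impI)
    fix \<tau> :: real and n :: nat
    assume \<tau>: "\<tau> \<in> {0<..<1}"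
    define t where "t = real n * \<tau>"
    have t: "0 \<le> t" using \<tau> by (simp add: t_def)
    have e: "mean_le M (\<lambda>\<omega>. norm (X t \<omega> - X\<tau> \<tau> t \<omega>) powr (2 * p)) (\<tau> powr (2 * p) * growth C t)"
      using E \<tau> unfolding t_def by blast
    show "integrable M (\<lambda>\<omega>. norm (X (real n * \<tau>) \<omega> - X\<tau> \<tau> (real n * \<tau>) \<omega>) powr (2 * p))"
      using e by (simp add: mean_le_def t_def)
    have "(LINT \<omega>|M. norm (X t \<omega> - X\<tau> \<tau> t \<omega>) powr (2 * p)) \<le> C * exp (C * t) * \<tau> powr (2 * p) * (1 + \<mu>)"
      using e by (simp add: mean_le_def growth_def mult_ac)
    also have "\<dots> \<le> C * exp (C * t) * \<tau> powr (2 * p) * (1 + C * t + \<mu>)"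
      using C t by (intro mult_left_mono) auto
    finally show "(LINT \<omega>|M. norm (X (real n * \<tau>) \<omega> - X\<tau> \<tau> (real n * \<tau>) \<omega>) powr (2 * p))
        \<le> C * exp (C * (real n * \<tau>)) * \<tau> powr (2 * p)
          * (1 + C * (real n * \<tau>) + (LINT \<omega>|M. norm (X0 \<omega>) powr (2 * p * r2)))"
      by (simp add: t_def \<mu>_def \<Lambda>_def)
  qed
qed

end
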